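(* Let $H$ be a locally compact group, let $K$ be a locally compact abelian (LCA) group, let $\tau:H\to \mathrm{Aut}(K)$ be a continuous homomorphism, and let $u\in L^2(K)$ be a window function. For $f\in L^2(G_\tau)$ define $$\mathcal{V}_uf(h,k,\omega):=\delta(h)^{1/2}\langle f_h,\varrho(k,\omega)u\rangle_{L^2(K)},\qquad (h,k,\omega)\in G_{\tau\times\widehat\tau}.$$ Then the $\tau\times\widehat{\tau}$-continuous Gabor transform $\mathcal{V}_u:L^2(G_\tau)\to L^2(G_{\tau\times\widehat{\tau}})$ is a (scalar) multiple of an isometric transform, and it maps $L^2(G_\tau)$ onto a closed subspace of $L^2(G_{\tau\times\widehat{\tau}})$.
   Context: $dh$ is a left Haar measure on $H$, $dk$ a Haar measure on $K$ (written additively); $\widehat{K}$ is the dual group and $d\omega$ is the Plancherel measure on $\widehat K$ (normalized so that the Fourier transform $\widehat v(\omega)=\int_K v(k)\overline{\omega(k)}\,dk$ extends to a unitary map $L^2(K)\to L^2(\widehat K)$). Continuity of $\tau$ means that $(h,k)\mapsto\tau_h(k)$ is continuous from $H\times K$ to $K$. Write $k^h:=\tau_h(k)$ and $\omega_h:=\omega\circ\tau_{h^{-1}}$. The continuous homomorphism $\delta:H\to(0,\infty)$ is determined by $dk=\delta(h)\,dk^h$, i.e. $\int_K v(\tau_h(k))\,dk=\delta(h)\int_K v(k)\,dk$ for $v\in L^1(K)$. $G_\tau=H\ltimes_\tau K$ is the semi-direct product (set $H\times K$, product topology, law $(h,k)(h',k')=(hh',k+\tau_h(k'))$) with left Haar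 measure $\delta(h)\,dh\,dk$. $G_{\tau\times\widehat\tau}=H\ltimes_{\tau\times\widehat\tau}(K\times\widehat K)$ has law $(h,k,\omega)(h',k',\omega')=(hh',k+k'^h,\omega\,\omega'_h)$ and left Haar measure $dh\,dk\,d\omega$. The $L^2$ spaces are taken with respect to these measures. For $f\in L^2(G_\tau)$, $f_h(k):=f(h,k)$, which lies in $L^2(K)$ for a.e. $h\in H$. The time-frequency shift is $[\varrho(k,\omega)u](y)=\omega(y)u(y-k)$. *)

theory Defs
  imports "HOL-Analysis.Analysis"
begin

section \<open>Conventions\<close>

text \<open>
  All groups are type-class groups. The class \<^class>\<open>topological_group_add\<close> does not
  assume commutativity, so an arbitrary topological group H is written additively:
  h + h' is the product of h and h', and - h is the inverse of h. Locally compact groups are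
  Hausdorff.
\<close>


section \<open>The dual group\<close>

typedef (overloaded) 'k dual =
  "{\<omega> :: 'k::topological_ab_group_add \<Rightarrow> complex.
      continuous_on UNIV \<omega> \<and> (\<forall>x. cmod (\<omega> x) = 1) \<and> (\<forall>x y. \<omega> (x + y) = \<omega> x * \<omega> y)}"
  morphisms char_eval Abs_dual
  by (rule exI[of _ "\<lambda>_. 1"]) simp

setup_lifting type_definition_dual

text \<open>The group law is pointwise multiplication; it is written additively, so that products
  such as K times its dual are groups by the library instances.\<close>

instantiation dual :: (topological_ab_group_add) ab_group_add
begin

lift_definition zero_dual :: "'a dual" is "\<lambda>_. 1"
  by simp

lift_definition plus_dual :: "'a dual \<Rightarrow> 'a dual \<Rightarrow> 'a dual" is "\<lambda>\<omega> \<omega>' x. \<omega> x * \<omega>' x"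
  by (auto intro!: continuous_intros simp: norm_mult)

lift_definition uminus_dual :: "'a dual \<Rightarrow> 'a dual" is "\<lambda>\<omega> x. cnj (\<omega> x)"
  by (auto intro!: continuous_intros)

definition minus_dual :: "'a dual \<Rightarrow> 'a dual \<Rightarrow> 'a dual"
  where "minus_dual \<omega> \<omega>' = \<omega> + - \<omega>'"

instance
proof
  fix a b c :: "'a dual"
  show "a + b + c = a + (b + c)" by transfer (simp add: mult.assoc)
  show "a + b = b + a" by transfer (simp add: mult.commute)
  show "0 + a = a" by transfer simp
  show "- a + a = 0"
    by transfer (auto simp: fun_eq_iff mult.commute[of "cnj _"] complex_norm_square[symmetric])
  show "a - b = a + - b" by (simp add: minus_dual_def)
qed

end

text \<open>The topology of uniform convergence on compact sets, as the compact-open topology.\<close>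

instantiation dual :: (topological_ab_group_add) topological_space
begin

definition open_dual :: "'a dual set \<Rightarrow> bool"
  where "open_dual = generate_topology
    {{\<omega>. char_eval \<omega> ` C \<subseteq> U} | C U. compact C \<and> open U}"

instance
  by standard (auto simp: open_dual_def intro: generate_topology.intros)

end


section \<open>Radon and Haar measures\<close>

text \<open>
  Radon measures are complete, locally determined, locally finite Borel measures that are
  inner regular with respect to compact sets on all measurable sets. On a sigma-compact group
  this is the completion of the usual Borel Haar measure. In general this convention differs from
  outer regularity on Borel sets in that locally null sets are null; the spaces
  of square-integrable functions modulo null functions are the same. No countability assumption
  is made on the groups, and without this convention the pointwise formula for the Gabor transform
  would not respect null functions.
\<close>

definition radon_measure :: "'a::topological_space measure \<Rightarrow> bool"
  where "radon_measure \<mu> \<longleftrightarrow>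
    cld_measure \<mu> \<and> sets borel \<subseteq> sets \<mu> \<and>
    (\<forall>x. \<exists>U. open U \<and> x \<in> U \<and> emeasure \<mu> U < \<infinity>) \<and>
    (\<forall>E\<in>sets \<mu>. emeasure \<mu> E = (SUP C\<in>{C. compact C \<and> C \<subseteq> E}. emeasure \<mu> C))"

text \<open>The group law is an argument, because semi-direct products live on product types
  whose type-class addition is the componentwise one.\<close>

definition left_haar_measure ::
    "('a \<Rightarrow> 'a \<Rightarrow> 'a) \<Rightarrow> 'a::topological_space measure \<Rightarrow> bool"
  where "left_haar_measure law \<mu> \<longleftrightarrow>
    radon_measure \<mu> \<and> emeasure \<mu> UNIV \<noteq> 0 \<and>
    (\<forall>x. \<forall>E\<in>sets borel. emeasure \<mu> (law x ` E) = emeasure \<mu> E)"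

definition Cc_fun :: "('a::topological_space \<Rightarrow> real) set"
  where "Cc_fun = {\<phi>. continuous_on UNIV \<phi> \<and> compact (closure {x. \<phi> x \<noteq> 0})}"

text \<open>The Radon measure representing a functional on compactly supported continuous functions.
  Iterated expressions such as dh dk denote measures in this sense;
  the library's product measures are not suitable without sigma-finiteness
  and second countability.\<close>

definition radon_measure_of ::
    "(('a::topological_space \<Rightarrow> real) \<Rightarrow> real) \<Rightarrow> 'a measure \<Rightarrow> bool"
  where "radon_measure_of I \<mu> \<longleftrightarrow>
    radon_measure \<mu> \<and> (\<forall>\<phi>\<in>Cc_fun. (LINT x|\<mu>. \<phi> x) = I \<phi>)"


section \<open>Square-integrable functions\<close>

text \<open>Elements of the space are functions; equality is equality almost everywhere.\<close>

definition L2 :: "'a measure \<Rightarrow> ('a \<Rightarrow> complex) set"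
  where "L2 M = {f. f \<in> borel_measurable M \<and> integrable M (\<lambda>x. (cmod (f x))\<^sup>2)}"

definition L2_norm :: "'a measure \<Rightarrow> ('a \<Rightarrow> complex) \<Rightarrow> real"
  where "L2_norm M f = sqrt (LINT x|M. (cmod (f x))\<^sup>2)"

definition L2_inner :: "'a measure \<Rightarrow> ('a \<Rightarrow> complex) \<Rightarrow> ('a \<Rightarrow> complex) \<Rightarrow> complex"
  where "L2_inner M f g = (LINT x|M. f x * cnj (g x))"

definition L2_isometry ::
    "'a measure \<Rightarrow> 'b measure \<Rightarrow> (('a \<Rightarrow> complex) \<Rightarrow> 'b \<Rightarrow> complex) \<Rightarrow> bool"
  where "L2_isometry M N J \<longleftrightarrow>
    (\<forall>f\<in>L2 M. J f \<in> L2 N) \<and>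
    (\<forall>f\<in>L2 M. \<forall>g\<in>L2 M. AE x in N. J (\<lambda>y. f y + g y) x = J f x + J g x) \<and>
    (\<forall>c. \<forall>f\<in>L2 M. AE x in N. J (\<lambda>y. c * f y) x = c * J f x) \<and>
    (\<forall>f\<in>L2 M. L2_norm N (J f) = L2_norm M f)"

definition L2_unitary ::
    "'a measure \<Rightarrow> 'b measure \<Rightarrow> (('a \<Rightarrow> complex) \<Rightarrow> 'b \<Rightarrow> complex) \<Rightarrow> bool"
  where "L2_unitary M N J \<longleftrightarrow>
    L2_isometry M N J \<and> (\<forall>g\<in>L2 N. \<exists>f\<in>L2 M. AE x in N. J f x = g x)"

definition multiple_of_L2_isometry ::
    "'a measure \<Rightarrow> 'b measure \<Rightarrow> (('a \<Rightarrow> complex) \<Rightarrow> 'b \<Rightarrow> complex) \<Rightarrow> bool"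
  where "multiple_of_L2_isometry M N T \<longleftrightarrow>
    (\<exists>c J. L2_isometry M N J \<and> (\<forall>f\<in>L2 M. AE x in N. T f x = c * J f x))"

definition L2_closed_subspace :: "'a measure \<Rightarrow> ('a \<Rightarrow> complex) set \<Rightarrow> bool"
  where "L2_closed_subspace M S \<longleftrightarrow>
    S \<subseteq> L2 M \<and>
    (\<exists>z\<in>S. AE x in M. z x = 0) \<and>
    (\<forall>f\<in>S. \<forall>g\<in>S. \<exists>s\<in>S. AE x in M. s x = f x + g x) \<and>
    (\<forall>c. \<forall>f\<in>S. \<exists>s\<in>S. AE x in M. s x = c * f x) \<and>
    (\<forall>F. \<forall>g\<in>L2 M. (\<forall>n::nat. F n \<in> S) \<and> (\<lambda>n. L2_norm M (\<lambda>x. F n x - g x)) \<longlonglongrightarrow> 0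
      \<longrightarrow> (\<exists>s\<in>S. AE x in M. s x = g x))"


section \<open>Fourier transform and Plancherel measure\<close>

definition fourier :: "'k::topological_ab_group_add measure \<Rightarrow> ('k \<Rightarrow> complex) \<Rightarrow> 'k dual \<Rightarrow> complex"
  where "fourier \<mu>K v \<omega> = (LINT k|\<mu>K. v k * cnj (char_eval \<omega> k))"

definition plancherel_measure ::
    "'k::topological_ab_group_add measure \<Rightarrow> 'k dual measure \<Rightarrow> bool"
  where "plancherel_measure \<mu>K \<nu> \<longleftrightarrow>
    left_haar_measure (+) \<nu> \<and>
    (\<exists>F. L2_unitary \<mu>K \<nu> F \<and>
       (\<forall>v. integrable \<mu>K v \<and> v \<in> L2 \<mu>K \<longrightarrow> (AE \<omega> in \<nu>. F v \<omega> = fourier \<mu>K v \<omega>)))"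


section \<open>Semi-direct products\<close>

definition topological_automorphisms :: "('k::{topological_space, plus} \<Rightarrow> 'k) set"
  where "topological_automorphisms =
    {\<alpha>. bij \<alpha> \<and> continuous_on UNIV \<alpha> \<and> continuous_on UNIV (inv \<alpha>) \<and>
        (\<forall>x y. \<alpha> (x + y) = \<alpha> x + \<alpha> y)}"

definition continuous_hom_to_Aut ::
    "('h::{topological_space, plus} \<Rightarrow> 'k::{topological_space, plus} \<Rightarrow> 'k) \<Rightarrow> bool"
  where "continuous_hom_to_Aut \<tau> \<longleftrightarrow>
    (\<forall>h. \<tau> h \<in> topological_automorphisms) \<and>
    (\<forall>h h'. \<tau> (h + h') = \<tau> h \<circ> \<tau> h') \<and>
    continuous_on UNIV (\<lambda>(h, k). \<tau> h k)"

definition semidirect ::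
    "('h::plus \<Rightarrow> 'n::plus \<Rightarrow> 'n) \<Rightarrow> 'h \<times> 'n \<Rightarrow> 'h \<times> 'n \<Rightarrow> 'h \<times> 'n"
  where "semidirect \<alpha> = (\<lambda>(h, n) (h', n'). (h + h', n + \<alpha> h n'))"

definition dual_action ::
    "('h::uminus \<Rightarrow> 'k::topological_ab_group_add \<Rightarrow> 'k) \<Rightarrow> 'h \<Rightarrow> 'k dual \<Rightarrow> 'k dual"
  where "dual_action \<tau> h \<omega> = Abs_dual (char_eval \<omega> \<circ> \<tau> (- h))"

lemma char_eval_dual_action:
  assumes "continuous_hom_to_Aut \<tau>"
  shows "char_eval (dual_action \<tau> h \<omega>) = char_eval \<omega> \<circ> \<tau> (- h)"
proof -
  have *: "continuous_on UNIV (\<tau> (- h))" "\<And>x y. \<tau> (- h) (x + y) = \<tau> (- h) x + \<tau> (- h) y"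
    using assms by (auto simp: continuous_hom_to_Aut_def topological_automorphisms_def)
  have "continuous_on UNIV (char_eval \<omega> \<circ> \<tau> (- h))"
    using * char_eval[of \<omega>]
    by (intro continuous_on_compose) (auto intro: continuous_on_subset)
  then show ?thesis
    unfolding dual_action_def using * char_eval[of \<omega>] by (subst Abs_dual_inverse) auto
qed

definition product_action ::
    "('h::uminus \<Rightarrow> 'k::topological_ab_group_add \<Rightarrow> 'k) \<Rightarrow> 'h \<Rightarrow> 'k \<times> 'k dual \<Rightarrow> 'k \<times> 'k dual"
  where "product_action \<tau> h = (\<lambda>(k, \<omega>). (\<tau> h k, dual_action \<tau> h \<omega>))"

definition is_modulus ::
    "'k measure \<Rightarrow> ('h::{topological_space, plus} \<Rightarrow> 'k \<Rightarrow> 'k) \<Rightarrow> ('h \<Rightarrow> real) \<Rightarrow> bool"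
  where "is_modulus \<mu>K \<tau> \<delta> \<longleftrightarrow>
    (\<forall>h. 0 < \<delta> h) \<and> (\<forall>h h'. \<delta> (h + h') = \<delta> h * \<delta> h') \<and> continuous_on UNIV \<delta> \<and>
    (\<forall>h. \<forall>v :: 'k \<Rightarrow> complex. integrable \<mu>K v \<longrightarrow>
       (LINT k|\<mu>K. v (\<tau> h k)) = complex_of_real (\<delta> h) * (LINT k|\<mu>K. v k))"

text \<open>The left Haar measure \<delta>(h) dh dk of the semi-direct product of H and K.\<close>

definition haar_semidirect ::
    "'h::{topological_space, plus} measure \<Rightarrow> 'k::{topological_space, plus} measure \<Rightarrow>
     ('h \<Rightarrow> 'k \<Rightarrow> 'k) \<Rightarrow> ('h \<Rightarrow> real) \<Rightarrow> ('h \<times> 'k) measure \<Rightarrow> bool"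
  where "haar_semidirect \<mu>H \<mu>K \<tau> \<delta> \<mu> \<longleftrightarrow>
    left_haar_measure (semidirect \<tau>) \<mu> \<and>
    radon_measure_of (\<lambda>\<phi>. LINT h|\<mu>H. \<delta> h * (LINT k|\<mu>K. \<phi> (h, k))) \<mu>"

text \<open>The left Haar measure dh dk d\<omega> of the semi-direct product of H and K times its dual.\<close>

definition haar_semidirect_dual ::
    "'h::{topological_space, plus, uminus} measure \<Rightarrow> 'k::topological_ab_group_add measure \<Rightarrow>
     'k dual measure \<Rightarrow> ('h \<Rightarrow> 'k \<Rightarrow> 'k) \<Rightarrow> ('h \<times> 'k \<times> 'k dual) measure \<Rightarrow> bool"
  where "haar_semidirect_dual \<mu>H \<mu>K \<nu> \<tau> \<mu> \<longleftrightarrow>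
    left_haar_measure (semidirect (product_action \<tau>)) \<mu> \<and>
    radon_measure_of (\<lambda>\<phi>. LINT h|\<mu>H. LINT k|\<mu>K. LINT \<omega>|\<nu>. \<phi> (h, k, \<omega>)) \<mu>"


section \<open>The Gabor transform\<close>

definition tf_shift ::
    "'k::topological_ab_group_add \<Rightarrow> 'k dual \<Rightarrow> ('k \<Rightarrow> complex) \<Rightarrow> 'k \<Rightarrow> complex"
  where "tf_shift k \<omega> u = (\<lambda>y. char_eval \<omega> y * u (y - k))"

text \<open>For a square-integrable f the integrand of the inner product is integrable for almost
  all (h, k, \<omega>); on the remaining null set the value is irrelevant.\<close>

definition gabor_transform ::
    "'k::topological_ab_group_add measure \<Rightarrow> ('h \<Rightarrow> real) \<Rightarrow> ('k \<Rightarrow> complex) \<Rightarrow>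
     ('h \<times> 'k \<Rightarrow> complex) \<Rightarrow> 'h \<times> 'k \<times> 'k dual \<Rightarrow> complex"
  where "gabor_transform \<mu>K \<delta> u f = (\<lambda>(h, k, \<omega>).
    complex_of_real (sqrt (\<delta> h)) * L2_inner \<mu>K (\<lambda>y. f (h, y)) (tf_shift k \<omega> u))"

end

theory Submission
  imports Defs
begin

text \<open>
  For fixed h and k the function \<omega> \<mapsto> V_u f(h, k, \<omega>) is \<delta>(h)^(1/2) times the Fourier transform of
  f_h times the conjugate of a translate of u. By Plancherel's theorem its squared norm is \<delta>(h) times the
  integral of |f_h(y)|^2 |u(y - k)|^2 over y. Integration over k, by translation and
  inversion invariance of Haar measure on K, gives \<delta>(h) times the product of the squared norms of u
  and f_h, and integration over h gives the product of the squared norms of u and f. So V_u is the norm of u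
  times an isometry, and its range is closed because L2 is complete.

  The groups need not be sigma-compact, and the measures on the semi-direct products are only given through
  iterated integrals of compactly supported continuous functions. The computation is
  therefore made for such f and u (\<open>gabor_transform_Cc\<close>), where Fubini's theorem on K times K can be proved
  by finite partitions (\<open>Cc_Fubini\<close>), and where the passage from cutoffs in \<omega> to the full integral
  is an argument of Dini's type. The cutoffs exist because the dual group is locally compact,
  which follows from its having a Haar measure (\<open>locally_compact_of_haar\<close>).

  For general f and u choose approximants F n and U n in Cc whose L2 distances to f and u decay geometrically. The main
  step is that V_(U n) (F n) converges to V_u f almost everywhere (\<open>gabor_transform_AE_limit\<close>); membership in L2, the
  norm, and additivity are then limits of the corresponding facts for Cc.
  In the absence of sigma-finiteness the sections f_h can be non-measurable for every h. But u vanishes almost everywhere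
  outside a sigma-compact set, so that V_u f on a compact set of points (h, k, \<omega>) depends only on the
  restriction of f to a set whose sections lie in one sigma-compact subset of K. There, null
  sets have null sections for almost every h (\<open>AE_null_sections\<close>). Conversely a null set of h lifts to
  a null set of points (h, k, \<omega>) (\<open>null_cylinder\<close>). Both statements are proved on compact sets, which suffices
  because for the Radon measures considered here a set is null as soon as its intersections
  with compact sets are (\<open>null_local\<close>).
\<close>

section \<open>Square-integrable functions\<close>

lemma L2_measurable: "f \<in> L2 M \<Longrightarrow> f \<in> borel_measurable M"
  by (simp add: L2_def)

lemma L2_integrable: "f \<in> L2 M \<Longrightarrow> integrable M (\<lambda>x. (cmod (f x))\<^sup>2)"
  by (simp add: L2_def)

lemma L2_iff_nn_integral:
  "f \<in> L2 M \<longleftrightarrow> f \<in> borel_measurable M \<and> (\<integral>\<^sup>+x. ennreal ((cmod (f x))\<^sup>2) \<partial>M) < \<infinity>"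
  by (auto simp: L2_def integrable_iff_bounded)

lemma L2_norm_nonneg [simp]: "0 \<le> L2_norm M f"
  by (simp add: L2_norm_def)

lemma L2_norm_power2: "(L2_norm M f)\<^sup>2 = (LINT x|M. (cmod (f x))\<^sup>2)"
  by (simp add: L2_norm_def)

lemma nn_integral_L2:
  assumes "f \<in> L2 M"
  shows "(\<integral>\<^sup>+x. ennreal ((cmod (f x))\<^sup>2) \<partial>M) = ennreal ((L2_norm M f)\<^sup>2)"
  using assms by (subst nn_integral_eq_integral) (auto simp: L2_def L2_norm_power2)

lemma L2_norm_le_nn_integral:
  assumes "f \<in> borel_measurable M" "(\<integral>\<^sup>+x. ennreal ((cmod (f x))\<^sup>2) \<partial>M) \<le> ennreal (e\<^sup>2)" "0 \<le> e"
  shows "f \<in> L2 M" "L2_norm M f \<le> e"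
proof -
  show f: "f \<in> L2 M"
    using assms by (auto simp: L2_iff_nn_integral intro: le_less_trans)
  have "ennreal ((L2_norm M f)\<^sup>2) \<le> ennreal (e\<^sup>2)"
    using assms(2) nn_integral_L2[OF f] by simp
  then show "L2_norm M f \<le> e"
    using assms(3) power2_le_imp_le by auto
qed

lemma L2_zero [simp]: "(\<lambda>x. 0) \<in> L2 M" "L2_norm M (\<lambda>x. 0) = 0"
  by (auto simp: L2_def L2_norm_def)

lemma L2_cmult:
  assumes "f \<in> L2 M"
  shows "(\<lambda>x. c * f x) \<in> L2 M" "L2_norm M (\<lambda>x. c * f x) = cmod c * L2_norm M f"
proof -
  show "(\<lambda>x. c * f x) \<in> L2 M"
    using assms by (auto simp: L2_def norm_mult power_mult_distrib)
  show "L2_norm M (\<lambda>x. c * f x) = cmod c * L2_norm M f"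
    by (simp add: L2_norm_def norm_mult power_mult_distrib real_sqrt_mult)
qed

lemma L2_AE_cong:
  assumes "f \<in> L2 M" "g \<in> borel_measurable M" "AE x in M. f x = g x"
  shows "g \<in> L2 M" "L2_norm M g = L2_norm M f"
proof -
  have eq: "AE x in M. (cmod (f x))\<^sup>2 = (cmod (g x))\<^sup>2"
    using assms(3) by eventually_elim simp
  show g: "g \<in> L2 M"
    using assms integrable_cong_AE_imp[of M "\<lambda>x. (cmod (f x))\<^sup>2" "\<lambda>x. (cmod (g x))\<^sup>2"] eq
    by (auto simp: L2_def eq_commute)
  show "L2_norm M g = L2_norm M f"
    unfolding L2_norm_def using assms(1) g eq
    by (intro arg_cong[of _ _ sqrt] integral_cong_AE) (auto simp: L2_def)
qed

lemma L2_norm_eq_0: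
  assumes "f \<in> L2 M"
  shows "L2_norm M f = 0 \<longleftrightarrow> (AE x in M. f x = 0)"
  using assms by (simp add: L2_norm_def L2_def integral_nonneg_eq_0_iff_AE)

lemma L2_add:
  assumes "f \<in> L2 M" "g \<in> L2 M"
  shows "(\<lambda>x. f x + g x) \<in> L2 M"
proof -
  have "integrable M (\<lambda>x. 2 * (cmod (f x))\<^sup>2 + 2 * (cmod (g x))\<^sup>2)"
    using assms by (auto simp: L2_def)
  moreover have "norm ((cmod (f x + g x))\<^sup>2) \<le> norm (2 * (cmod (f x))\<^sup>2 + 2 * (cmod (g x))\<^sup>2)" for x
  proof -
    have "(cmod (f x + g x))\<^sup>2 \<le> (cmod (f x) + cmod (g x))\<^sup>2"
      by (simp add: norm_triangle_ineq power_mono)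
    also have "\<dots> \<le> 2 * (cmod (f x))\<^sup>2 + 2 * (cmod (g x))\<^sup>2"
      using sum_squares_bound[of "cmod (f x)" "cmod (g x)"] by (simp add: power2_sum)
    finally show ?thesis by simp
  qed
  moreover have [measurable]: "f \<in> borel_measurable M" "g \<in> borel_measurable M"
    using assms by (auto simp: L2_def)
  ultimately have "integrable M (\<lambda>x. (cmod (f x + g x))\<^sup>2)"
    using Bochner_Integration.integrable_bound[of M "\<lambda>x. 2 * (cmod (f x))\<^sup>2 + 2 * (cmod (g x))\<^sup>2"
      "\<lambda>x. (cmod (f x + g x))\<^sup>2"] by (simp del: norm_power real_norm_def)
  then show ?thesis
    by (simp add: L2_def)
qed

lemma L2_uminus: "f \<in> L2 M \<Longrightarrow> (\<lambda>x. - f x) \<in> L2 M"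
  by (simp add: L2_def)

lemma L2_diff: "f \<in> L2 M \<Longrightarrow> g \<in> L2 M \<Longrightarrow> (\<lambda>x. f x - g x) \<in> L2 M"
  using L2_add[of f M "\<lambda>x. - g x"] L2_uminus[of g M] by simp

lemma L2_norm_minus_commute: "L2_norm M (\<lambda>x. f x - g x) = L2_norm M (\<lambda>x. g x - f x)"
  by (simp add: L2_norm_def norm_minus_commute)

lemma L2_product:
  assumes f: "f \<in> L2 M" and g: "g \<in> L2 M"
  shows "integrable M (\<lambda>x. f x * g x)" "(LINT x|M. cmod (f x) * cmod (g x)) \<le> L2_norm M f * L2_norm M g"
proof -
  have [measurable]: "f \<in> borel_measurable M" "g \<in> borel_measurable M"
    using assms by (auto simp: L2_def)
  let ?I = "\<integral>\<^sup>+x. ennreal (cmod (f x) * cmod (g x)) \<partial>M"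
  have "?I\<^sup>2 \<le> (\<integral>\<^sup>+x. ennreal ((cmod (f x))\<^sup>2) \<partial>M) * (\<integral>\<^sup>+x. ennreal ((cmod (g x))\<^sup>2) \<partial>M)"
    using Cauchy_Schwarz_nn_integral[of "\<lambda>x. ennreal (cmod (f x))" M "\<lambda>x. ennreal (cmod (g x))"]
    by (simp add: ennreal_power flip: ennreal_mult)
  also have "\<dots> = ennreal ((L2_norm M f * L2_norm M g)\<^sup>2)"
    unfolding nn_integral_L2[OF f] nn_integral_L2[OF g] by (simp add: power_mult_distrib flip: ennreal_mult)
  finally have le: "?I\<^sup>2 \<le> ennreal ((L2_norm M f * L2_norm M g)\<^sup>2)" .
  then have "?I\<^sup>2 < top"
    by (rule le_less_trans) simp
  then have "?I < \<infinity>"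
    by (simp add: power_less_top_ennreal)
  then have int: "integrable M (\<lambda>x. cmod (f x) * cmod (g x))"
    by (intro integrableI_bounded) auto
  then show "integrable M (\<lambda>x. f x * g x)"
    by (rule Bochner_Integration.integrable_bound) (auto simp: norm_mult)
  have "?I = ennreal (LINT x|M. cmod (f x) * cmod (g x))"
    using int by (intro nn_integral_eq_integral) auto
  with le have "ennreal ((LINT x|M. cmod (f x) * cmod (g x))\<^sup>2) \<le> ennreal ((L2_norm M f * L2_norm M g)\<^sup>2)"
    by (simp add: ennreal_power)
  then show "(LINT x|M. cmod (f x) * cmod (g x)) \<le> L2_norm M f * L2_norm M g"
    by (auto intro: power2_le_imp_le)
qed

lemma L2_inner_Cauchy_Schwarz:
  assumes f: "f \<in> L2 M" and g: "g \<in> L2 M"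
  shows "integrable M (\<lambda>x. f x * cnj (g x))" "cmod (L2_inner M f g) \<le> L2_norm M f * L2_norm M g"
proof -
  have g': "(\<lambda>x. cnj (g x)) \<in> L2 M" "L2_norm M (\<lambda>x. cnj (g x)) = L2_norm M g"
    using g by (auto simp: L2_def L2_norm_def intro: borel_measurable_continuous_on[OF continuous_on_cnj[OF continuous_on_id]])
  show "integrable M (\<lambda>x. f x * cnj (g x))"
    using L2_product(1)[OF f g'(1)] .
  have "cmod (L2_inner M f g) \<le> (LINT x|M. cmod (f x * cnj (g x)))"
    unfolding L2_inner_def by (rule integral_norm_bound)
  then show "cmod (L2_inner M f g) \<le> L2_norm M f * L2_norm M g"
    using L2_product(2)[OF f g'(1)] g'(2) by (simp add: norm_mult)
qed

lemma L2_norm_triangle: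
  assumes f: "f \<in> L2 M" and g: "g \<in> L2 M"
  shows "L2_norm M (\<lambda>x. f x + g x) \<le> L2_norm M f + L2_norm M g"
proof -
  note int = L2_integrable[OF f] L2_integrable[OF g] L2_integrable[OF L2_add[OF f g]]
    integrable_norm[OF L2_product(1)[OF f g], unfolded norm_mult]
  have "(L2_norm M (\<lambda>x. f x + g x))\<^sup>2 = (LINT x|M. (cmod (f x + g x))\<^sup>2)"
    by (rule L2_norm_power2)
  also have "\<dots> \<le> (LINT x|M. (cmod (f x))\<^sup>2 + (cmod (g x))\<^sup>2 + 2 * (cmod (f x) * cmod (g x)))"
  proof (rule integral_mono)
    show "(cmod (f x + g x))\<^sup>2 \<le> (cmod (f x))\<^sup>2 + (cmod (g x))\<^sup>2 + 2 * (cmod (f x) * cmod (g x))" for x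
      using power_mono[OF norm_triangle_ineq[of "f x" "g x"], of 2] by (simp add: power2_sum)
  qed (intro int Bochner_Integration.integrable_add integrable_mult_right)+
  also have "\<dots> = (L2_norm M f)\<^sup>2 + (L2_norm M g)\<^sup>2 + 2 * (LINT x|M. cmod (f x) * cmod (g x))"
    using int by (simp add: L2_norm_power2)
  also have "\<dots> \<le> (L2_norm M f)\<^sup>2 + (L2_norm M g)\<^sup>2 + 2 * (L2_norm M f * L2_norm M g)"
    using L2_product(2)[OF f g] by simp
  also have "\<dots> = (L2_norm M f + L2_norm M g)\<^sup>2"
    by (simp add: power2_sum)
  finally show ?thesis
    by (rule power2_le_imp_le) simp
qed

lemma L2_norm_diff_triangle:
  assumes "f \<in> L2 M" "g \<in> L2 M" "k \<in> L2 M"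
  shows "L2_norm M (\<lambda>x. f x - k x) \<le> L2_norm M (\<lambda>x. f x - g x) + L2_norm M (\<lambda>x. g x - k x)"
  using L2_norm_triangle[OF L2_diff[OF assms(1,2)] L2_diff[OF assms(2,3)]] by simp

lemma L2_norm_diff_abs:
  assumes "f \<in> L2 M" "g \<in> L2 M"
  shows "\<bar>L2_norm M f - L2_norm M g\<bar> \<le> L2_norm M (\<lambda>x. f x - g x)"
  using L2_norm_diff_triangle[OF assms L2_zero(1)] L2_norm_diff_triangle[OF assms(2,1) L2_zero(1)]
  by (simp add: L2_norm_minus_commute[of M g f])

lemma L2_norm_tendsto:
  assumes "\<And>n. F n \<in> L2 M" "f \<in> L2 M" "(\<lambda>n. L2_norm M (\<lambda>x. F n x - f x)) \<longlonglongrightarrow> 0"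
  shows "(\<lambda>n. L2_norm M (F n)) \<longlonglongrightarrow> L2_norm M f"
proof (rule LIM_zero_cancel, rule tendsto_rabs_zero_cancel, rule tendsto_sandwich[OF _ _ tendsto_const assms(3)])
  show "\<forall>\<^sub>F n in sequentially. \<bar>L2_norm M (F n) - L2_norm M f\<bar> \<le> L2_norm M (\<lambda>x. F n x - f x)"
    using L2_norm_diff_abs[OF assms(1,2)] by simp
qed simp

lemma L2_inner_tendsto:
  assumes F: "\<And>n. F n \<in> L2 M" "f \<in> L2 M" "(\<lambda>n. L2_norm M (\<lambda>x. F n x - f x)) \<longlonglongrightarrow> 0"
    and G: "\<And>n. G n \<in> L2 M" "g \<in> L2 M" "(\<lambda>n. L2_norm M (\<lambda>x. G n x - g x)) \<longlonglongrightarrow> 0"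
  shows "(\<lambda>n. L2_inner M (F n) (G n)) \<longlonglongrightarrow> L2_inner M f g"
proof -
  have le: "cmod (L2_inner M (F n) (G n) - L2_inner M f g) \<le>
      L2_norm M (\<lambda>x. F n x - f x) * L2_norm M (G n) + L2_norm M f * L2_norm M (\<lambda>x. G n x - g x)" for n
  proof -
    have "L2_inner M (F n) (G n) - L2_inner M f g =
      L2_inner M (\<lambda>x. F n x - f x) (G n) + L2_inner M f (\<lambda>x. G n x - g x)"
      unfolding L2_inner_def left_diff_distrib complex_cnj_diff right_diff_distrib
      using L2_inner_Cauchy_Schwarz(1)[OF F(1) G(1), of n n] L2_inner_Cauchy_Schwarz(1)[OF F(2) G(1), of n]
        L2_inner_Cauchy_Schwarz(1)[OF F(2) G(2)] by simp
    also have "cmod \<dots> \<le> cmod (L2_inner M (\<lambda>x. F n x - f x) (G n)) + cmod (L2_inner M f (\<lambda>x. G n x - g x))"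
      by (rule norm_triangle_ineq)
    also have "\<dots> \<le> L2_norm M (\<lambda>x. F n x - f x) * L2_norm M (G n) + L2_norm M f * L2_norm M (\<lambda>x. G n x - g x)"
      by (intro add_mono L2_inner_Cauchy_Schwarz L2_diff F G)
    finally show ?thesis .
  qed
  have "(\<lambda>n. L2_norm M (\<lambda>x. F n x - f x) * L2_norm M (G n) + L2_norm M f * L2_norm M (\<lambda>x. G n x - g x))
     \<longlonglongrightarrow> 0 * L2_norm M g + L2_norm M f * 0"
    by (intro tendsto_intros F G L2_norm_tendsto[OF G])
  then have lim: "(\<lambda>n. L2_norm M (\<lambda>x. F n x - f x) * L2_norm M (G n) + L2_norm M f * L2_norm M (\<lambda>x. G n x - g x))
     \<longlonglongrightarrow> 0" by simp
  show ?thesis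
    by (rule LIM_zero_cancel, rule Lim_null_comparison[OF always_eventually lim]) (simp add: le)
qed

text \<open>By the inequality of the arithmetic and geometric means, a n is at most
  2 ^ n * (a n)^2 + 1 / 2 ^ n. The weights let an integral of squares control a series of norms.\<close>

lemma summable_of_weighted_squares:
  fixes a :: "nat \<Rightarrow> real"
  assumes "\<And>n. 0 \<le> a n" "(\<Sum>n. ennreal (2 ^ n * (a n)\<^sup>2)) < \<infinity>"
  shows "summable a"
proof (rule summable_comparison_test')
  show "summable (\<lambda>n. 2 ^ n * (a n)\<^sup>2 + (1/2) ^ n)"
    using assms by (intro summable_add[OF summable_suminf_not_top summable_geometric]) (auto simp: less_top)
  show "norm (a n) \<le> 2 ^ n * (a n)\<^sup>2 + (1/2) ^ n" if "0 \<le> n" for n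
  proof -
    have "2 * a n \<le> 2 ^ n * (a n)\<^sup>2 + (1/2) ^ n"
      using zero_le_power2[of "2^n * a n - 1"]
      by (simp add: power2_eq_square field_simps)
    then show ?thesis using assms(1)[of n] by simp
  qed
qed

text \<open>Fatou's lemma: along an L2-Cauchy sequence the almost everywhere limit is the L2-limit.\<close>

lemma L2_limit_of_AE_limit:
  assumes F: "\<And>n. F n \<in> L2 M"
    and cauchy: "\<And>e. 0 < e \<Longrightarrow> \<exists>N. \<forall>m\<ge>N. \<forall>n\<ge>N. L2_norm M (\<lambda>x. F m x - F n x) < e"
    and lim: "AE x in M. (\<lambda>n. F n x) \<longlonglongrightarrow> g x" and g [measurable]: "g \<in> borel_measurable M"
  shows "g \<in> L2 M" "(\<lambda>n. L2_norm M (\<lambda>x. F n x - g x)) \<longlonglongrightarrow> 0"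
proof -
  note [measurable] = L2_measurable[OF F]
  have le: "(\<lambda>x. F n x - g x) \<in> L2 M \<and> L2_norm M (\<lambda>x. F n x - g x) \<le> e"
    if e: "0 < e" and N: "\<And>m n. N \<le> m \<Longrightarrow> N \<le> n \<Longrightarrow> L2_norm M (\<lambda>x. F m x - F n x) < e" and n: "N \<le> n" for e N n
  proof -
    have "(\<integral>\<^sup>+x. ennreal ((cmod (F n x - g x))\<^sup>2) \<partial>M)
        = (\<integral>\<^sup>+x. liminf (\<lambda>m. ennreal ((cmod (F n x - F m x))\<^sup>2)) \<partial>M)"
    proof (rule nn_integral_cong_AE)
      show "AE x in M. ennreal ((cmod (F n x - g x))\<^sup>2) = liminf (\<lambda>m. ennreal ((cmod (F n x - F m x))\<^sup>2))"
        using lim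
      proof eventually_elim
        case (elim x)
        have "(\<lambda>m. ennreal ((cmod (F n x - F m x))\<^sup>2)) \<longlonglongrightarrow> ennreal ((cmod (F n x - g x))\<^sup>2)"
          by (intro tendsto_ennrealI tendsto_power tendsto_norm tendsto_diff tendsto_const elim)
        then show ?case
          by (rule lim_imp_Liminf[symmetric, rotated]) simp
      qed
    qed
    also have "\<dots> \<le> liminf (\<lambda>m. \<integral>\<^sup>+x. ennreal ((cmod (F n x - F m x))\<^sup>2) \<partial>M)"
      by (rule nn_integral_liminf) measurable
    also have "\<dots> \<le> limsup (\<lambda>m. \<integral>\<^sup>+x. ennreal ((cmod (F n x - F m x))\<^sup>2) \<partial>M)"
      by (rule Liminf_le_Limsup) simp
    also have "\<dots> \<le> ennreal (e\<^sup>2)"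
    proof (rule Limsup_bounded, rule eventually_sequentiallyI[of N])
      fix m assume "N \<le> m"
      then have "L2_norm M (\<lambda>x. F n x - F m x) \<le> e"
        using N n by (simp add: less_imp_le)
      then show "(\<integral>\<^sup>+x. ennreal ((cmod (F n x - F m x))\<^sup>2) \<partial>M) \<le> ennreal (e\<^sup>2)"
        unfolding nn_integral_L2[OF L2_diff[OF F F]] by (intro ennreal_leI power_mono) auto
    qed
    finally show ?thesis
      using e by (intro conjI L2_norm_le_nn_integral) auto
  qed
  obtain N where "\<And>m n. N \<le> m \<Longrightarrow> N \<le> n \<Longrightarrow> L2_norm M (\<lambda>x. F m x - F n x) < 1"
    using cauchy[of 1] by auto
  then have "(\<lambda>x. F N x - g x) \<in> L2 M"
    using le[of 1 N N] by simp
  from L2_diff[OF F[of N] this] show "g \<in> L2 M"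
    by simp
  show "(\<lambda>n. L2_norm M (\<lambda>x. F n x - g x)) \<longlonglongrightarrow> 0"
  proof (rule LIMSEQ_I)
    fix r :: real assume "0 < r"
    then obtain N where "\<And>m n. N \<le> m \<Longrightarrow> N \<le> n \<Longrightarrow> L2_norm M (\<lambda>x. F m x - F n x) < r/2"
      using cauchy[of "r/2"] by auto
    then have "L2_norm M (\<lambda>x. F n x - g x) < r" if "N \<le> n" for n
      using le[of "r/2" N n] \<open>0 < r\<close> that by auto
    then show "\<exists>N. \<forall>n\<ge>N. norm (L2_norm M (\<lambda>x. F n x - g x) - 0) < r"
      by auto
  qed
qed

lemma geometric_imp_Cauchy:
  fixes d :: "nat \<Rightarrow> nat \<Rightarrow> real"
  assumes tri: "\<And>i j k. d i k \<le> d i j + d j k" and refl: "\<And>i. d i i = 0" and sym: "\<And>i j. d i j = d j i"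
    and step: "summable (\<lambda>n. d n (Suc n))" and e: "0 < e"
  shows "\<exists>N. \<forall>m\<ge>N. \<forall>n\<ge>N. d m n < (e::real)"
proof -
  obtain N where N: "\<And>m n. N \<le> m \<Longrightarrow> norm (sum (\<lambda>n. d n (Suc n)) {m..<n}) < e"
    using step e unfolding summable_Cauchy by blast
  have le: "d m n \<le> sum (\<lambda>n. d n (Suc n)) {m..<n}" if "m \<le> n" for m n
    using that
  proof (induction n rule: dec_induct)
    case base
    then show ?case by (simp add: refl)
  next
    case (step n)
    then show ?case using tri[of m "Suc n" n] by simp
  qed
  have "d m n < e" if "N \<le> m" "m \<le> n" for m n
    using le[OF that(2)] N[OF that(1), of n] by simp
  then have "d m n < e" if "N \<le> m" "N \<le> n" for m n
    using that sym by (metis nat_le_linear)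
  then show ?thesis by blast
qed

lemma L2_summable_imp_Cauchy:
  assumes "\<And>n. F n \<in> L2 M" "summable (\<lambda>n. L2_norm M (\<lambda>x. F n x - F (Suc n) x))" "0 < e"
  shows "\<exists>N. \<forall>m\<ge>N. \<forall>n\<ge>N. L2_norm M (\<lambda>x. F m x - F n x) < e"
proof (rule geometric_imp_Cauchy[where d = "\<lambda>m n. L2_norm M (\<lambda>x. F m x - F n x)"])
  show "L2_norm M (\<lambda>x. F i x - F k x) \<le> L2_norm M (\<lambda>x. F i x - F j x) + L2_norm M (\<lambda>x. F j x - F k x)" for i j k
    by (intro L2_norm_diff_triangle assms)
qed (use assms L2_norm_minus_commute in auto)

lemma power2_divide_power: "(C / 2 ^ n)\<^sup>2 = C\<^sup>2 / 4 ^ n" for C :: real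
  by (simp add: power_divide power_mult[symmetric] mult.commute[of n]) (simp add: power_mult)

text \<open>The Borel-Cantelli step of the Riesz-Fischer theorem, in a form that is also used with
  norms of sections in place of absolute values.\<close>

lemma AE_summable_weighted_squares:
  fixes a :: "nat \<Rightarrow> 'a \<Rightarrow> real"
  assumes [measurable]: "\<And>n. a n \<in> borel_measurable M" and nn: "\<And>n x. 0 \<le> a n x"
    and le: "\<And>n. (\<integral>\<^sup>+x. ennreal ((a n x)\<^sup>2) \<partial>M) \<le> ennreal (C / 4 ^ n)"
  shows "AE x in M. summable (\<lambda>n. a n x)"
proof -
  have "(\<integral>\<^sup>+x. (\<Sum>n. ennreal (2 ^ n * (a n x)\<^sup>2)) \<partial>M) = (\<Sum>n. \<integral>\<^sup>+x. ennreal (2 ^ n * (a n x)\<^sup>2) \<partial>M)"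
    by (rule nn_integral_suminf) measurable
  also have "\<dots> = (\<Sum>n. ennreal (2 ^ n) * (\<integral>\<^sup>+x. ennreal ((a n x)\<^sup>2) \<partial>M))"
    by (simp add: ennreal_mult nn_integral_cmult)
  also have "\<dots> \<le> (\<Sum>n. ennreal (\<bar>C\<bar> * (1/2) ^ n))"
  proof (rule suminf_le)
    fix n
    have "ennreal (2 ^ n) * (\<integral>\<^sup>+x. ennreal ((a n x)\<^sup>2) \<partial>M) \<le> ennreal (2 ^ n) * ennreal (\<bar>C\<bar> / 4 ^ n)"
      by (intro mult_left_mono order_trans[OF le] ennreal_leI divide_right_mono) auto
    also have "\<dots> = ennreal (2 ^ n * (\<bar>C\<bar> / 4 ^ n))"
      by (subst ennreal_mult) auto
    also have "2 ^ n * (\<bar>C\<bar> / 4 ^ n) = \<bar>C\<bar> * (1/2) ^ n"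
      using power_mult_distrib[of "2::real" 2 n] by (simp add: field_simps)
    finally show "ennreal (2 ^ n) * (\<integral>\<^sup>+x. ennreal ((a n x)\<^sup>2) \<partial>M) \<le> ennreal (\<bar>C\<bar> * (1/2) ^ n)" .
  qed auto
  also have "\<dots> = ennreal (\<Sum>n. \<bar>C\<bar> * (1/2) ^ n)"
    by (intro suminf_ennreal2 summable_mult) auto
  also have "\<dots> < \<infinity>" by simp
  finally have "AE x in M. (\<Sum>n. ennreal (2 ^ n * (a n x)\<^sup>2)) \<noteq> \<infinity>"
    by (intro nn_integral_PInf_AE) auto
  then show ?thesis
  proof eventually_elim
    case (elim x)
    then show ?case
      using nn by (intro summable_of_weighted_squares) (auto simp: less_top)
  qed
qed

text \<open>A sequence whose L2-distances to the limit decay geometrically converges almost everywhere;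
  such sequences stand in for passing to subsequences.\<close>

definition L2_fast :: "'a measure \<Rightarrow> (nat \<Rightarrow> 'a \<Rightarrow> complex) \<Rightarrow> ('a \<Rightarrow> complex) \<Rightarrow> bool"
  where "L2_fast M F f \<longleftrightarrow> f \<in> L2 M \<and> (\<forall>n. F n \<in> L2 M) \<and>
    (\<exists>C. \<forall>n. L2_norm M (\<lambda>x. F n x - f x) \<le> C / 2 ^ n)"

lemma L2_fast_tendsto:
  assumes "L2_fast M F f"
  shows "(\<lambda>n. L2_norm M (\<lambda>x. F n x - f x)) \<longlonglongrightarrow> 0"
proof -
  obtain C where C: "\<And>n. L2_norm M (\<lambda>x. F n x - f x) \<le> C / 2 ^ n"
    using assms unfolding L2_fast_def by blast
  have "(\<lambda>n. C * (1/2) ^ n) \<longlonglongrightarrow> C * 0"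
    by (intro tendsto_intros LIMSEQ_realpow_zero) auto
  then have "(\<lambda>n. C / 2 ^ n) \<longlonglongrightarrow> 0"
    by (simp add: power_divide)
  then show ?thesis
    by (rule tendsto_sandwich[OF _ _ tendsto_const, rotated 2]) (use C in auto)
qed

lemma L2_fast_step:
  assumes "L2_fast M F f"
  obtains C where "\<And>n. (L2_norm M (\<lambda>x. F n x - F (Suc n) x))\<^sup>2 \<le> C / 4 ^ n"
proof -
  obtain C where C: "\<And>n. L2_norm M (\<lambda>x. F n x - f x) \<le> C / 2 ^ n" and L: "f \<in> L2 M" "\<And>n. F n \<in> L2 M"
    using assms unfolding L2_fast_def by blast
  have C0: "0 \<le> C" using order_trans[OF _ C[of 0]] by simp
  have "(L2_norm M (\<lambda>x. F n x - F (Suc n) x))\<^sup>2 \<le> (4 * C\<^sup>2) / 4 ^ n" for n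
  proof -
    have "L2_norm M (\<lambda>x. F n x - F (Suc n) x) \<le> C / 2 ^ n + C / 2 ^ Suc n"
      using L2_norm_diff_triangle[OF L(2)[of n] L(1) L(2)[of "Suc n"]] C[of n] C[of "Suc n"]
      by (simp add: L2_norm_minus_commute[of M f])
    also have "\<dots> \<le> 2 * C / 2 ^ n" using C0 by (simp add: field_simps)
    finally have "(L2_norm M (\<lambda>x. F n x - F (Suc n) x))\<^sup>2 \<le> (2 * C / 2 ^ n)\<^sup>2"
      by (intro power_mono) auto
    also have "\<dots> = (4 * C\<^sup>2) / 4 ^ n"
      by (simp add: power2_divide_power power_mult_distrib)
    finally show ?thesis .
  qed
  then show ?thesis using that by blast
qed

lemma L2_fast_AE:
  assumes "L2_fast M F f"
  shows "AE x in M. (\<lambda>n. F n x) \<longlonglongrightarrow> f x"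
proof -
  obtain C where C: "\<And>n. L2_norm M (\<lambda>x. F n x - f x) \<le> C / 2 ^ n" and L: "f \<in> L2 M" "\<And>n. F n \<in> L2 M"
    using assms unfolding L2_fast_def by blast
  note [measurable] = L2_measurable[OF L(1)] L2_measurable[OF L(2)]
  have "AE x in M. summable (\<lambda>n. cmod (F n x - f x))"
  proof (rule AE_summable_weighted_squares)
    fix n
    have "(L2_norm M (\<lambda>x. F n x - f x))\<^sup>2 \<le> (C / 2 ^ n)\<^sup>2"
      by (intro power_mono C) simp
    also have "\<dots> = C\<^sup>2 / 4 ^ n"
      by (rule power2_divide_power)
    finally show "(\<integral>\<^sup>+x. ennreal ((cmod (F n x - f x))\<^sup>2) \<partial>M) \<le> ennreal (C\<^sup>2 / 4 ^ n)"
      by (simp add: nn_integral_L2[OF L2_diff[OF L(2) L(1)]])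
  qed auto
  then show ?thesis
    by eventually_elim (auto dest!: summable_LIMSEQ_zero intro: LIM_zero_cancel tendsto_norm_zero_cancel)
qed

lemma Riesz_Fischer:
  assumes F: "\<And>n. F n \<in> L2 M"
    and cauchy: "\<And>e. 0 < e \<Longrightarrow> \<exists>N. \<forall>m\<ge>N. \<forall>n\<ge>N. L2_norm M (\<lambda>x. F m x - F n x) < e"
  obtains g where "g \<in> L2 M" "(\<lambda>n. L2_norm M (\<lambda>x. F n x - g x)) \<longlonglongrightarrow> 0"
proof -
  note [measurable] = L2_measurable[OF F]
  have "\<exists>N. \<forall>n. \<forall>m\<ge>N n. \<forall>k\<ge>N n. L2_norm M (\<lambda>x. F m x - F k x) < 1 / 2 ^ n"
    using cauchy[of "1 / 2 ^ _"] by (intro choice) auto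
  then obtain N where N: "\<And>n m k. N n \<le> m \<Longrightarrow> N n \<le> k \<Longrightarrow> L2_norm M (\<lambda>x. F m x - F k x) < 1 / 2 ^ n"
    by blast
  \<comment> \<open>s n dominates N 0, ..., N n, so consecutive terms are close, and it dominates n.\<close>
  define s where "s n = (\<Sum>i\<le>n. N i) + n" for n
  have sN: "N n \<le> s n" "N n \<le> s (Suc n)" "n \<le> s n" for n
    unfolding s_def by (auto intro: order_trans[OF member_le_sum[of n "{..n}" N]])
  define G where "G n = F (s n)" for n
  have G: "G n \<in> L2 M" for n by (simp add: G_def F)
  have [measurable]: "G n \<in> borel_measurable M" for n by (simp add: G_def)
  have step: "L2_norm M (\<lambda>x. G n x - G (Suc n) x) \<le> 1 / 2 ^ n" for n
    unfolding G_def using N[OF sN(1,2), of n] by simp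
  have "AE x in M. summable (\<lambda>n. cmod (G n x - G (Suc n) x))"
  proof (rule AE_summable_weighted_squares)
    fix n
    have "(L2_norm M (\<lambda>x. G n x - G (Suc n) x))\<^sup>2 \<le> (1 / 2 ^ n)\<^sup>2"
      by (intro power_mono step) simp
    also have "\<dots> = 1 / 4 ^ n"
      by (simp add: power2_divide_power)
    finally show "(\<integral>\<^sup>+x. ennreal ((cmod (G n x - G (Suc n) x))\<^sup>2) \<partial>M) \<le> ennreal (1 / 4 ^ n)"
      by (simp add: nn_integral_L2[OF L2_diff[OF G G]])
  qed auto
  then have lim: "AE x in M. (\<lambda>n. G n x) \<longlonglongrightarrow> lim (\<lambda>n. G n x)"
  proof eventually_elim
    case (elim x)
    have "summable (\<lambda>n. G (Suc n) x - G n x)"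
      using elim by (intro summable_norm_cancel[where f="\<lambda>n. G (Suc n) x - G n x"]) (simp add: norm_minus_commute)
    then have "convergent (\<lambda>n. \<Sum>i<n. G (Suc i) x - G i x)"
      by (simp add: summable_iff_convergent)
    then have "convergent (\<lambda>n. (G n x - G 0 x) + G 0 x)"
      unfolding sum_lessThan_telescope[of "\<lambda>i. G i x"] by (rule convergent_add) (rule convergent_const)
    then show ?case by (simp add: convergent_LIMSEQ_iff)
  qed
  have "(\<lambda>x. lim (\<lambda>n. G n x)) \<in> borel_measurable M"
    by measurable
  note lim = lim this
  have "summable (\<lambda>n. L2_norm M (\<lambda>x. G n x - G (Suc n) x))"
  proof (rule summable_comparison_test')
    show "summable (\<lambda>n. (1/2::real) ^ n)" by simp
    show "norm (L2_norm M (\<lambda>x. G n x - G (Suc n) x)) \<le> (1/2) ^ n" if "0 \<le> n" for n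
      using step[of n] by (simp only: power_one_over[symmetric] real_norm_def abs_of_nonneg L2_norm_nonneg)
  qed
  note lim = L2_limit_of_AE_limit[OF G L2_summable_imp_Cauchy[where F = G, OF G this] lim]
  obtain g where g: "g \<in> L2 M" "(\<lambda>n. L2_norm M (\<lambda>x. G n x - g x)) \<longlonglongrightarrow> 0"
    by (rule that[OF lim])
  have "(\<lambda>n. L2_norm M (\<lambda>x. F n x - g x)) \<longlonglongrightarrow> 0"
  proof (rule LIMSEQ_I)
    fix r :: real assume "0 < r"
    obtain A where A: "\<And>m n. A \<le> m \<Longrightarrow> A \<le> n \<Longrightarrow> L2_norm M (\<lambda>x. F m x - F n x) < r/2"
      using cauchy[of "r/2"] \<open>0 < r\<close> by auto
    obtain B where B: "\<And>n. B \<le> n \<Longrightarrow> L2_norm M (\<lambda>x. G n x - g x) < r/2"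
      using LIMSEQ_D[OF g(2), of "r/2"] \<open>0 < r\<close> by auto
    have "L2_norm M (\<lambda>x. F n x - g x) < r" if "A \<le> n" for n
    proof -
      obtain K where K: "A \<le> K" "B \<le> K"
        by (metis max.cobounded1 max.cobounded2)
      have "L2_norm M (\<lambda>x. F n x - G K x) < r/2"
        unfolding G_def using A[OF that] K(1) sN(3)[of K] by simp
      then show ?thesis
        using L2_norm_diff_triangle[OF F[of n] G[of K] g(1)] B[OF K(2)] by linarith
    qed
    then show "\<exists>N. \<forall>n\<ge>N. norm (L2_norm M (\<lambda>x. F n x - g x) - 0) < r"
      by (intro exI[of _ A]) simp
  qed
  then show ?thesis using that g(1) by blast
qed

section \<open>Compactly supported functions\<close>

text \<open>On Hausdorff spaces this agrees with having compact support; the compact set is left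
  existential because it is the form in which supports are computed and used.\<close>

definition Cc :: "('a::topological_space \<Rightarrow> 'b::real_normed_vector) set"
  where "Cc = {f. continuous_on UNIV f \<and> (\<exists>C. compact C \<and> (\<forall>x. x \<notin> C \<longrightarrow> f x = 0))}"

lemma CcI: "continuous_on UNIV f \<Longrightarrow> compact C \<Longrightarrow> (\<And>x. x \<notin> C \<Longrightarrow> f x = 0) \<Longrightarrow> f \<in> Cc"
  unfolding Cc_def by blast

lemma Cc_continuous: "f \<in> Cc \<Longrightarrow> continuous_on UNIV f"
  by (simp add: Cc_def)

lemma Cc_support:
  assumes "f \<in> Cc"
  obtains C where "compact C" "\<And>x. x \<notin> C \<Longrightarrow> f x = 0"
  using assms by (auto simp: Cc_def)

lemma Cc_zero: "(\<lambda>x. 0) \<in> Cc"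
  by (rule CcI[of _ "{}"]) auto

lemma Cc_add:
  assumes "f \<in> Cc" "g \<in> Cc"
  shows "(\<lambda>x. f x + g x) \<in> Cc"
proof -
  obtain C D where "compact C" "\<And>x. x \<notin> C \<Longrightarrow> f x = 0" "compact D" "\<And>x. x \<notin> D \<Longrightarrow> g x = 0"
    by (metis Cc_support assms)
  then show ?thesis
    using Cc_continuous[OF assms(1)] Cc_continuous[OF assms(2)]
    by (intro CcI[of _ "C \<union> D"] continuous_intros) auto
qed

lemma Cc_compose:
  assumes "f \<in> Cc" "continuous_on UNIV g" "g 0 = 0"
  shows "(\<lambda>x. g (f x)) \<in> Cc"
proof -
  obtain C where C: "compact C" "\<And>x. x \<notin> C \<Longrightarrow> f x = 0"
    by (metis Cc_support assms(1))
  have "continuous_on UNIV (\<lambda>x. g (f x))"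
    using continuous_on_compose2[OF assms(2) Cc_continuous[OF assms(1)]] by simp
  then show ?thesis
    using C assms(3) by (intro CcI[of _ C]) auto
qed

lemma Cc_cmult: "f \<in> Cc \<Longrightarrow> (\<lambda>x. c * f x) \<in> Cc" for f :: "'a::topological_space \<Rightarrow> 'b::real_normed_algebra"
  by (rule Cc_compose[where g = "\<lambda>y. c * y"]) (auto intro!: continuous_intros)

lemma Cc_mult:
  fixes f :: "'a::topological_space \<Rightarrow> 'b::real_normed_algebra"
  assumes "f \<in> Cc" "continuous_on UNIV g"
  shows "(\<lambda>x. g x * f x) \<in> Cc" "(\<lambda>x. f x * g x) \<in> Cc"
proof -
  obtain C where "compact C" "\<And>x. x \<notin> C \<Longrightarrow> f x = 0"
    by (metis Cc_support assms(1))
  then show "(\<lambda>x. g x * f x) \<in> Cc" "(\<lambda>x. f x * g x) \<in> Cc"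
    using Cc_continuous[OF assms(1)] assms(2)
    by (auto intro!: CcI[of _ C] continuous_intros)
qed

lemma Cc_diff:
  assumes "f \<in> Cc" "g \<in> Cc"
  shows "(\<lambda>x. f x - g x) \<in> Cc"
  using Cc_add[OF assms(1) Cc_compose[OF assms(2), of uminus]] by (simp add: continuous_on_minus)

lemma Cc_norm_square: "f \<in> Cc \<Longrightarrow> (\<lambda>x. (cmod (f x))\<^sup>2) \<in> Cc"
  by (rule Cc_compose[where g = "\<lambda>y. (cmod y)\<^sup>2"]) (auto intro!: continuous_intros)

lemma Cc_of_real: "f \<in> Cc \<Longrightarrow> (\<lambda>x. complex_of_real (f x)) \<in> Cc"
  by (rule Cc_compose[where g = complex_of_real]) (auto intro!: continuous_intros)

lemma Cc_imp_Cc_fun: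
  fixes \<phi> :: "'a::t2_space \<Rightarrow> real"
  assumes "\<phi> \<in> Cc"
  shows "\<phi> \<in> Cc_fun"
proof -
  obtain C where C: "compact C" "\<And>x. x \<notin> C \<Longrightarrow> \<phi> x = 0"
    by (metis Cc_support assms)
  then have "closure {x. \<phi> x \<noteq> 0} \<subseteq> C"
    by (intro closure_minimal compact_imp_closed) auto
  then have "compact (closure {x. \<phi> x \<noteq> 0})"
    using C(1) closed_Int_compact[of "closure {x. \<phi> x \<noteq> 0}" C] by (simp add: Int_absorb2)
  then show ?thesis
    using Cc_continuous[OF assms] by (simp add: Cc_fun_def)
qed

lemma locally_compact_nbhd:
  fixes C :: "'a::t2_space set"
  assumes lc: "locally_compact_space (euclidean :: 'a topology)" and "compact C"
  obtains V K where "open V" "compact K" "C \<subseteq> V" "V \<subseteq> K"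
proof -
  have "\<exists>U K. open U \<and> compact K \<and> x \<in> U \<and> U \<subseteq> K" for x :: 'a
    using lc by (simp add: locally_compact_space_def)
  then have "\<forall>x::'a. \<exists>p. open (fst p) \<and> compact (snd p) \<and> x \<in> fst p \<and> fst p \<subseteq> snd p"
    by simp
  then obtain p where "\<forall>x::'a. open (fst (p x)) \<and> compact (snd (p x)) \<and> x \<in> fst (p x) \<and> fst (p x) \<subseteq> snd (p x)"
    using choice[of "\<lambda>x p. open (fst p) \<and> compact (snd p) \<and> x \<in> fst p \<and> fst p \<subseteq> snd p"] by blast
  then obtain U K where UK: "\<And>x::'a. open (U x)" "\<And>x::'a. compact (K x)" "\<And>x. x \<in> U x" "\<And>x. U x \<subseteq> K x"
    by (rule_tac that[of "fst \<circ> p" "snd \<circ> p"]) auto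
  obtain F where F: "F \<subseteq> C" "finite F" "C \<subseteq> (\<Union>x\<in>F. U x)"
    by (rule compactE_image[OF assms(2), of C U]) (use UK(1,3) in auto)
  show ?thesis
  proof
    show "open (\<Union>x\<in>F. U x)" "compact (\<Union>x\<in>F. K x)"
      using F(2) UK(1,2) by (auto intro: compact_UN)
    show "C \<subseteq> (\<Union>x\<in>F. U x)" by (rule F)
    show "(\<Union>x\<in>F. U x) \<subseteq> (\<Union>x\<in>F. K x)"
      using UK(4) by (intro UN_mono) auto
  qed
qed

lemma Urysohn_Cc:
  fixes C :: "'a::t2_space set"
  assumes lc: "locally_compact_space (euclidean :: 'a topology)" and C: "compact C" and U: "open U" "C \<subseteq> U"
  obtains \<phi> :: "'a \<Rightarrow> real" where "\<phi> \<in> Cc" "\<And>x. 0 \<le> \<phi> x" "\<And>x. \<phi> x \<le> 1" "\<And>x. x \<in> C \<Longrightarrow> \<phi> x = 1"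
    "\<And>x. x \<notin> U \<Longrightarrow> \<phi> x = 0"
proof -
  obtain V K where V: "open V" "compact K" "C \<subseteq> V" "V \<subseteq> K"
    using locally_compact_nbhd[OF lc C] .
  have creg: "completely_regular_space (euclidean :: 'a topology)"
    using lc hausdorff by (intro locally_compact_regular_imp_completely_regular_space)
      (auto simp: Hausdorff_space_def disjnt_def)
  have "closedin euclidean (- (U \<inter> V))"
    using U(1) V(1) by auto
  then obtain f where f: "continuous_map euclidean (top_of_set {0..1::real}) f"
      "f ` (- (U \<inter> V)) \<subseteq> {0}" "f ` C \<subseteq> {1}"
    using Urysohn_completely_regular_compact_closed[of 0 1 "euclidean :: 'a topology" C "- (U \<inter> V)"] creg C U V
    by (auto simp: disjnt_def)
  have cont: "continuous_on UNIV f" and ran: "f x \<in> {0..1}" for x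
    using f(1) by (auto simp: continuous_map_in_subtopology image_subset_iff)
  show ?thesis
  proof
    show "f \<in> Cc"
      using f(2) V by (intro CcI[OF cont, of K]) auto
  qed (use f ran in auto)
qed

section \<open>Radon measures\<close>

text \<open>Local compactness is added only later, since for topological groups it
  is deduced from the existence of a Haar measure.\<close>

locale radon_prelim =
  fixes \<mu> :: "'a::t2_space measure"
  assumes radon: "radon_measure \<mu>"
begin

sublocale cld_measure \<mu>
  using radon by (simp add: radon_measure_def)

lemma sets_borel: "A \<in> sets borel \<Longrightarrow> A \<in> sets \<mu>"
  using radon by (auto simp: radon_measure_def)

lemma space_UNIV: "space \<mu> = UNIV"
  using sets.sets_into_space[OF sets_borel[of UNIV]] by auto

lemma sets_open: "open A \<Longrightarrow> A \<in> sets \<mu>"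
  and sets_compact: "compact A \<Longrightarrow> A \<in> sets \<mu>"
  by (auto intro: sets_borel borel_closed compact_imp_closed)

lemma measurable_borel: "f \<in> borel_measurable borel \<Longrightarrow> f \<in> borel_measurable \<mu>"
  by (auto simp: measurable_def space_UNIV intro: sets_borel)

lemma measurable_continuous: "continuous_on UNIV f \<Longrightarrow> f \<in> borel_measurable \<mu>"
  by (intro measurable_borel borel_measurable_continuous_onI)

lemma compact_open_finite:
  assumes "compact C"
  obtains V where "open V" "C \<subseteq> V" "emeasure \<mu> V < \<infinity>"
proof -
  have "\<exists>U. open U \<and> x \<in> U \<and> emeasure \<mu> U < \<infinity>" for x
    using radon by (simp add: radon_measure_def)
  then obtain U where U: "\<And>x. open (U x)" "\<And>x. x \<in> U x" "\<And>x. emeasure \<mu> (U x) < \<infinity>"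
    by metis
  obtain F where F: "F \<subseteq> C" "finite F" "C \<subseteq> (\<Union>x\<in>F. U x)"
    by (rule compactE_image[OF assms, of C U]) (use U(1,2) in auto)
  have "emeasure \<mu> (\<Union>x\<in>F. U x) \<le> (\<Sum>x\<in>F. emeasure \<mu> (U x))"
    using F U by (intro emeasure_subadditive_finite) (auto intro: sets_open)
  also have "\<dots> < \<infinity>"
    using F U by (simp add: less_top)
  finally show ?thesis
    using that[of "\<Union>x\<in>F. U x"] F(3) U(1) by auto
qed

lemma emeasure_compact_finite:
  assumes "compact C"
  shows "emeasure \<mu> C < \<infinity>"
proof -
  obtain V where "open V" "C \<subseteq> V" "emeasure \<mu> V < \<infinity>"
    by (rule compact_open_finite[OF assms])
  then show ?thesis
    using emeasure_mono[of C V \<mu>] sets_open[of V] by (auto intro: le_less_trans)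
qed

lemma emeasure_inner:
  "E \<in> sets \<mu> \<Longrightarrow> emeasure \<mu> E = (SUP C\<in>{C. compact C \<and> C \<subseteq> E}. emeasure \<mu> C)"
  using radon by (simp add: radon_measure_def)

lemma emeasure_le_of_compact:
  assumes "E \<in> sets \<mu>" "\<And>C. compact C \<Longrightarrow> C \<subseteq> E \<Longrightarrow> emeasure \<mu> C \<le> b"
  shows "emeasure \<mu> E \<le> b"
  unfolding emeasure_inner[OF assms(1)] using assms(2) by (intro SUP_least) auto

lemma inner_approx:
  assumes E: "E \<in> sets \<mu>" "emeasure \<mu> E < \<infinity>" and e: "0 < (e::real)"
  obtains C where "compact C" "C \<subseteq> E" "emeasure \<mu> (E - C) \<le> ennreal e"
proof -
  have "\<exists>C\<in>{C. compact C \<and> C \<subseteq> E}. emeasure \<mu> E < emeasure \<mu> C + ennreal e"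
    using e E(2) by (intro SUP_approx_ennreal[OF _ _ emeasure_inner[OF E(1)]]) auto
  then obtain C where C: "compact C" "C \<subseteq> E" "emeasure \<mu> E < emeasure \<mu> C + ennreal e"
    by blast
  have "emeasure \<mu> (E - C) = emeasure \<mu> E - emeasure \<mu> C"
    using C E emeasure_compact_finite[OF C(1)] sets_compact[OF C(1)] by (intro emeasure_Diff) auto
  also have "\<dots> \<le> ennreal e"
    using C(3) emeasure_compact_finite[OF C(1)]
    by (auto simp: ennreal_minus_le_iff less_imp_le add.commute)
  finally show ?thesis
    using that C by blast
qed

end

locale radon = radon_prelim \<mu> for \<mu> :: "'a::t2_space measure" +
  assumes locally_compact: "locally_compact_space (euclidean :: 'a topology)"
begin

text \<open>Outer regularity on relatively compact sets: remove from an open set of finite measure a compact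
  set that fills up most of the complement of E.\<close>

lemma outer_approx:
  assumes E: "E \<in> sets \<mu>" "E \<subseteq> K" "compact K" and e: "0 < (e::real)"
  obtains U where "open U" "E \<subseteq> U" "emeasure \<mu> (U - E) \<le> ennreal e"
proof -
  obtain V K' where V: "open V" "compact K'" "K \<subseteq> V" "V \<subseteq> K'"
    using locally_compact_nbhd[OF locally_compact E(3)] .
  have "emeasure \<mu> (V - E) \<le> emeasure \<mu> K'"
    using V by (intro emeasure_mono sets_compact) auto
  then have fin: "emeasure \<mu> (V - E) < \<infinity>"
    using emeasure_compact_finite[OF V(2)] by (rule le_less_trans)
  have "V - E \<in> sets \<mu>"
    using E(1) sets_open[OF V(1)] by auto
  then obtain C where C: "compact C" "C \<subseteq> V - E" "emeasure \<mu> (V - E - C) \<le> ennreal e"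
    using inner_approx[OF _ fin e] by metis
  show ?thesis
  proof
    show "open (V - C)"
      using V C by (intro open_Diff compact_imp_closed)
    show "E \<subseteq> V - C"
      using E V C by auto
    have "V - C - E = V - E - C" by auto
    then show "emeasure \<mu> (V - C - E) \<le> ennreal e"
      using C(3) by simp
  qed
qed

lemma null_of_small_cover:
  assumes "\<And>e. 0 < (e::real) \<Longrightarrow> \<exists>A\<in>sets \<mu>. N \<subseteq> A \<and> emeasure \<mu> A \<le> ennreal e"
  shows "N \<in> null_sets \<mu>"
proof -
  have "\<exists>A. \<forall>n. A n \<in> sets \<mu> \<and> N \<subseteq> A n \<and> emeasure \<mu> (A n) \<le> ennreal (1 / real (Suc n))"
    using assms[of "1 / real (Suc _)"] by (intro choice) auto
  then obtain A where A: "\<And>n. A n \<in> sets \<mu>" "\<And>n. N \<subseteq> A n" "\<And>n. emeasure \<mu> (A n) \<le> ennreal (1 / real (Suc n))"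
    by auto
  have le: "emeasure \<mu> (\<Inter>n. A n) \<le> ennreal (1 / real (Suc n))" for n
    by (rule order_trans[OF emeasure_mono A(3)]) (use A in auto)
  have "(\<lambda>n. ennreal (1 / real (Suc n))) \<longlonglongrightarrow> ennreal 0"
    by (intro tendsto_ennrealI LIMSEQ_Suc[OF lim_1_over_n])
  then have "emeasure \<mu> (\<Inter>n. A n) \<le> ennreal 0"
    by (rule LIMSEQ_le_const) (use le in auto)
  then have "(\<Inter>n. A n) \<in> null_sets \<mu>"
    using A by (auto simp: null_sets_def)
  then show ?thesis
    by (rule complete2[rotated]) (use A in auto)
qed

lemma sigma_compact_approx:
  assumes B: "B \<in> sets \<mu>" "emeasure \<mu> B < \<infinity>"
  obtains C where "\<And>n::nat. compact (C n)" "\<And>n. C n \<subseteq> B" "B - (\<Union>n. C n) \<in> null_sets \<mu>"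
proof -
  have "\<exists>C. \<forall>n. compact (C n) \<and> C n \<subseteq> B \<and> emeasure \<mu> (B - C n) \<le> ennreal (1 / real (Suc n))"
    using inner_approx[OF B, of "1 / real (Suc _)"] by (intro choice allI) (metis of_nat_0_less_iff zero_less_Suc zero_less_divide_1_iff)
  then obtain C where C: "\<And>n. compact (C n)" "\<And>n. C n \<subseteq> B" "\<And>n. emeasure \<mu> (B - C n) \<le> ennreal (1 / real (Suc n))"
    by auto
  have "B - (\<Union>n. C n) \<in> null_sets \<mu>"
  proof (rule null_of_small_cover)
    fix e :: real assume "0 < e"
    then obtain n where "1 / real (Suc n) < e"
      using nat_approx_posE by blast
    then have "emeasure \<mu> (B - C n) \<le> ennreal e"
      using C(3)[of n] by (meson ennreal_leI less_imp_le order_trans)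
    then show "\<exists>A\<in>sets \<mu>. B - (\<Union>n. C n) \<subseteq> A \<and> emeasure \<mu> A \<le> ennreal e"
      using B C by (intro bexI[of _ "B - C n"]) (auto intro: sets_compact)
  qed
  then show ?thesis using that C(1,2) by metis
qed

text \<open>Sets of finite measure are sigma-compact up to a null set, so in a locally determined measure
  measurability, and then nullity, can be tested on compact sets. This replaces
  sigma-finiteness throughout.\<close>

lemma sets_local:
  assumes "\<And>C. compact C \<Longrightarrow> E \<inter> C \<in> sets \<mu>"
  shows "E \<in> sets \<mu>"
proof (rule locally_determined)
  fix B assume "B \<in> sets \<mu>" "emeasure \<mu> B < \<infinity>"
  then obtain C where C: "\<And>n::nat. compact (C n)" "\<And>n. C n \<subseteq> B" "B - (\<Union>n. C n) \<in> null_sets \<mu>"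
    using sigma_compact_approx by metis
  have "E \<inter> (B - (\<Union>n. C n)) \<in> sets \<mu>"
    by (rule complete[OF _ C(3)]) auto
  moreover have "E \<inter> B = (\<Union>n. E \<inter> C n) \<union> E \<inter> (B - (\<Union>n. C n))"
    using C(2) by auto
  moreover have "(\<Union>n. E \<inter> C n) \<in> sets \<mu>"
    by (intro sets.countable_UN'') (auto intro: assms C(1))
  ultimately show "E \<inter> B \<in> sets \<mu>"
    by (metis sets.Un)
qed (simp add: space_UNIV)

lemma null_local:
  assumes "\<And>C. compact C \<Longrightarrow> E \<inter> C \<in> null_sets \<mu>"
  shows "E \<in> null_sets \<mu>"
proof -
  have E: "E \<in> sets \<mu>"
    by (rule sets_local, rule null_setsD2, rule assms)
  have "emeasure \<mu> E \<le> 0"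
  proof (rule emeasure_le_of_compact[OF E])
    fix C assume "compact C" "C \<subseteq> E"
    then show "emeasure \<mu> C \<le> 0"
      using assms[of C] by (simp add: Int_absorb1 null_sets_def)
  qed
  then show ?thesis
    using E by (simp add: null_sets_def)
qed

lemma AE_iff_null_set: "(AE x in \<mu>. P x) \<longleftrightarrow> {x. \<not> P x} \<in> null_sets \<mu>"
proof
  assume "AE x in \<mu>. P x"
  then obtain N where "{x\<in>space \<mu>. \<not> P x} \<subseteq> N" "N \<in> null_sets \<mu>"
    by (auto elim!: AE_E simp: null_sets_def)
  then show "{x. \<not> P x} \<in> null_sets \<mu>"
    using complete2 by (simp add: space_UNIV)
next
  assume "{x. \<not> P x} \<in> null_sets \<mu>"
  then show "AE x in \<mu>. P x"
    by (rule AE_I') (auto simp: space_UNIV)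
qed

lemma AE_local:
  assumes "\<And>C. compact C \<Longrightarrow> AE x in \<mu>. x \<in> C \<longrightarrow> P x"
  shows "AE x in \<mu>. P x"
  unfolding AE_iff_null_set
proof (rule null_local)
  fix C :: "'a set" assume "compact C"
  from assms[OF this] show "{x. \<not> P x} \<inter> C \<in> null_sets \<mu>"
    unfolding AE_iff_null_set by (simp add: Collect_conj_eq Int_commute conj_commute)
qed

lemma measurable_AE_cong:
  fixes f :: "'a \<Rightarrow> 'b::topological_space"
  assumes f: "f \<in> borel_measurable \<mu>" and eq: "AE x in \<mu>. f x = g x"
  shows "g \<in> borel_measurable \<mu>"
proof (rule measurableI)
  fix A :: "'b set" assume A: "A \<in> sets borel"
  have N: "{x. f x \<noteq> g x} \<in> null_sets \<mu>"
    using eq by (simp add: AE_iff_null_set)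
  have "g -` A = (f -` A - {x. f x \<noteq> g x}) \<union> (g -` A \<inter> {x. f x \<noteq> g x})"
    by auto
  moreover have "f -` A \<in> sets \<mu>"
    using measurable_sets[OF f A] by (simp add: space_UNIV)
  moreover have "g -` A \<inter> {x. f x \<noteq> g x} \<in> sets \<mu>"
    using N by (rule complete[rotated]) auto
  ultimately show "g -` A \<inter> space \<mu> \<in> sets \<mu>"
    using null_setsD2[OF N] by (metis Int_UNIV_right sets.Diff sets.Un space_UNIV)
qed (simp add: space_UNIV)

lemma measurable_AE_limit:
  fixes F :: "nat \<Rightarrow> 'a \<Rightarrow> complex"
  assumes [measurable]: "\<And>n. F n \<in> borel_measurable \<mu>" and lim: "AE x in \<mu>. (\<lambda>n. F n x) \<longlonglongrightarrow> f x"
  shows "f \<in> borel_measurable \<mu>"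
proof (rule measurable_AE_cong)
  show "(\<lambda>x. lim (\<lambda>n. F n x)) \<in> borel_measurable \<mu>"
    by measurable
  show "AE x in \<mu>. lim (\<lambda>n. F n x) = f x"
    using lim by eventually_elim (rule limI)
qed

lemma integrable_of_bounded_support:
  fixes f :: "'a \<Rightarrow> 'b::{banach, second_countable_topology}"
  assumes f: "f \<in> borel_measurable \<mu>" and C: "compact C" "\<And>x. x \<notin> C \<Longrightarrow> f x = 0" and B: "\<And>x. norm (f x) \<le> B"
  shows "integrable \<mu> f"
  by (rule integrableI_bounded_set[of C \<mu> f B])
     (use assms emeasure_compact_finite[OF C(1)] sets_compact[OF C(1)] in auto)

lemma Cc_bounded:
  fixes f :: "'c::topological_space \<Rightarrow> 'b::real_normed_vector"
  assumes "f \<in> Cc"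
  obtains B where "\<And>x. norm (f x) \<le> B" "0 \<le> B"
proof -
  obtain C where C: "compact C" "\<And>x. x \<notin> C \<Longrightarrow> f x = 0"
    by (metis Cc_support assms)
  have "compact (f ` C)"
    using C(1) Cc_continuous[OF assms] by (intro compact_continuous_image) (auto intro: continuous_on_subset)
  then obtain B where B: "\<And>y. y \<in> f ` C \<Longrightarrow> norm y \<le> B"
    using compact_imp_bounded bounded_iff by metis
  then have "norm (f x) \<le> max B 0" for x
  proof (cases "x \<in> C")
    case True
    then have "norm (f x) \<le> B" by (intro B) simp
    then show ?thesis by simp
  qed (simp add: C(2))
  then show ?thesis
    using that[of "max B 0"] by simp
qed

lemma Cc_measurable: "f \<in> Cc \<Longrightarrow> f \<in> borel_measurable \<mu>"
  by (simp add: measurable_continuous Cc_continuous)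

lemma Cc_integrable:
  fixes f :: "'a \<Rightarrow> 'b::{banach, second_countable_topology}"
  assumes "f \<in> Cc"
  shows "integrable \<mu> f"
proof -
  obtain C where "compact C" "\<And>x. x \<notin> C \<Longrightarrow> f x = 0"
    by (metis Cc_support assms)
  moreover obtain B where "\<And>x. norm (f x) \<le> B"
    using Cc_bounded[OF assms] by metis
  ultimately show ?thesis
    by (rule integrable_of_bounded_support[OF Cc_measurable[OF assms]])
qed

lemma Cc_L2: "f \<in> Cc \<Longrightarrow> f \<in> L2 \<mu>"
  by (simp add: L2_def Cc_measurable Cc_integrable Cc_norm_square)

text \<open>Tube lemma: near x0 the integrand is uniformly close to its value at x0 on the compact set
  carrying it.\<close>

lemma continuous_parametric_integral:
  fixes \<Phi> :: "'x::topological_space \<Rightarrow> 'a \<Rightarrow> 'b::{banach, second_countable_topology}"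
  assumes cont: "continuous_on UNIV (\<lambda>(x, y). \<Phi> x y)"
    and Q: "compact Q" "\<And>x y. y \<notin> Q \<Longrightarrow> \<Phi> x y = 0"
  shows "continuous_on UNIV (\<lambda>x. LINT y|\<mu>. \<Phi> x y)"
proof -
  have contx: "continuous_on UNIV (\<Phi> x)" for x
    using continuous_on_compose2[OF cont continuous_on_Pair[OF continuous_on_const continuous_on_id, of UNIV x]]
    by simp
  have int: "integrable \<mu> (\<Phi> x)" for x
    by (intro Cc_integrable CcI[OF contx Q(1)]) (use Q(2) in auto)
  have "((\<lambda>x. LINT y|\<mu>. \<Phi> x y) \<longlongrightarrow> (LINT y|\<mu>. \<Phi> x0 y)) (at x0)" for x0
  proof (rule tendstoI)
    fix e :: real assume e: "0 < e"
    define d where "d = e / (measure \<mu> Q + 1)"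
    have d: "0 < d" using e by (simp add: d_def add_nonneg_pos)
    define W where "W = (\<lambda>(x, y). norm (\<Phi> x y - \<Phi> x0 y)) -` {..< d}"
    have "continuous_on UNIV (\<lambda>p. norm ((\<lambda>(x, y). \<Phi> x y) p - \<Phi> x0 (snd p)))"
      by (intro continuous_intros cont continuous_on_compose2[OF contx]) auto
    then have "open W"
      unfolding W_def by (auto intro!: open_vimage simp: case_prod_beta)
    moreover have "{x0} \<times> Q \<subseteq> W"
      using d by (auto simp: W_def)
    ultimately obtain X where X: "open X" "x0 \<in> X" "X \<times> Q \<subseteq> W"
      using Elementary_Topology.tube_lemma[OF Q(1), of W x0] by auto
    have "dist (LINT y|\<mu>. \<Phi> x y) (LINT y|\<mu>. \<Phi> x0 y) < e" if "x \<in> X" for x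
    proof -
      have "norm (\<Phi> x y - \<Phi> x0 y) \<le> d * indicator Q y" for y
        using that X(3) Q(2) d by (cases "y \<in> Q") (auto simp: W_def less_imp_le)
      moreover have "integrable \<mu> (\<lambda>y. d * indicator Q y)"
        using emeasure_compact_finite[OF Q(1)] sets_compact[OF Q(1)] by simp
      ultimately have "(LINT y|\<mu>. norm (\<Phi> x y - \<Phi> x0 y)) \<le> (LINT y|\<mu>. d * indicator Q y)"
        by (intro integral_mono integrable_norm Bochner_Integration.integrable_diff int)
      then have "norm (LINT y|\<mu>. \<Phi> x y - \<Phi> x0 y) \<le> (LINT y|\<mu>. d * indicator Q y)"
        by (rule order_trans[OF integral_norm_bound])
      also have "\<dots> = d * measure \<mu> Q"
        by (simp add: space_UNIV)
      also have "\<dots> < e"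
      proof -
        have "d * measure \<mu> Q < d * (measure \<mu> Q + 1)" using d by simp
        also have "\<dots> = e"
          using measure_nonneg[of \<mu> Q] unfolding d_def by (simp add: add_nonneg_eq_0_iff)
        finally show ?thesis .
      qed
      finally show ?thesis
        using int by (simp add: dist_norm)
    qed
    then show "\<forall>\<^sub>F x in at x0. dist (LINT y|\<mu>. \<Phi> x y) (LINT y|\<mu>. \<Phi> x0 y) < e"
      using X by (auto simp: eventually_at_topological)
  qed
  then show ?thesis
    by (simp add: continuous_on_def)
qed

lemma Cc_section: "\<phi> \<in> Cc \<Longrightarrow> (\<lambda>y. \<phi> (x, y)) \<in> Cc"
proof -
  assume \<phi>: "\<phi> \<in> Cc"
  then obtain C where C: "compact C" "\<And>p. p \<notin> C \<Longrightarrow> \<phi> p = 0"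
    by (metis Cc_support)
  show ?thesis
  proof (rule CcI)
    show "continuous_on UNIV (\<lambda>y. \<phi> (x, y))"
      by (rule continuous_on_compose2[OF Cc_continuous[OF \<phi>]]) (auto intro: continuous_intros)
    show "compact (snd ` C)"
      using C(1) by (intro compact_continuous_image continuous_intros)
  qed (use C in force)
qed

lemma Cc_integrate_out:
  fixes \<phi> :: "'x::t2_space \<times> 'a \<Rightarrow> 'b::{banach, second_countable_topology}"
  assumes "\<phi> \<in> Cc"
  shows "(\<lambda>x. LINT y|\<mu>. \<phi> (x, y)) \<in> Cc"
proof -
  obtain C where C: "compact C" "\<And>p. p \<notin> C \<Longrightarrow> \<phi> p = 0"
    by (metis Cc_support assms)
  show ?thesis
  proof (rule CcI)
    show "continuous_on UNIV (\<lambda>x. LINT y|\<mu>. \<phi> (x, y))"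
    proof (rule continuous_parametric_integral[of "\<lambda>x y. \<phi> (x, y)" "snd ` C"])
      show "compact (snd ` C)"
        using C(1) by (intro compact_continuous_image continuous_intros)
    qed (use C Cc_continuous[OF assms] in force)+
    show "compact (fst ` C)"
      using C(1) by (intro compact_continuous_image continuous_intros)
    show "(LINT y|\<mu>. \<phi> (x, y)) = 0" if "x \<notin> fst ` C" for x
    proof -
      have "\<phi> (x, y) = 0" for y
        using that C(2)[of "(x, y)"] by force
      then show ?thesis by simp
    qed
  qed
qed


text \<open>Integrals of nonnegative functions are exhausted by compact sets: the measures of sets are,
  and the compact sets form a directed family.\<close>

lemma nn_integral_compact:
  assumes "g \<in> borel_measurable \<mu>"
  shows "(\<integral>\<^sup>+x. g x \<partial>\<mu>) = (SUP C\<in>{C. compact C}. \<integral>\<^sup>+x. g x * indicator C x \<partial>\<mu>)"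
  using assms
proof (induction rule: borel_measurable_induct)
  case (cong f g)
  then show ?case by (simp add: space_UNIV)
next
  case (set A)
  have "(\<integral>\<^sup>+x. indicator A x \<partial>\<mu>) = (SUP C\<in>{C. compact C \<and> C \<subseteq> A}. emeasure \<mu> C)"
    using set by (simp add: emeasure_inner[symmetric])
  also have "\<dots> = (SUP C\<in>{C. compact C}. \<integral>\<^sup>+x. indicator A x * indicator C x \<partial>\<mu>)"
  proof (rule antisym)
    show "(SUP C\<in>{C. compact C \<and> C \<subseteq> A}. emeasure \<mu> C)
      \<le> (SUP C\<in>{C. compact C}. \<integral>\<^sup>+x. indicator A x * indicator C x \<partial>\<mu>)"
    proof (rule SUP_mono)
      fix C assume "C \<in> {C. compact C \<and> C \<subseteq> A}"
      then show "\<exists>D\<in>{C. compact C}. emeasure \<mu> C \<le> (\<integral>\<^sup>+x. indicator A x * indicator D x \<partial>\<mu>)"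
        using sets_compact[of C] set
        by (intro bexI[of _ C]) (auto simp: indicator_inter_arith[symmetric] Int_absorb1)
    qed
    show "(SUP C\<in>{C. compact C}. \<integral>\<^sup>+x. indicator A x * indicator C x \<partial>\<mu>)
      \<le> (SUP C\<in>{C. compact C \<and> C \<subseteq> A}. emeasure \<mu> C)"
    proof (rule SUP_least)
      fix C :: "'a set" assume "C \<in> {C. compact C}"
      then have "(\<integral>\<^sup>+x. indicator A x * indicator C x \<partial>\<mu>) \<le> emeasure \<mu> A"
        using set sets_compact[of C]
        by (simp add: indicator_inter_arith[symmetric] emeasure_mono)
      then show "(\<integral>\<^sup>+x. indicator A x * indicator C x \<partial>\<mu>) \<le> (SUP C\<in>{C. compact C \<and> C \<subseteq> A}. emeasure \<mu> C)"
        using set by (simp add: emeasure_inner[symmetric])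
    qed
  qed
  finally show ?case .
next
  case (mult u c)
  have "(\<integral>\<^sup>+x. c * u x * indicator C x \<partial>\<mu>) = c * (\<integral>\<^sup>+x. u x * indicator C x \<partial>\<mu>)" if "compact C" for C
    unfolding mult.assoc using mult(2) sets_compact[OF that] by (intro nn_integral_cmult) auto
  then show ?case
    using mult by (simp add: nn_integral_cmult SUP_mult_left_ennreal)
next
  case (add u v)
  have "(\<integral>\<^sup>+x. (v x + u x) * indicator C x \<partial>\<mu>)
      = (\<integral>\<^sup>+x. v x * indicator C x \<partial>\<mu>) + (\<integral>\<^sup>+x. u x * indicator C x \<partial>\<mu>)" if "compact C" for C
    unfolding distrib_right using add(1,3) sets_compact[OF that] by (intro nn_integral_add) auto
  then have "(SUP C\<in>{C. compact C}. \<integral>\<^sup>+x. (v x + u x) * indicator C x \<partial>\<mu>)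
      = (SUP C\<in>{C. compact C}. (\<integral>\<^sup>+x. v x * indicator C x \<partial>\<mu>) + (\<integral>\<^sup>+x. u x * indicator C x \<partial>\<mu>))"
    by (intro SUP_cong) auto
  also have "\<dots> = (SUP C\<in>{C. compact C}. \<integral>\<^sup>+x. v x * indicator C x \<partial>\<mu>)
      + (SUP C\<in>{C. compact C}. \<integral>\<^sup>+x. u x * indicator C x \<partial>\<mu>)"
  proof (rule SUP_add_directed_ennreal)
    fix C D :: "'a set" assume "C \<in> {C. compact C}" "D \<in> {C. compact C}"
    then show "\<exists>K\<in>{C. compact C}. (\<integral>\<^sup>+x. v x * indicator C x \<partial>\<mu>) + (\<integral>\<^sup>+x. u x * indicator D x \<partial>\<mu>)
      \<le> (\<integral>\<^sup>+x. v x * indicator K x \<partial>\<mu>) + (\<integral>\<^sup>+x. u x * indicator K x \<partial>\<mu>)"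
      by (intro bexI[of _ "C \<union> D"] add_mono nn_integral_mono) (auto split: split_indicator intro: compact_Un)
  qed
  finally show ?case
    using add by (simp add: nn_integral_add)
next
  case (seq U)
  have "(\<integral>\<^sup>+x. (SUP i. U i) x \<partial>\<mu>) = (SUP i. \<integral>\<^sup>+x. U i x \<partial>\<mu>)"
    unfolding SUP_apply using seq by (intro nn_integral_monotone_convergence_SUP) auto
  also have "\<dots> = (SUP i. SUP C\<in>{C. compact C}. \<integral>\<^sup>+x. U i x * indicator C x \<partial>\<mu>)"
    by (rule SUP_cong[OF refl seq.IH])
  also have "\<dots> = (SUP C\<in>{C. compact C}. SUP i. \<integral>\<^sup>+x. U i x * indicator C x \<partial>\<mu>)"
    by (rule SUP_commute)
  also have "\<dots> = (SUP C\<in>{C. compact C}. \<integral>\<^sup>+x. (SUP i. U i) x * indicator C x \<partial>\<mu>)"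
  proof (rule SUP_cong)
    fix C :: "'a set" assume "C \<in> {C. compact C}"
    then have C: "C \<in> sets \<mu>" by (simp add: sets_compact)
    have "(SUP i. \<integral>\<^sup>+x. U i x * indicator C x \<partial>\<mu>) = (\<integral>\<^sup>+x. (SUP i. U i x * indicator C x) \<partial>\<mu>)"
    proof (rule nn_integral_monotone_convergence_SUP[symmetric])
      show "incseq (\<lambda>i x. U i x * indicator C x)"
      proof (rule monoI, rule le_funI, rule mult_right_mono)
        show "U m x \<le> U n x" if "m \<le> n" for m n x
          using incseqD[OF \<open>incseq U\<close> that] by (rule le_funD)
      qed simp
      show "(\<lambda>x. U i x * indicator C x) \<in> borel_measurable \<mu>" for i
        using seq(1) C by measurable
    qed
    then show "(SUP i. \<integral>\<^sup>+x. U i x * indicator C x \<partial>\<mu>) = (\<integral>\<^sup>+x. (SUP i. U i) x * indicator C x \<partial>\<mu>)"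
      by (simp add: SUP_mult_right_ennreal image_comp)
  qed simp
  finally show ?case .
qed

lemma nn_integral_le_of_compact:
  assumes "g \<in> borel_measurable \<mu>" "\<And>C. compact C \<Longrightarrow> (\<integral>\<^sup>+x. g x * indicator C x \<partial>\<mu>) \<le> b"
  shows "(\<integral>\<^sup>+x. g x \<partial>\<mu>) \<le> b"
  unfolding nn_integral_compact[OF assms(1)] using assms(2) by (intro SUP_least) auto

end

section \<open>Density of compactly supported continuous functions\<close>

context radon
begin

definition Cc_approximable :: "('a \<Rightarrow> complex) \<Rightarrow> bool"
  where "Cc_approximable f \<longleftrightarrow> f \<in> L2 \<mu> \<and> (\<forall>e>0. \<exists>g\<in>Cc. L2_norm \<mu> (\<lambda>x. f x - g x) \<le> e)"

lemma Cc_approximable_add: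
  assumes f: "Cc_approximable f" and g: "Cc_approximable g"
  shows "Cc_approximable (\<lambda>x. f x + g x)"
  unfolding Cc_approximable_def
proof (intro conjI allI impI)
  have L: "f \<in> L2 \<mu>" "g \<in> L2 \<mu>" using assms by (auto simp: Cc_approximable_def)
  then show "(\<lambda>x. f x + g x) \<in> L2 \<mu>" by (rule L2_add)
  fix e :: real assume "0 < e"
  then have "0 < e/2" by simp
  obtain f' where f': "f' \<in> Cc" "L2_norm \<mu> (\<lambda>x. f x - f' x) \<le> e/2"
    using f \<open>0 < e/2\<close> unfolding Cc_approximable_def by metis
  obtain g' where g': "g' \<in> Cc" "L2_norm \<mu> (\<lambda>x. g x - g' x) \<le> e/2"
    using g \<open>0 < e/2\<close> unfolding Cc_approximable_def by metis
  have "L2_norm \<mu> (\<lambda>x. (f x - f' x) + (g x - g' x)) \<le> e/2 + e/2"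
    by (intro order_trans[OF L2_norm_triangle] add_mono f' g' L2_diff L Cc_L2)
  moreover have "(\<lambda>x. (f x - f' x) + (g x - g' x)) = (\<lambda>x. f x + g x - (f' x + g' x))"
    by (simp add: fun_eq_iff)
  ultimately show "\<exists>k\<in>Cc. L2_norm \<mu> (\<lambda>x. f x + g x - k x) \<le> e"
    using Cc_add[OF f'(1) g'(1)] by (intro bexI[of _ "\<lambda>x. f' x + g' x"]) simp_all
qed

lemma Cc_approximable_zero: "Cc_approximable (\<lambda>x. 0)"
  unfolding Cc_approximable_def using Cc_zero by (auto intro!: bexI[of _ "\<lambda>x. 0"])

lemma Cc_approximable_sum:
  assumes "finite I" "\<And>i. i \<in> I \<Longrightarrow> Cc_approximable (f i)"
  shows "Cc_approximable (\<lambda>x. \<Sum>i\<in>I. f i x)"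
  using assms by (induction I rule: finite_induct) (simp_all add: Cc_approximable_zero Cc_approximable_add)

lemma Cc_approximable_cmult:
  assumes f: "Cc_approximable f"
  shows "Cc_approximable (\<lambda>x. c * f x)"
  unfolding Cc_approximable_def
proof (intro conjI allI impI)
  have L: "f \<in> L2 \<mu>" using assms by (auto simp: Cc_approximable_def)
  then show "(\<lambda>x. c * f x) \<in> L2 \<mu>" by (rule L2_cmult)
  fix e :: real assume e: "0 < e"
  have d: "0 < e / (cmod c + 1)"
    using e norm_ge_zero[of c] by (intro divide_pos_pos) linarith+
  obtain f' where f': "f' \<in> Cc" "L2_norm \<mu> (\<lambda>x. f x - f' x) \<le> e / (cmod c + 1)"
    using f d unfolding Cc_approximable_def by metis
  have "L2_norm \<mu> (\<lambda>x. c * f x - c * f' x) = cmod c * L2_norm \<mu> (\<lambda>x. f x - f' x)"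
    using L2_cmult(2)[OF L2_diff[OF L Cc_L2[OF f'(1)]], of c] by (simp add: right_diff_distrib)
  also have "\<dots> \<le> (cmod c + 1) * (e / (cmod c + 1))"
    by (intro mult_mono f') auto
  also have "\<dots> = e"
    using norm_ge_zero[of c] by (simp add: add_nonneg_eq_0_iff)
  finally show "\<exists>k\<in>Cc. L2_norm \<mu> (\<lambda>x. c * f x - k x) \<le> e"
    using Cc_cmult[OF f'(1)] by (intro bexI[of _ "\<lambda>x. c * f' x"])
qed

lemma Cc_approximable_limit:
  assumes F: "\<And>n. Cc_approximable (F n)" and f: "f \<in> L2 \<mu>"
    and lim: "(\<lambda>n. L2_norm \<mu> (\<lambda>x. F n x - f x)) \<longlonglongrightarrow> 0"
  shows "Cc_approximable f"
  unfolding Cc_approximable_def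
proof (intro conjI allI impI f)
  fix e :: real assume "0 < e"
  then have "0 < e/2" by simp
  obtain n where n: "L2_norm \<mu> (\<lambda>x. F n x - f x) < e/2"
    using LIMSEQ_D[OF lim \<open>0 < e/2\<close>] by auto
  obtain g where g: "g \<in> Cc" "L2_norm \<mu> (\<lambda>x. F n x - g x) \<le> e/2"
    using F[of n] \<open>0 < e/2\<close> unfolding Cc_approximable_def by metis
  have "L2_norm \<mu> (\<lambda>x. f x - g x) \<le> L2_norm \<mu> (\<lambda>x. f x - F n x) + L2_norm \<mu> (\<lambda>x. F n x - g x)"
    using F[of n] f Cc_L2[OF g(1)] by (intro L2_norm_diff_triangle) (auto simp: Cc_approximable_def)
  also have "\<dots> \<le> e"
    using n g(2) L2_norm_minus_commute[of \<mu> f "F n"] by simp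
  finally show "\<exists>g\<in>Cc. L2_norm \<mu> (\<lambda>x. f x - g x) \<le> e"
    using g(1) by blast
qed

text \<open>Squeeze a set between a compact set and an open set of nearly the same measure and
  interpolate by Urysohn's lemma.\<close>

lemma Cc_approximable_indicator:
  assumes E: "E \<in> sets \<mu>" "emeasure \<mu> E < \<infinity>"
  shows "Cc_approximable (\<lambda>x. complex_of_real (indicator E x))"
  unfolding Cc_approximable_def
proof (intro conjI allI impI)
  have [measurable]: "E \<in> sets \<mu>" by (rule E)
  have sq: "(cmod (complex_of_real (indicator E x)))\<^sup>2 = indicator E x" for x
    by (simp split: split_indicator)
  show "(\<lambda>x. complex_of_real (indicator E x)) \<in> L2 \<mu>"
    unfolding L2_def mem_Collect_eq sq using E by simp
  fix e :: real assume "0 < e"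
  then have e2: "0 < e\<^sup>2/2" by simp
  obtain C where C: "compact C" "C \<subseteq> E" "emeasure \<mu> (E - C) \<le> ennreal (e\<^sup>2/2)"
    using inner_approx[OF E e2] by metis
  obtain U where U: "open U" "C \<subseteq> U" "emeasure \<mu> (U - C) \<le> ennreal (e\<^sup>2/2)"
    using outer_approx[OF sets_compact[OF C(1)] order_refl C(1) e2] by metis
  obtain \<phi> :: "'a \<Rightarrow> real" where \<phi>: "\<phi> \<in> Cc" "\<And>x. 0 \<le> \<phi> x" "\<And>x. \<phi> x \<le> 1"
      "\<And>x. x \<in> C \<Longrightarrow> \<phi> x = 1" "\<And>x. x \<notin> U \<Longrightarrow> \<phi> x = 0"
    using Urysohn_Cc[OF locally_compact C(1) U(1,2)] by metis
  have [measurable]: "C \<in> sets \<mu>" "U \<in> sets \<mu>"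
    using C U by (auto intro: sets_compact sets_open)
  note [measurable] = Cc_measurable[OF \<phi>(1)]
  have "(\<integral>\<^sup>+x. ennreal ((cmod (complex_of_real (indicator E x) - complex_of_real (\<phi> x)))\<^sup>2) \<partial>\<mu>)
      \<le> (\<integral>\<^sup>+x. indicator (E - C) x + indicator (U - C) x \<partial>\<mu>)"
  proof (rule nn_integral_mono)
    fix x
    have le1: "(cmod (complex_of_real (indicator E x) - complex_of_real (\<phi> x)))\<^sup>2 \<le> 1"
    proof -
      have "\<bar>indicator E x - \<phi> x\<bar> \<le> 1"
        using \<phi>(2,3)[of x] by (auto split: split_indicator)
      then show ?thesis
        unfolding of_real_diff[symmetric] norm_of_real by (simp add: abs_square_le_1)
    qed
    consider "x \<in> C" | "x \<in> E - C" | "x \<in> U - C" | "x \<notin> E" "x \<notin> U" by blast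
    then show "ennreal ((cmod (complex_of_real (indicator E x) - complex_of_real (\<phi> x)))\<^sup>2)
      \<le> indicator (E - C) x + indicator (U - C) x"
    proof cases
      case 1
      then have "x \<in> E" using C by auto
      then show ?thesis using \<phi>(4)[OF 1] by simp
    next
      case 2
      then show ?thesis using le1 by (intro add_increasing2) auto
    next
      case 3
      then show ?thesis using le1 by (intro add_increasing) auto
    next
      case 4
      then show ?thesis by (simp add: \<phi>(5))
    qed
  qed
  also have "\<dots> = emeasure \<mu> (E - C) + emeasure \<mu> (U - C)"
    by (subst nn_integral_add) auto
  also have "\<dots> \<le> ennreal (e\<^sup>2/2) + ennreal (e\<^sup>2/2)"
    by (intro add_mono C U)
  also have "\<dots> = ennreal (e\<^sup>2)"
    by (subst ennreal_plus[symmetric]) auto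
  finally have "L2_norm \<mu> (\<lambda>x. complex_of_real (indicator E x) - complex_of_real (\<phi> x)) \<le> e"
    using \<open>0 < e\<close> by (intro L2_norm_le_nn_integral(2)) auto
  then show "\<exists>g\<in>Cc. L2_norm \<mu> (\<lambda>x. complex_of_real (indicator E x) - g x) \<le> e"
    using Cc_of_real[OF \<phi>(1)] by (intro bexI[of _ "\<lambda>x. complex_of_real (\<phi> x)"])
qed

lemma Cc_approximable_simple:
  assumes s: "simple_function \<mu> s" "s \<in> L2 \<mu>"
  shows "Cc_approximable s"
proof -
  have fin: "finite (range s)"
    using s(1) by (simp add: simple_function_def space_UNIV)
  have meas: "s -` {z} \<in> sets \<mu>" for z
    using measurable_sets[OF L2_measurable[OF s(2)], of "{z}"] by (simp add: space_UNIV)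
  have "s x = (\<Sum>z\<in>range s - {0}. z * complex_of_real (indicator (s -` {z}) x))" for x
  proof -
    have "(\<Sum>z\<in>range s - {0}. z * complex_of_real (indicator (s -` {z}) x))
        = (\<Sum>z\<in>range s - {0}. if z = s x then s x else 0)"
      by (intro sum.cong) (auto split: split_indicator)
    also have "\<dots> = s x"
      using fin by (simp add: sum.delta)
    finally show ?thesis by simp
  qed
  then have eq: "s = (\<lambda>x. \<Sum>z\<in>range s - {0}. z * complex_of_real (indicator (s -` {z}) x))"
    by (rule ext)
  have "Cc_approximable (\<lambda>x. \<Sum>z\<in>range s - {0}. z * complex_of_real (indicator (s -` {z}) x))"
  proof (intro Cc_approximable_sum Cc_approximable_cmult Cc_approximable_indicator meas)
    show "finite (range s - {0})" using fin by simp
    fix z assume z: "z \<in> range s - {0}"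
    have "ennreal ((cmod z)\<^sup>2) * emeasure \<mu> (s -` {z}) = (\<integral>\<^sup>+x. ennreal ((cmod z)\<^sup>2) * indicator (s -` {z}) x \<partial>\<mu>)"
      using meas by (simp add: nn_integral_cmult_indicator)
    also have "\<dots> \<le> (\<integral>\<^sup>+x. ennreal ((cmod (s x))\<^sup>2) \<partial>\<mu>)"
      by (intro nn_integral_mono) (auto split: split_indicator)
    also have "\<dots> < \<infinity>"
      using s(2) by (simp add: L2_iff_nn_integral)
    finally show "emeasure \<mu> (s -` {z}) < \<infinity>"
      using z by (auto simp: ennreal_mult_less_top)
  qed
  then show ?thesis using eq by simp
qed

lemma Cc_dense:
  assumes f: "f \<in> L2 \<mu>" and e: "0 < e"
  obtains g where "g \<in> Cc" "L2_norm \<mu> (\<lambda>x. f x - g x) \<le> e"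
proof -
  note [measurable] = L2_measurable[OF f]
  obtain F where F: "\<And>i. simple_function \<mu> (F i)" "\<And>x. (\<lambda>i. F i x) \<longlonglongrightarrow> f x"
      "\<And>i x. cmod (F i x) \<le> 2 * cmod (f x)"
    using borel_measurable_implies_sequence_metric[OF L2_measurable[OF f], of 0]
    by (auto simp: space_UNIV)
  note [measurable] = borel_measurable_simple_function[OF F(1)]
  have le: "(cmod (F i x))\<^sup>2 \<le> 4 * (cmod (f x))\<^sup>2" for i x
    using power_mono[OF F(3)[of i x], of 2] by simp
  have L: "F i \<in> L2 \<mu>" for i
  proof -
    have "integrable \<mu> (\<lambda>x. (cmod (F i x))\<^sup>2)"
      by (rule Bochner_Integration.integrable_bound[of _ "\<lambda>x. 4 * (cmod (f x))\<^sup>2"])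
         (use L2_integrable[OF f] le[of i] in simp_all)
    then show ?thesis by (simp add: L2_def)
  qed
  have "(\<lambda>i. LINT x|\<mu>. (cmod (F i x - f x))\<^sup>2) \<longlonglongrightarrow> (LINT x|\<mu>. 0)"
  proof (rule integral_dominated_convergence[where w = "\<lambda>x. 9 * (cmod (f x))\<^sup>2"])
    show "integrable \<mu> (\<lambda>x. 9 * (cmod (f x))\<^sup>2)"
      using L2_integrable[OF f] by simp
    show "AE x in \<mu>. (\<lambda>i. (cmod (F i x - f x))\<^sup>2) \<longlonglongrightarrow> 0"
    proof (rule AE_I2)
      fix x
      have "(\<lambda>i. (cmod (F i x - f x))\<^sup>2) \<longlonglongrightarrow> (cmod (f x - f x))\<^sup>2"
        by (intro tendsto_power tendsto_norm tendsto_diff F tendsto_const)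
      then show "(\<lambda>i. (cmod (F i x - f x))\<^sup>2) \<longlonglongrightarrow> 0" by simp
    qed
    show "AE x in \<mu>. norm ((cmod (F i x - f x))\<^sup>2) \<le> 9 * (cmod (f x))\<^sup>2" for i
    proof (rule AE_I2)
      fix x
      have "cmod (F i x - f x) \<le> 3 * cmod (f x)"
        using norm_triangle_ineq4[of "F i x" "f x"] F(3)[of i x] by linarith
      from power_mono[OF this, of 2]
      show "norm ((cmod (F i x - f x))\<^sup>2) \<le> 9 * (cmod (f x))\<^sup>2" by simp
    qed
  qed measurable
  then have "(\<lambda>i. sqrt (LINT x|\<mu>. (cmod (F i x - f x))\<^sup>2)) \<longlonglongrightarrow> sqrt 0"
    by (intro tendsto_real_sqrt) simp
  then have "(\<lambda>i. L2_norm \<mu> (\<lambda>x. F i x - f x)) \<longlonglongrightarrow> 0"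
    by (simp add: L2_norm_def)
  then have "Cc_approximable f"
    by (rule Cc_approximable_limit[OF Cc_approximable_simple[OF F(1) L] f])
  then show ?thesis
    using e that unfolding Cc_approximable_def by metis
qed

lemma Cc_dense_fast:
  assumes f: "f \<in> L2 \<mu>"
  obtains F where "\<And>n::nat. F n \<in> Cc" "L2_fast \<mu> F f"
proof -
  have "\<exists>g. g \<in> Cc \<and> L2_norm \<mu> (\<lambda>x. f x - g x) \<le> 1 / 2 ^ n" for n :: nat
    using Cc_dense[OF f, of "1 / 2 ^ n"] by auto
  then obtain F where F: "\<And>n. F n \<in> Cc" "\<And>n. L2_norm \<mu> (\<lambda>x. f x - F n x) \<le> 1 / 2 ^ n"
    by metis
  moreover have "L2_fast \<mu> F f"
    unfolding L2_fast_def using f Cc_L2[OF F(1)] F(2) L2_norm_minus_commute[of \<mu> f] by auto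
  ultimately show ?thesis
    using that by blast
qed

end

section \<open>Iterated integrals of compactly supported functions\<close>

lemma finite_Borel_partition:
  fixes P :: "'a::t2_space set"
  assumes P: "compact P" and V: "\<And>x. open (V x)" "\<And>x. x \<in> V x"
  obtains n :: nat and x B where "\<And>i. B i \<in> sets borel" "\<And>i. i < n \<Longrightarrow> B i \<subseteq> V (x i)"
    "disjoint_family_on B {..<n}" "(\<Union>i<n. B i) = P"
proof -
  obtain F where F: "F \<subseteq> P" "finite F" "P \<subseteq> (\<Union>x\<in>F. V x)"
    by (rule compactE_image[OF P, of P V]) (use V in auto)
  obtain x n where x: "F = x ` {i::nat. i < n}"
    using finite_imp_nat_seg_image_inj_on[OF F(2)] by blast
  define B where "B i = disjointed (\<lambda>i. P \<inter> V (x i)) i" for i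
  show ?thesis
  proof
    have "disjointed (\<lambda>i. P \<inter> V (x i)) i \<in> sets borel" for i
      unfolding disjointed_def using P V(1)
      by (intro sets.Diff sets.countable_UN'' sets.Int) (auto intro: borel_closed compact_imp_closed)
    then show "B i \<in> sets borel" for i
      by (simp add: B_def)
    show "B i \<subseteq> V (x i)" for i
      using disjointed_subset[of "\<lambda>i. P \<inter> V (x i)" i] by (auto simp: B_def)
    show "disjoint_family_on B {..<n}"
      using disjoint_family_disjointed[of "\<lambda>i. P \<inter> V (x i)"]
      by (auto simp: B_def[abs_def] disjoint_family_on_def)
    have "(\<Union>i<n. B i) = (\<Union>i<n. P \<inter> V (x i))"
      using finite_UN_disjointed_eq[of "\<lambda>i. P \<inter> V (x i)" n] by (simp add: B_def lessThan_atLeast0)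
    also have "\<dots> = P"
      using F(3) by (auto simp: x)
    finally show "(\<Union>i<n. B i) = P" .
  qed
qed

locale radon_pair = X: radon \<alpha> + Y: radon \<beta>
  for \<alpha> :: "'a::t2_space measure" and \<beta> :: "'b::t2_space measure"
begin

text \<open>A compactly supported function is, uniformly, a finite sum of products of a Borel indicator
  in the first variable and a continuous function in the second; for such sums the two iterated
  integrals agree by linearity.\<close>

lemma Cc_Fubini:
  fixes \<phi> :: "'a \<times> 'b \<Rightarrow> real"
  assumes \<phi>: "\<phi> \<in> Cc"
  shows "(LINT x|\<alpha>. LINT y|\<beta>. \<phi> (x, y)) = (LINT y|\<beta>. LINT x|\<alpha>. \<phi> (x, y))"
proof -
  obtain C where C: "compact C" "\<And>p. p \<notin> C \<Longrightarrow> \<phi> p = 0"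
    by (metis Cc_support \<phi>)
  define P Q where "P = fst ` C" and "Q = snd ` C"
  have P: "compact P" and Q: "compact Q"
    unfolding P_def Q_def using C(1) by (auto intro!: compact_continuous_image continuous_intros)
  have zero: "\<phi> (x, y) = 0" if "x \<notin> P \<or> y \<notin> Q" for x y
    using that C(2)[of "(x, y)"] by (force simp: P_def Q_def)
  have swap: "(\<lambda>(y, x). \<phi> (x, y)) \<in> Cc"
  proof (rule CcI)
    show "continuous_on UNIV (\<lambda>(y, x). \<phi> (x, y))"
      unfolding case_prod_beta
      by (rule continuous_on_compose2[OF Cc_continuous[OF \<phi>]]) (auto intro!: continuous_intros)
    show "compact (Q \<times> P)" using P Q by (rule compact_Times[rotated])
  qed (use zero in auto)
  have secX: "integrable \<alpha> (\<lambda>x. \<phi> (x, y))" for y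
    using X.Cc_integrable[OF Y.Cc_section[OF swap, of y]] by simp
  have secY: "integrable \<beta> (\<lambda>y. \<phi> (x, y))" for x
    by (intro Y.Cc_integrable Y.Cc_section \<phi>)
  have intX: "integrable \<alpha> (\<lambda>x. LINT y|\<beta>. \<phi> (x, y))"
    by (intro X.Cc_integrable Y.Cc_integrate_out \<phi>)
  have intY: "integrable \<beta> (\<lambda>y. LINT x|\<alpha>. \<phi> (x, y))"
    using Y.Cc_integrable[OF X.Cc_integrate_out[OF swap]] by simp
  have indX: "integrable \<alpha> (\<lambda>x. c * indicator P x)" for c :: real
    using X.emeasure_compact_finite[OF P] X.sets_compact[OF P] by simp
  have indY: "integrable \<beta> (\<lambda>y. c * indicator Q y)" for c :: real
    using Y.emeasure_compact_finite[OF Q] Y.sets_compact[OF Q] by simp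
  define c where "c = measure \<alpha> P * measure \<beta> Q"
  have "\<bar>(LINT x|\<alpha>. LINT y|\<beta>. \<phi> (x, y)) - (LINT y|\<beta>. LINT x|\<alpha>. \<phi> (x, y))\<bar> \<le> e * (2 * c)" if e: "0 < e" for e
  proof -
    have "\<exists>V. open V \<and> x \<in> V \<and> (\<forall>x'\<in>V. \<forall>y\<in>Q. \<bar>\<phi> (x', y) - \<phi> (x, y)\<bar> < e)" for x
    proof -
      define W where "W = (\<lambda>p. \<bar>\<phi> p - \<phi> (x, snd p)\<bar>) -` {..<e}"
      have "continuous_on UNIV (\<lambda>p. \<bar>\<phi> p - \<phi> (x, snd p)\<bar>)"
        by (intro continuous_intros Cc_continuous[OF \<phi>] continuous_on_compose2[OF Cc_continuous[OF \<phi>]]) auto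
      then have "open W" unfolding W_def by (intro open_vimage) auto
      moreover have "{x} \<times> Q \<subseteq> W" using e by (auto simp: W_def)
      ultimately obtain V where "x \<in> V" "open V" "V \<times> Q \<subseteq> W"
        using Elementary_Topology.tube_lemma[OF Q] by metis
      then show ?thesis
        by (intro exI[of _ V]) (auto simp: W_def)
    qed
    then obtain V where V: "\<And>x. open (V x)" "\<And>x. x \<in> V x"
        "\<And>x x' y. x' \<in> V x \<Longrightarrow> y \<in> Q \<Longrightarrow> \<bar>\<phi> (x', y) - \<phi> (x, y)\<bar> < e"
      by metis
    obtain n :: nat and x B where B: "\<And>i. B i \<in> sets borel" "\<And>i. i < n \<Longrightarrow> B i \<subseteq> V (x i)"
        "disjoint_family_on B {..<n}" "(\<Union>i<n. B i) = P"
      using finite_Borel_partition[OF P V(1,2)] by metis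
    \<comment> \<open>Replace x' by the centre x i of the cell B i that contains it.\<close>
    define S where "S x' y = (\<Sum>i<n. indicator (B i) x' * \<phi> (x i, y))" for x' y
    have fin: "emeasure \<alpha> (B i) < \<infinity>" if "i < n" for i
    proof -
      have "emeasure \<alpha> (B i) \<le> emeasure \<alpha> P"
        using B(4) that by (intro emeasure_mono X.sets_compact[OF P]) auto
      then show ?thesis using X.emeasure_compact_finite[OF P] by (rule le_less_trans)
    qed
    have Bint: "integrable \<alpha> (\<lambda>x'. indicator (B i) x' * c)" if "i < n" for i and c :: real
      using fin[OF that] X.sets_borel[OF B(1)] by simp
    have Bsum: "integrable \<alpha> (\<lambda>x'. \<Sum>i<n. indicator (B i) x' * c i)"
        "(LINT x'|\<alpha>. (\<Sum>i<n. indicator (B i) x' * c i)) = (\<Sum>i<n. measure \<alpha> (B i) * c i)" for c :: "nat \<Rightarrow> real"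
    proof -
      show "integrable \<alpha> (\<lambda>x'. \<Sum>i<n. indicator (B i) x' * c i)"
        by (rule Bochner_Integration.integrable_sum, rule Bint) simp
      have "(LINT x'|\<alpha>. (\<Sum>i<n. indicator (B i) x' * c i)) = (\<Sum>i<n. (LINT x'|\<alpha>. indicator (B i) x' * c i))"
        by (rule Bochner_Integration.integral_sum, rule Bint) simp
      also have "\<dots> = (\<Sum>i<n. measure \<alpha> (B i) * c i)"
        by (simp add: X.space_UNIV)
      finally show "(LINT x'|\<alpha>. (\<Sum>i<n. indicator (B i) x' * c i)) = (\<Sum>i<n. measure \<alpha> (B i) * c i)" .
    qed
    have close: "\<bar>\<phi> (x', y) - S x' y\<bar> \<le> e * indicator P x' * indicator Q y" for x' y
    proof (cases "x' \<in> P \<and> y \<in> Q")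
      case True
      then obtain j where j: "j < n" "x' \<in> B j" using B(4) by auto
      have "indicator (B i) x' * \<phi> (x i, y) = (if i = j then \<phi> (x j, y) else 0)" if "i < n" for i
        using that j B(3) by (auto simp: disjoint_family_on_def split: split_indicator)
      then have "S x' y = (\<Sum>i<n. if i = j then \<phi> (x j, y) else 0)"
        unfolding S_def by (intro sum.cong) auto
      also have "\<dots> = \<phi> (x j, y)" using j by simp
      finally show ?thesis
        using True V(3)[of x' "x j" y] j B(2)[of j] by auto
    next
      case False
      have "S x' y = 0"
      proof (cases "y \<in> Q")
        case True
        with False B(4) have "x' \<notin> B i" if "i < n" for i using that by auto
        then show ?thesis by (simp add: S_def)
      qed (simp add: S_def zero)
      moreover have "\<phi> (x', y) = 0" using False zero by blast
      ultimately show ?thesis using e by simp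
    qed
    have SY: "integrable \<beta> (\<lambda>y. S x' y)" "(LINT y|\<beta>. S x' y) = (\<Sum>i<n. indicator (B i) x' * (LINT y|\<beta>. \<phi> (x i, y)))" for x'
      unfolding S_def using secY by simp_all
    have SX: "integrable \<alpha> (\<lambda>x'. S x' y)" "(LINT x'|\<alpha>. S x' y) = (\<Sum>i<n. measure \<alpha> (B i) * \<phi> (x i, y))" for y
      unfolding S_def by (rule Bsum)+
    have SXY: "integrable \<alpha> (\<lambda>x'. LINT y|\<beta>. S x' y)"
        "(LINT x'|\<alpha>. LINT y|\<beta>. S x' y) = (\<Sum>i<n. measure \<alpha> (B i) * (LINT y|\<beta>. \<phi> (x i, y)))"
      unfolding SY by (rule Bsum)+
    have SYX: "integrable \<beta> (\<lambda>y. LINT x'|\<alpha>. S x' y)"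
        "(LINT y|\<beta>. LINT x'|\<alpha>. S x' y) = (\<Sum>i<n. measure \<alpha> (B i) * (LINT y|\<beta>. \<phi> (x i, y)))"
      unfolding SX using secY by simp_all
    have bound: "\<bar>(LINT z|M. f z) - (LINT z|M. g z)\<bar> \<le> (LINT z|M. k z)"
      if "integrable M f" "integrable M g" "integrable M k" "\<And>z. \<bar>f z - g z\<bar> \<le> k z"
      for M :: "'z measure" and f g k :: "'z \<Rightarrow> real"
    proof -
      have "\<bar>LINT z|M. f z - g z\<bar> \<le> (LINT z|M. \<bar>f z - g z\<bar>)"
        using integral_norm_bound[of M "\<lambda>z. f z - g z"] by simp
      also have "\<dots> \<le> (LINT z|M. k z)"
        by (intro integral_mono that integrable_abs Bochner_Integration.integrable_diff)
      finally show ?thesis using that by simp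
    qed
    have 1: "\<bar>(LINT y|\<beta>. \<phi> (x', y)) - (LINT y|\<beta>. S x' y)\<bar> \<le> (e * measure \<beta> Q) * indicator P x'" for x'
      using bound[OF secY SY(1) indY close[of x']]
      by (simp add: Y.space_UNIV mult_ac)
    have 2: "\<bar>(LINT x|\<alpha>. \<phi> (x, y)) - (LINT x'|\<alpha>. S x' y)\<bar> \<le> (e * measure \<alpha> P) * indicator Q y" for y
    proof -
      have "\<bar>\<phi> (x', y) - S x' y\<bar> \<le> e * indicator Q y * indicator P x'" for x'
        using close[of x' y] by (simp add: mult_ac)
      from bound[OF secX SX(1) indX this] show ?thesis
        by (simp add: X.space_UNIV mult_ac)
    qed
    have "\<bar>(LINT x|\<alpha>. LINT y|\<beta>. \<phi> (x, y)) - (LINT x'|\<alpha>. LINT y|\<beta>. S x' y)\<bar> \<le> e * c"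
      using bound[OF intX SXY(1) indX 1] by (simp add: X.space_UNIV c_def mult_ac)
    moreover have "\<bar>(LINT y|\<beta>. LINT x|\<alpha>. \<phi> (x, y)) - (LINT y|\<beta>. LINT x'|\<alpha>. S x' y)\<bar> \<le> e * c"
      using bound[OF intY SYX(1) indY 2] by (simp add: Y.space_UNIV c_def mult_ac)
    ultimately show ?thesis
      unfolding SXY(2) SYX(2) by linarith
  qed note bound = this
  have c: "0 \<le> 2 * c" by (simp add: c_def)
  have "\<bar>(LINT x|\<alpha>. LINT y|\<beta>. \<phi> (x, y)) - (LINT y|\<beta>. LINT x|\<alpha>. \<phi> (x, y))\<bar> \<le> 0 + d" if d: "0 < d" for d
  proof -
    have "0 < d / (2 * c + 1)" using c d by (intro divide_pos_pos) linarith+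
    from bound[OF this] have "\<bar>(LINT x|\<alpha>. LINT y|\<beta>. \<phi> (x, y)) - (LINT y|\<beta>. LINT x|\<alpha>. \<phi> (x, y))\<bar> \<le> d / (2 * c + 1) * (2 * c)" .
    also have "\<dots> \<le> d / (2 * c + 1) * (2 * c + 1)"
      using c d by (intro mult_left_mono) auto
    also have "\<dots> = d" using c by simp
    finally show ?thesis by simp
  qed
  from field_le_epsilon[OF this] show ?thesis by simp
qed

end

section \<open>Haar measures\<close>

text \<open>Invariance is only postulated for Borel sets. It extends to the whole complete sigma-algebra
  because null subsets of compact sets have open neighbourhoods of small measure, and measurability
  can be tested on compact sets.\<close>

lemma (in radon) homeomorphism_preserves:
  assumes t: "continuous_on UNIV t" and s: "continuous_on UNIV s"
    and st: "\<And>x. s (t x) = x" and ts: "\<And>x. t (s x) = x"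
    and inv: "\<And>E. E \<in> sets borel \<Longrightarrow> emeasure \<mu> (t ` E) = emeasure \<mu> E"
  shows "s \<in> measurable \<mu> \<mu>" "distr \<mu> \<mu> s = \<mu>"
proof -
  have img: "t ` E = s -` E" for E
  proof (intro set_eqI iffI)
    show "x \<in> s -` E" if "x \<in> t ` E" for x using that st by auto
    show "x \<in> t ` E" if "x \<in> s -` E" for x
      using that ts[of x, symmetric] by (intro image_eqI[of _ _ "s x"]) auto
  qed
  have null: "t ` N \<in> null_sets \<mu>" if N: "N \<in> null_sets \<mu>" "N \<subseteq> K" "compact K" for N K
  proof (rule null_of_small_cover)
    fix e :: real assume "0 < e"
    then obtain U where U: "open U" "N \<subseteq> U" "emeasure \<mu> (U - N) \<le> ennreal e"
      using outer_approx[OF null_setsD2[OF N(1)] N(2,3)] by metis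
    have "emeasure \<mu> (t ` U) = emeasure \<mu> (U - N)"
      using inv[of U] U(1) emeasure_Diff_null_set[OF N(1) sets_open[OF U(1)]] by simp
    moreover have "open (t ` U)"
      unfolding img using U(1) s by (intro open_vimage)
    ultimately show "\<exists>A\<in>sets \<mu>. t ` N \<subseteq> A \<and> emeasure \<mu> A \<le> ennreal e"
      using U by (intro bexI[of _ "t ` U"]) (auto intro: sets_open)
  qed
  have ct: "compact (t ` C)" and cs: "compact (s ` C)" if "compact C" for C
    using that t s by (auto intro!: compact_continuous_image intro: continuous_on_subset)
  have meas: "t ` E \<in> sets \<mu>" if E: "E \<in> sets \<mu>" for E
  proof (rule sets_local)
    fix C :: "'a set" assume C: "compact C"
    have E': "E \<inter> s ` C \<in> sets \<mu>"
      using E sets_compact[OF cs[OF C]] by blast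
    have "emeasure \<mu> (E \<inter> s ` C) \<le> emeasure \<mu> (s ` C)"
      by (intro emeasure_mono sets_compact cs C) auto
    then have "emeasure \<mu> (E \<inter> s ` C) < \<infinity>"
      using emeasure_compact_finite[OF cs[OF C]] by (rule le_less_trans)
    then obtain D where D: "\<And>n::nat. compact (D n)" "\<And>n. D n \<subseteq> E \<inter> s ` C" "E \<inter> s ` C - (\<Union>n. D n) \<in> null_sets \<mu>"
      using sigma_compact_approx[OF E'] by metis
    have "t ` (E \<inter> s ` C - (\<Union>n. D n)) \<in> sets \<mu>"
      by (rule null_setsD2, rule null[OF D(3) _ cs[OF C]]) auto
    moreover have "(\<Union>n. t ` D n) \<in> sets \<mu>"
      by (intro sets.countable_UN'') (auto intro: sets_compact ct D)
    moreover have "t ` E \<inter> C = t ` (E \<inter> s ` C - (\<Union>n. D n)) \<union> (\<Union>n. t ` D n)"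
    proof -
      have "t ` E \<inter> C = t ` (E \<inter> s ` C)"
      proof (intro set_eqI iffI)
        show "x \<in> t ` (E \<inter> s ` C)" if "x \<in> t ` E \<inter> C" for x
          using that by (auto simp: img)
        show "x \<in> t ` E \<inter> C" if "x \<in> t ` (E \<inter> s ` C)" for x
          using that by (auto simp: ts)
      qed
      also have "E \<inter> s ` C = (E \<inter> s ` C - (\<Union>n. D n)) \<union> (\<Union>n. D n)"
        using D(2) by blast
      finally show ?thesis by (simp only: image_Un image_UN)
    qed
    ultimately show "t ` E \<inter> C \<in> sets \<mu>"
      by (metis sets.Un)
  qed
  have invc: "emeasure \<mu> (t ` C) = emeasure \<mu> C" if "compact C" for C
    using that by (intro inv borel_closed compact_imp_closed)
  have em: "emeasure \<mu> (t ` E) = emeasure \<mu> E" if E: "E \<in> sets \<mu>" for E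
  proof (rule antisym)
    show "emeasure \<mu> (t ` E) \<le> emeasure \<mu> E"
    proof (rule emeasure_le_of_compact[OF meas[OF E]])
      fix C assume C: "compact C" "C \<subseteq> t ` E"
      have "t ` s ` C = C" by (simp add: image_image ts)
      then have "emeasure \<mu> C = emeasure \<mu> (s ` C)"
        using invc[OF cs[OF C(1)]] by simp
      also have "\<dots> \<le> emeasure \<mu> E"
        using C(2) st by (intro emeasure_mono E) auto
      finally show "emeasure \<mu> C \<le> emeasure \<mu> E" .
    qed
    show "emeasure \<mu> E \<le> emeasure \<mu> (t ` E)"
    proof (rule emeasure_le_of_compact[OF E])
      fix C assume C: "compact C" "C \<subseteq> E"
      then show "emeasure \<mu> C \<le> emeasure \<mu> (t ` E)"
        unfolding invc[OF C(1), symmetric] by (intro emeasure_mono meas E) auto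
    qed
  qed
  show s': "s \<in> measurable \<mu> \<mu>"
    using meas by (intro measurableI) (auto simp: space_UNIV img)
  show "distr \<mu> \<mu> s = \<mu>"
    using em s' by (intro measure_eqI) (auto simp: emeasure_distr space_UNIV img)
qed

lemma left_haar_radon: "left_haar_measure law \<mu> \<Longrightarrow> radon_measure \<mu>"
  by (simp add: left_haar_measure_def)

text \<open>If C is compact of positive measure, then translates of C by elements near 0 meet C, as they
  fit into an open set of measure less than twice that of C. So C - C is a
  compact neighbourhood of 0.\<close>

lemma locally_compact_of_haar:
  fixes \<mu> :: "'a::{topological_group_add, t2_space} measure"
  assumes haar: "left_haar_measure (+) \<mu>"
  shows "locally_compact_space (euclidean :: 'a topology)"
proof -
  interpret radon_prelim \<mu>
    using haar by unfold_locales (rule left_haar_radon)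
  have "emeasure \<mu> UNIV \<noteq> 0"
    using haar by (simp add: left_haar_measure_def)
  then obtain C :: "'a set" where C: "compact C" "emeasure \<mu> C \<noteq> 0"
    using emeasure_le_of_compact[of UNIV 0] sets_open[of UNIV] by (metis le_zero_eq open_UNIV)
  define m where "m = measure \<mu> C"
  have m: "emeasure \<mu> C = ennreal m" "0 < m"
    using C emeasure_compact_finite[OF C(1)]
    by (auto simp: m_def emeasure_eq_ennreal_measure less_top zero_less_measure_iff)
  obtain V where V: "open V" "C \<subseteq> V" "emeasure \<mu> V < \<infinity>"
    by (rule compact_open_finite[OF C(1)])
  have "emeasure \<mu> (V - C) \<le> emeasure \<mu> V"
    by (intro emeasure_mono sets_open V) auto
  then have fin: "emeasure \<mu> (V - C) < \<infinity>"
    using V(3) by (rule le_less_trans)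
  have VC: "V - C \<in> sets \<mu>"
    using V(1) C(1) by (intro sets_open open_Diff compact_imp_closed)
  obtain D where D: "compact D" "D \<subseteq> V - C" "emeasure \<mu> (V - C - D) \<le> ennreal (m/2)"
    by (rule inner_approx[OF VC fin, of "m/2"]) (use m(2) in simp)
  define U where "U = V - D"
  have U: "open U" "C \<subseteq> U"
    using V C D by (auto simp: U_def intro!: open_Diff compact_imp_closed)
  have "U - C = V - C - D" by (auto simp: U_def)
  then have Usmall: "emeasure \<mu> (U - C) \<le> ennreal (m/2)"
    using D(3) by simp
  have "open ((\<lambda>p::'a \<times> 'a. fst p + snd p) -` U)"
    using U(1) by (intro open_vimage continuous_intros)
  moreover have "{0} \<times> C \<subseteq> (\<lambda>p::'a \<times> 'a. fst p + snd p) -` U"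
    using U(2) by auto
  ultimately obtain W where W: "0 \<in> W" "open W" "W \<times> C \<subseteq> (\<lambda>p::'a \<times> 'a. fst p + snd p) -` U"
    using Elementary_Topology.tube_lemma[OF C(1), of "(\<lambda>p::'a \<times> 'a. fst p + snd p) -` U" 0] by blast
  define K where "K = (\<lambda>p. fst p - snd p) ` (C \<times> C)"
  have K: "compact K"
    unfolding K_def using C(1) by (intro compact_continuous_image compact_Times continuous_intros)
  have "W \<subseteq> K"
  proof
    fix w assume w: "w \<in> W"
    have "(+) w ` C \<inter> C \<noteq> {}"
    proof
      assume disj: "(+) w ` C \<inter> C = {}"
      have "emeasure \<mu> ((+) w ` C) = emeasure \<mu> C"
        using haar C(1) by (auto simp: left_haar_measure_def intro: borel_closed compact_imp_closed)
      moreover have "emeasure \<mu> ((+) w ` C) \<le> emeasure \<mu> (U - C)"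
        using W(3) w disj U(1) C(1)
        by (intro emeasure_mono sets_open open_Diff compact_imp_closed) auto
      ultimately have "ennreal m \<le> ennreal (m/2)"
        using Usmall m(1) by simp
      then show False using m(2) by simp
    qed
    then obtain c d where "c \<in> C" "d \<in> C" "w + c = d" by auto
    then have "w = d - c" by (metis add_diff_cancel)
    then show "w \<in> K" unfolding K_def using \<open>c \<in> C\<close> \<open>d \<in> C\<close> by force
  qed
  show ?thesis
    unfolding locally_compact_space_def
  proof (intro ballI)
    fix x :: 'a
    have "open ((\<lambda>y. - x + y) -` W)"
      using W(2) by (intro open_vimage continuous_intros)
    moreover have "compact ((+) x ` K)"
      using K by (intro compact_continuous_image continuous_intros)
    moreover have "x \<in> (\<lambda>y. - x + y) -` W"
      using W(1) by simp
    moreover have "(\<lambda>y. - x + y) -` W \<subseteq> (+) x ` K"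
    proof
      fix y assume "y \<in> (\<lambda>y. - x + y) -` W"
      then have "- x + y \<in> K" using \<open>W \<subseteq> K\<close> by auto
      then show "y \<in> (+) x ` K" by (intro image_eqI[of _ _ "- x + y"]) (simp_all add: add.assoc[symmetric])
    qed
    ultimately show "\<exists>U K. openin euclidean U \<and> compactin euclidean K \<and> x \<in> U \<and> U \<subseteq> K"
      unfolding open_openin[symmetric] compactin_euclidean_iff by blast
  qed
qed

locale abelian_haar =
  fixes \<mu> :: "'k::{topological_ab_group_add, t2_space} measure"
  assumes haar: "left_haar_measure (+) \<mu>"
begin

sublocale radon \<mu>
  using haar by unfold_locales (auto intro: left_haar_radon locally_compact_of_haar)

lemma translation: "(\<lambda>y. y - k) \<in> measurable \<mu> \<mu>" "distr \<mu> \<mu> (\<lambda>y. y - k) = \<mu>"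
proof -
  have inv: "emeasure \<mu> ((+) k ` E) = emeasure \<mu> E" if "E \<in> sets borel" for E
    using haar that by (simp add: left_haar_measure_def)
  show "(\<lambda>y. y - k) \<in> measurable \<mu> \<mu>" "distr \<mu> \<mu> (\<lambda>y. y - k) = \<mu>"
    by (rule homeomorphism_preserves[of "(+) k", OF _ _ _ _ inv]; simp add: continuous_intros)+
qed

lemma integral_translation:
  fixes f :: "'k \<Rightarrow> 'b::{banach, second_countable_topology}"
  assumes "f \<in> borel_measurable \<mu>"
  shows "(LINT y|\<mu>. f (y - k)) = (LINT y|\<mu>. f y)"
  using integral_distr[OF translation(1)[of k] assms] translation(2)[of k] by simp

lemma L2_translation:
  assumes "f \<in> L2 \<mu>"
  shows "(\<lambda>y. f (y - k)) \<in> L2 \<mu>" "L2_norm \<mu> (\<lambda>y. f (y - k)) = L2_norm \<mu> f"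
proof -
  note [measurable] = L2_measurable[OF assms] translation(1)[of k]
  have m: "(\<lambda>y. f (y - k)) \<in> borel_measurable \<mu>"
    by (rule measurable_compose[OF translation(1) L2_measurable[OF assms]])
  have "integrable \<mu> (\<lambda>y. (cmod (f (y - k)))\<^sup>2)"
    using integrable_distr[OF translation(1)[of k], of "\<lambda>y. (cmod (f y))\<^sup>2"] translation(2)[of k] L2_integrable[OF assms]
    by simp
  with m show "(\<lambda>y. f (y - k)) \<in> L2 \<mu>"
    by (simp add: L2_def)
  show "L2_norm \<mu> (\<lambda>y. f (y - k)) = L2_norm \<mu> f"
    unfolding L2_norm_def by (subst integral_translation) auto
qed

lemma AE_translation:
  assumes "AE y in \<mu>. P y"
  shows "AE y in \<mu>. P (y - k)"
  by (rule AE_distrD[OF translation(1)[of k], of P, unfolded translation(2), OF assms])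

lemma Cc_integral_pos:
  obtains \<phi> :: "'k \<Rightarrow> real" where "\<phi> \<in> Cc" "\<And>x. 0 \<le> \<phi> x" "(LINT x|\<mu>. \<phi> x) > 0" "\<And>x. \<phi> x \<le> 1"
proof -
  have "emeasure \<mu> UNIV \<noteq> 0"
    using haar by (simp add: left_haar_measure_def)
  then obtain C :: "'k set" where C: "compact C" "emeasure \<mu> C \<noteq> 0"
    using emeasure_le_of_compact[of UNIV 0] sets_open[of UNIV] by (metis le_zero_eq open_UNIV)
  obtain \<phi> :: "'k \<Rightarrow> real" where \<phi>: "\<phi> \<in> Cc" "\<And>x. 0 \<le> \<phi> x" "\<And>x. \<phi> x \<le> 1" "\<And>x. x \<in> C \<Longrightarrow> \<phi> x = 1"
    using Urysohn_Cc[OF locally_compact C(1) open_UNIV] by (metis subset_UNIV)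
  have "0 < measure \<mu> C"
    using C emeasure_compact_finite[OF C(1)] by (simp add: zero_less_measure_iff emeasure_eq_ennreal_measure less_top)
  also have "measure \<mu> C = (LINT x|\<mu>. indicator C x)"
    by (simp add: space_UNIV)
  also have "\<dots> \<le> (LINT x|\<mu>. \<phi> x)"
  proof (rule integral_mono[OF _ Cc_integrable[OF \<phi>(1)]])
    show "integrable \<mu> (indicator C :: 'k \<Rightarrow> real)"
      using emeasure_compact_finite[OF C(1)] sets_compact[OF C(1)] by simp
    show "indicator C x \<le> \<phi> x" for x
      using \<phi> by (simp split: split_indicator)
  qed
  finally show ?thesis using that \<phi> by blast
qed

text \<open>Multiplied by the integral of an auxiliary function \<phi>, both sides are, up to
  translations, the iterated integrals of \<phi>(x) \<psi>(x - y) in the two orders.\<close>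

lemma Cc_integral_inversion:
  fixes \<psi> :: "'k \<Rightarrow> real"
  assumes \<psi>: "\<psi> \<in> Cc"
  shows "(LINT y|\<mu>. \<psi> (- y)) = (LINT y|\<mu>. \<psi> y)"
proof -
  interpret KK: radon_pair \<mu> \<mu> ..
  obtain \<phi> :: "'k \<Rightarrow> real" where \<phi>: "\<phi> \<in> Cc" "(LINT x|\<mu>. \<phi> x) > 0"
    using Cc_integral_pos by metis
  obtain P where P: "compact P" "\<And>x. x \<notin> P \<Longrightarrow> \<phi> x = 0" by (metis Cc_support \<phi>(1))
  obtain Q where Q: "compact Q" "\<And>x. x \<notin> Q \<Longrightarrow> \<psi> x = 0" by (metis Cc_support \<psi>)
  define R where "R = (\<lambda>p. fst p - snd p) ` (P \<times> Q)"
  have R: "compact R"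
    unfolding R_def using P Q by (intro compact_continuous_image compact_Times continuous_intros)
  have c\<psi>: "continuous_on S (\<lambda>p. \<psi> (g p))" if "continuous_on S g" for S and g :: "'k \<times> 'k \<Rightarrow> 'k"
    using that by (rule continuous_on_compose2[OF Cc_continuous[OF \<psi>]]) auto
  have c\<phi>: "continuous_on S (\<lambda>p. \<phi> (g p))" if "continuous_on S g" for S and g :: "'k \<times> 'k \<Rightarrow> 'k"
    using that by (rule continuous_on_compose2[OF Cc_continuous[OF \<phi>(1)]]) auto
  have 1: "(\<lambda>(x, y). \<phi> x * \<psi> (x - y)) \<in> Cc"
  proof (rule CcI)
    show "continuous_on UNIV (\<lambda>(x, y). \<phi> x * \<psi> (x - y))"
      unfolding case_prod_beta by (intro continuous_intros c\<psi> c\<phi>)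
    show "compact (P \<times> R)" using P R by (intro compact_Times)
    fix p :: "'k \<times> 'k" assume p: "p \<notin> P \<times> R"
    show "(case p of (x, y) \<Rightarrow> \<phi> x * \<psi> (x - y)) = 0"
    proof (rule ccontr)
      assume "\<not> ?thesis"
      then have "fst p \<in> P" "fst p - snd p \<in> Q" using P(2) Q(2) by (auto simp: case_prod_beta)
      then have "snd p \<in> R" unfolding R_def by (intro image_eqI[of _ _ "(fst p, fst p - snd p)"]) auto
      with p \<open>fst p \<in> P\<close> show False by (simp add: mem_Times_iff)
    qed
  qed
  have 2: "(\<lambda>(x, y). \<phi> (x + y) * \<psi> x) \<in> Cc"
  proof (rule CcI)
    show "continuous_on UNIV (\<lambda>(x, y). \<phi> (x + y) * \<psi> x)"
      unfolding case_prod_beta by (intro continuous_intros c\<psi> c\<phi>)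
    show "compact (Q \<times> R)" using Q R by (intro compact_Times)
    fix p :: "'k \<times> 'k" assume p: "p \<notin> Q \<times> R"
    show "(case p of (x, y) \<Rightarrow> \<phi> (x + y) * \<psi> x) = 0"
    proof (rule ccontr)
      assume "\<not> ?thesis"
      then have "fst p \<in> Q" "fst p + snd p \<in> P" using P(2) Q(2) by (auto simp: case_prod_beta)
      then have "snd p \<in> R" unfolding R_def by (intro image_eqI[of _ _ "(fst p + snd p, fst p)"]) auto
      with p \<open>fst p \<in> Q\<close> show False by (simp add: mem_Times_iff)
    qed
  qed
  have m\<psi>: "(\<lambda>y. \<psi> (x - y)) \<in> borel_measurable \<mu>" "(\<lambda>y. \<psi> (- y)) \<in> borel_measurable \<mu>" for x
    by (intro measurable_continuous continuous_on_compose2[OF Cc_continuous[OF \<psi>]] continuous_intros; simp)+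
  have m\<phi>: "(\<lambda>x. \<phi> (x + y)) \<in> borel_measurable \<mu>" for y
    by (intro measurable_continuous continuous_on_compose2[OF Cc_continuous[OF \<phi>(1)]] continuous_intros) simp
  have "(LINT x|\<mu>. \<phi> x) * (LINT y|\<mu>. \<psi> (- y)) = (LINT x|\<mu>. LINT y|\<mu>. \<phi> x * \<psi> (x - y))"
  proof -
    have "(LINT y|\<mu>. \<psi> (x - y)) = (LINT y|\<mu>. \<psi> (- y))" for x
      using integral_translation[OF m\<psi>(2), of x] by simp
    then show ?thesis by simp
  qed
  also have "\<dots> = (LINT y|\<mu>. LINT x|\<mu>. \<phi> x * \<psi> (x - y))"
    using KK.Cc_Fubini[OF 1] by simp
  also have "\<dots> = (LINT y|\<mu>. LINT x|\<mu>. \<phi> (x + y) * \<psi> x)"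
  proof -
    have "(LINT x|\<mu>. \<phi> x * \<psi> (x - y)) = (LINT x|\<mu>. \<phi> (x + y) * \<psi> x)" for y
      using integral_translation[of "\<lambda>x. \<phi> (x + y) * \<psi> x" y] m\<phi>[of y] Cc_measurable[OF \<psi>] by simp
    then show ?thesis by simp
  qed
  also have "\<dots> = (LINT x|\<mu>. LINT y|\<mu>. \<phi> (x + y) * \<psi> x)"
    using KK.Cc_Fubini[OF 2] by simp
  also have "\<dots> = (LINT x|\<mu>. \<phi> x) * (LINT x|\<mu>. \<psi> x)"
  proof -
    have "(LINT y|\<mu>. \<phi> (x + y)) = (LINT y|\<mu>. \<phi> y)" for x
      using integral_translation[OF Cc_measurable[OF \<phi>(1)], of "- x"] by (simp add: add.commute)
    then show ?thesis by simp
  qed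
  finally show ?thesis using \<phi>(2) by simp
qed

end

section \<open>The dual group\<close>

lemma char_eval_continuous: "continuous_on UNIV (char_eval \<omega>)"
  and char_eval_norm [simp]: "cmod (char_eval \<omega> x) = 1"
  using char_eval[of \<omega>] by auto

lemma open_dual_subbasic: "compact C \<Longrightarrow> open U \<Longrightarrow> open {\<omega>. char_eval \<omega> ` C \<subseteq> U}"
  unfolding open_dual_def by (rule generate_topology.Basis) blast

instance dual :: (topological_ab_group_add) t2_space
proof
  fix a b :: "'a dual" assume "a \<noteq> b"
  then have "char_eval a \<noteq> char_eval b" by (simp add: char_eval_inject)
  then obtain x where "char_eval a x \<noteq> char_eval b x" by (auto simp: fun_eq_iff)
  then obtain U V where UV: "open U" "open V" "char_eval a x \<in> U" "char_eval b x \<in> V" "U \<inter> V = {}"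
    using hausdorff by metis
  have "open {\<omega>. char_eval \<omega> ` {x} \<subseteq> U}" "open {\<omega>. char_eval \<omega> ` {x} \<subseteq> V}"
    by (intro open_dual_subbasic UV compact_sing)+
  moreover have "{\<omega>. char_eval \<omega> ` {x} \<subseteq> U} \<inter> {\<omega>. char_eval \<omega> ` {x} \<subseteq> V} = {}"
    using UV(5) by auto
  ultimately show "\<exists>U V. open U \<and> open V \<and> a \<in> U \<and> b \<in> V \<and> U \<inter> V = {}"
    using UV(3,4)
    by (intro exI[of _ "{\<omega>. char_eval \<omega> ` {x} \<subseteq> U}"] exI[of _ "{\<omega>. char_eval \<omega> ` {x} \<subseteq> V}"]) simp
qed

text \<open>Covering a compact set by finitely many compact pieces on which the limit character is
  nearly constant turns uniform closeness into finitely many subbasic conditions.\<close>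

lemma eventually_uniformly_close_dual:
  fixes \<omega>0 :: "'k::topological_ab_group_add dual"
  assumes C: "compact C" and e: "0 < e"
  shows "\<forall>\<^sub>F \<omega> in nhds \<omega>0. \<forall>y\<in>C. dist (char_eval \<omega> y) (char_eval \<omega>0 y) < e"
proof -
  let ?e = "char_eval \<omega>0"
  have cont: "continuous_on UNIV (\<lambda>y. dist (?e y) c)" for c
    by (intro continuous_intros char_eval_continuous)
  have op: "open {y. dist (?e y) (?e x) < e/3}" for x
    using open_vimage[OF open_lessThan[of "e/3"] cont[of "?e x"]] by (simp add: vimage_def)
  have cl: "closed {y. dist (?e y) (?e x) \<le> e/3}" for x
    using closed_vimage[OF closed_atMost[of "e/3"] cont[of "?e x"]] by (simp add: vimage_def)
  obtain F where F: "F \<subseteq> C" "finite F" "C \<subseteq> (\<Union>x\<in>F. {y. dist (?e y) (?e x) < e/3})"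
    by (rule compactE_image[OF C, of C "\<lambda>x. {y. dist (?e y) (?e x) < e/3}"]) (use op e in auto)
  define N where "N x = {\<omega>. char_eval \<omega> ` (C \<inter> {y. dist (?e y) (?e x) \<le> e/3}) \<subseteq> ball (?e x) (e/2)}" for x
  have N: "open (N x)" "\<omega>0 \<in> N x" for x
  proof -
    show "open (N x)"
      unfolding N_def by (intro open_dual_subbasic compact_Int_closed C cl open_ball)
    show "\<omega>0 \<in> N x"
      unfolding N_def using e by (auto simp: dist_commute)
  qed
  have "\<forall>\<^sub>F \<omega> in nhds \<omega>0. \<forall>x\<in>F. \<omega> \<in> N x"
    using F(2) N by (intro eventually_ball_finite) (auto intro: eventually_nhds_in_open)
  then show ?thesis
  proof eventually_elim
    case (elim \<omega>)
    show ?case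
    proof
      fix y assume y: "y \<in> C"
      then obtain x where x: "x \<in> F" "dist (?e y) (?e x) < e/3" using F(3) by auto
      have "y \<in> C \<inter> {y. dist (?e y) (?e x) \<le> e/3}"
        using x(2) y by simp
      moreover have "char_eval \<omega> ` (C \<inter> {y. dist (?e y) (?e x) \<le> e/3}) \<subseteq> ball (?e x) (e/2)"
        using elim x(1) unfolding N_def by blast
      ultimately have "char_eval \<omega> y \<in> ball (?e x) (e/2)"
        by blast
      then show "dist (char_eval \<omega> y) (?e y) < e"
        using x(2) dist_triangle2[of "char_eval \<omega> y" "?e y" "?e x"] e by (auto simp: dist_commute)
    qed
  qed
qed

text \<open>The compact-open topology is that of uniform convergence on compact sets: the image of a compact set
  under a character is compact, hence has positive distance from the complement of any open set
  containing it.\<close>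

lemma tendsto_dual_iff:
  fixes f :: "'x \<Rightarrow> 'k::topological_ab_group_add dual"
  shows "(f \<longlongrightarrow> \<omega>0) F \<longleftrightarrow>
    (\<forall>C e. compact C \<longrightarrow> 0 < e \<longrightarrow> (\<forall>\<^sub>F x in F. \<forall>y\<in>C. dist (char_eval (f x) y) (char_eval \<omega>0 y) < e))"
    (is "_ \<longleftrightarrow> ?R")
proof
  assume "(f \<longlongrightarrow> \<omega>0) F"
  then show ?R
    using eventually_uniformly_close_dual[of _ _ \<omega>0] by (auto simp: filterlim_iff)
next
  assume R: ?R
  have "\<forall>\<^sub>F x in F. f x \<in> S" if "generate_topology {{\<omega>. char_eval \<omega> ` C \<subseteq> U} | C U. compact C \<and> open U} S" "\<omega>0 \<in> S" for S
    using that
  proof (induction rule: generate_topology.induct)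
    case UNIV
    then show ?case by simp
  next
    case (Int a b)
    then show ?case by (auto intro: eventually_conj)
  next
    case (UN K)
    then obtain k where "k \<in> K" "\<omega>0 \<in> k" by auto
    then have "\<forall>\<^sub>F x in F. f x \<in> k" using UN by auto
    then show ?case using \<open>k \<in> K\<close> by (auto elim: eventually_mono)
  next
    case (Basis s)
    then obtain C U where CU: "s = {\<omega>. char_eval \<omega> ` C \<subseteq> U}" "compact C" "open U" by auto
    have "compact (char_eval \<omega>0 ` C)"
      using CU(2) by (intro compact_continuous_image continuous_on_subset[OF char_eval_continuous]) auto
    moreover have "char_eval \<omega>0 ` C \<subseteq> U" using Basis CU(1) by auto
    ultimately obtain e where e: "0 < e" "(\<Union>z\<in>char_eval \<omega>0 ` C. ball z e) \<subseteq> U"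
      using compact_subset_open_imp_ball_epsilon_subset[OF _ CU(3)] by metis
    have "\<forall>\<^sub>F x in F. \<forall>y\<in>C. dist (char_eval (f x) y) (char_eval \<omega>0 y) < e"
      using R CU(2) e(1) by blast
    then show ?case
    proof eventually_elim
      case (elim x)
      show ?case unfolding CU(1)
      proof (intro CollectI subsetI)
        fix z assume "z \<in> char_eval (f x) ` C"
        then obtain y where "y \<in> C" "z = char_eval (f x) y" by auto
        then have "z \<in> ball (char_eval \<omega>0 y) e" using elim by (simp add: dist_commute)
        then show "z \<in> U" using e(2) \<open>y \<in> C\<close> by blast
      qed
    qed
  qed
  then show "(f \<longlongrightarrow> \<omega>0) F"
    by (intro topological_tendstoI) (simp add: open_dual_def)
qed

lemma char_eval_add: "char_eval (\<omega> + \<omega>') x = char_eval \<omega> x * char_eval \<omega>' x"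
  by (simp add: plus_dual.rep_eq)

lemma char_eval_minus: "char_eval (- \<omega>) x = cnj (char_eval \<omega> x)"
  by (simp add: uminus_dual.rep_eq)

instance dual :: (topological_ab_group_add) topological_ab_group_add
proof
  fix a b :: "'a dual"
  show "((\<lambda>x. fst x + snd x) \<longlongrightarrow> a + b) (nhds a \<times>\<^sub>F nhds b)"
    unfolding tendsto_dual_iff
  proof (intro allI impI)
    fix C :: "'a set" and e :: real assume C: "compact C" and "0 < e"
    then have e: "0 < e/2" by simp
    have "\<forall>\<^sub>F p in nhds a \<times>\<^sub>F nhds b. (\<forall>y\<in>C. dist (char_eval (fst p) y) (char_eval a y) < e/2) \<and>
        (\<forall>y\<in>C. dist (char_eval (snd p) y) (char_eval b y) < e/2)"
      using eventually_prodI[OF eventually_uniformly_close_dual[OF C e, of a] eventually_uniformly_close_dual[OF C e, of b]]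
      by (simp add: case_prod_beta)
    then show "\<forall>\<^sub>F p in nhds a \<times>\<^sub>F nhds b. \<forall>y\<in>C. dist (char_eval (fst p + snd p) y) (char_eval (a + b) y) < e"
    proof eventually_elim
      case (elim p)
      show ?case
      proof
        fix y assume y: "y \<in> C"
        let ?p = "char_eval (fst p) y" and ?q = "char_eval (snd p) y" and ?a = "char_eval a y" and ?b = "char_eval b y"
        have "dist (?p * ?q) (?a * ?b) = cmod ((?p - ?a) * ?q + ?a * (?q - ?b))"
          by (simp add: dist_norm algebra_simps)
        also have "\<dots> \<le> cmod (?p - ?a) + cmod (?q - ?b)"
          by (rule order_trans[OF norm_triangle_ineq]) (simp add: norm_mult)
        also have "\<dots> < e"
          using elim y by (force simp: dist_norm)
        finally show "dist (char_eval (fst p + snd p) y) (char_eval (a + b) y) < e"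
          by (simp add: char_eval_add)
      qed
    qed
  qed
  show "(uminus \<longlongrightarrow> - a) (nhds a)"
    unfolding tendsto_dual_iff
    using eventually_uniformly_close_dual[of _ _ a]
    by (simp add: char_eval_minus dist_norm flip: complex_cnj_diff)
qed

text \<open>Local compactness provides a compact neighbourhood D of a point that the character maps into U;
  characters near it in the compact-open topology still map D into U.\<close>

lemma char_eval_jointly_continuous:
  assumes lc: "locally_compact_space (euclidean :: 'k::{topological_ab_group_add, t2_space} topology)"
  shows "continuous_on UNIV (\<lambda>(\<omega>, y :: 'k). char_eval \<omega> y)"
  unfolding continuous_on_open_vimage[OF open_UNIV] Int_UNIV_right
proof (intro allI impI)
  fix U :: "complex set" assume U: "open U"
  show "open ((\<lambda>(\<omega>, y :: 'k). char_eval \<omega> y) -` U)"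
    unfolding open_prod_def
  proof (intro ballI)
    fix p :: "'k dual \<times> 'k" assume p: "p \<in> (\<lambda>(\<omega>, y). char_eval \<omega> y) -` U"
    define V where "V = char_eval (fst p) -` U"
    have V: "open V" "{snd p} \<subseteq> V"
      using p U open_vimage[OF U char_eval_continuous] by (auto simp: V_def case_prod_beta)
    obtain \<phi> :: "'k \<Rightarrow> real" where \<phi>: "\<phi> \<in> Cc" "\<phi> (snd p) = 1" "\<And>x. x \<notin> V \<Longrightarrow> \<phi> x = 0"
      using Urysohn_Cc[OF lc compact_sing V] by (metis insertI1)
    obtain K where K: "compact K" "\<And>x. x \<notin> K \<Longrightarrow> \<phi> x = 0" by (metis Cc_support \<phi>(1))
    define D where "D = \<phi> -` {1/2..}"
    have "closed D" unfolding D_def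
      by (intro closed_vimage closed_atLeast Cc_continuous \<phi>(1))
    moreover have "D \<subseteq> K" using K(2) by (force simp: D_def)
    ultimately have D: "compact D"
      using compact_Int_closed[OF K(1), of D] by (simp add: Int_absorb1)
    have DV: "D \<subseteq> V" using \<phi>(3) by (force simp: D_def)
    show "\<exists>A B. open A \<and> open B \<and> p \<in> A \<times> B \<and> A \<times> B \<subseteq> (\<lambda>(\<omega>, y). char_eval \<omega> y) -` U"
    proof (intro exI conjI)
      show "open {\<omega>. char_eval \<omega> ` D \<subseteq> U}" by (rule open_dual_subbasic[OF D U])
      show "open (\<phi> -` {1/2<..})"
        by (intro open_vimage open_greaterThan Cc_continuous \<phi>(1))
      show "p \<in> {\<omega>. char_eval \<omega> ` D \<subseteq> U} \<times> (\<phi> -` {1/2<..})"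
        using DV \<phi>(2) by (auto simp: V_def mem_Times_iff)
      show "{\<omega>. char_eval \<omega> ` D \<subseteq> U} \<times> (\<phi> -` {1/2<..}) \<subseteq> (\<lambda>(\<omega>, y). char_eval \<omega> y) -` U"
      proof (rule subsetI)
        fix q assume "q \<in> {\<omega>. char_eval \<omega> ` D \<subseteq> U} \<times> (\<phi> -` {1/2<..})"
        then have "char_eval (fst q) ` D \<subseteq> U" "snd q \<in> D"
          by (auto simp: D_def mem_Times_iff)
        then show "q \<in> (\<lambda>(\<omega>, y). char_eval \<omega> y) -` U"
          by (auto simp: case_prod_beta)
      qed
    qed
  qed
qed

section \<open>Haar measures on the two semi-direct products\<close>

definition Cc_unit :: "'a::topological_space set \<Rightarrow> ('a \<Rightarrow> real) set"
  where "Cc_unit U = {\<phi>. \<phi> \<in> Cc \<and> (\<forall>x. 0 \<le> \<phi> x \<and> \<phi> x \<le> indicator U x)}"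

lemma Cc_unit_D:
  assumes "\<phi> \<in> Cc_unit U"
  shows "\<phi> \<in> Cc" "0 \<le> \<phi> x" "\<phi> x \<le> indicator U x" "\<phi> x \<le> 1"
proof -
  show "\<phi> \<in> Cc" "0 \<le> \<phi> x" "\<phi> x \<le> indicator U x"
    using assms by (auto simp: Cc_unit_def)
  then show "\<phi> x \<le> 1"
    by (auto split: split_indicator_asm)
qed

lemma Cc_unit_Urysohn:
  fixes C :: "'a::t2_space set"
  assumes lc: "locally_compact_space (euclidean :: 'a topology)" and C: "compact C" and U: "open U" "C \<subseteq> U"
  obtains \<phi> where "\<phi> \<in> Cc_unit U" "\<And>x. x \<in> C \<Longrightarrow> \<phi> x = 1"
proof -
  obtain \<phi> :: "'a \<Rightarrow> real" where \<phi>: "\<phi> \<in> Cc" "\<And>x. 0 \<le> \<phi> x" "\<And>x. \<phi> x \<le> 1" "\<And>x. x \<in> C \<Longrightarrow> \<phi> x = 1"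
    "\<And>x. x \<notin> U \<Longrightarrow> \<phi> x = 0"
    using Urysohn_Cc[OF assms] by metis
  have "\<phi> x \<le> indicator U x" for x
    using \<phi>(3,5)[of x] by (simp split: split_indicator)
  then show ?thesis
    using \<phi> by (intro that[of \<phi>]) (auto simp: Cc_unit_def)
qed

lemma Cc_unit_directed:
  assumes "finite F" "F \<subseteq> Cc_unit U"
  shows "\<exists>\<phi>\<in>Cc_unit U. \<forall>\<psi>\<in>F. \<forall>x. \<psi> x \<le> \<phi> x"
  using assms
proof (induction F rule: finite_induct)
  case empty
  have "(\<lambda>x. 0) \<in> Cc_unit U" by (simp add: Cc_unit_def Cc_zero)
  then show ?case by blast
next
  case (insert \<psi> F)
  then obtain \<phi> where \<phi>: "\<phi> \<in> Cc_unit U" "\<forall>\<psi>\<in>F. \<forall>x. \<psi> x \<le> \<phi> x" by auto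
  have \<psi>: "\<psi> \<in> Cc_unit U" using insert by simp
  obtain C where C: "compact C" "\<And>x. x \<notin> C \<Longrightarrow> \<phi> x = 0"
    by (metis Cc_support Cc_unit_D(1)[OF \<phi>(1)])
  obtain D where D: "compact D" "\<And>x. x \<notin> D \<Longrightarrow> \<psi> x = 0"
    by (metis Cc_support Cc_unit_D(1)[OF \<psi>])
  have "(\<lambda>x. max (\<phi> x) (\<psi> x)) \<in> Cc"
  proof (rule CcI)
    show "continuous_on UNIV (\<lambda>x. max (\<phi> x) (\<psi> x))"
      by (intro continuous_on_max Cc_continuous Cc_unit_D(1)[OF \<phi>(1)] Cc_unit_D(1)[OF \<psi>])
    show "compact (C \<union> D)" using C D by (intro compact_Un)
    show "max (\<phi> x) (\<psi> x) = 0" if "x \<notin> C \<union> D" for x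
      using that C(2)[of x] D(2)[of x] by simp
  qed
  then have "(\<lambda>x. max (\<phi> x) (\<psi> x)) \<in> Cc_unit U"
    using Cc_unit_D(2,3)[OF \<phi>(1)] Cc_unit_D(2,3)[OF \<psi>] by (simp add: Cc_unit_def le_max_iff_disj)
  moreover have "\<forall>\<psi>'\<in>insert \<psi> F. \<forall>x. \<psi>' x \<le> max (\<phi> x) (\<psi> x)"
    using \<phi>(2) by (auto simp: le_max_iff_disj)
  ultimately show ?case by (intro bexI[of _ "\<lambda>x. max (\<phi> x) (\<psi> x)"])
qed

lemma locally_compact_Times:
  assumes "locally_compact_space (euclidean :: 'a::topological_space topology)"
    and "locally_compact_space (euclidean :: 'b::topological_space topology)"
  shows "locally_compact_space (euclidean :: ('a \<times> 'b) topology)"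
  using assms locally_compact_space_prod_topology[of "euclidean :: 'a topology" "euclidean :: 'b topology"]
  by simp

lemma (in radon) integral_Cc_unit_le:
  assumes \<phi>: "\<phi> \<in> Cc_unit U" and U: "U \<in> sets \<mu>" "emeasure \<mu> U \<le> ennreal b" "0 \<le> b"
  shows "(LINT x|\<mu>. \<phi> x) \<le> b"
proof -
  have "ennreal (LINT x|\<mu>. \<phi> x) = (\<integral>\<^sup>+x. ennreal (\<phi> x) \<partial>\<mu>)"
    using Cc_unit_D[OF \<phi>] by (intro nn_integral_eq_integral[symmetric] Cc_integrable) auto
  also have "\<dots> \<le> (\<integral>\<^sup>+x. indicator U x \<partial>\<mu>)"
  proof (rule nn_integral_mono)
    show "ennreal (\<phi> x) \<le> indicator U x" for x
      using Cc_unit_D(3)[OF \<phi>, of x] by (cases "x \<in> U") (auto simp: ennreal_neg)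
  qed
  also have "\<dots> \<le> ennreal b" using U by simp
  finally show ?thesis using U(3) by (simp add: ennreal_le_iff)
qed

lemma (in radon) emeasure_le_integral_Cc:
  assumes \<phi>: "\<phi> \<in> Cc" "\<And>x. 0 \<le> \<phi> x" "\<And>x. x \<in> C \<Longrightarrow> 1 \<le> \<phi> x" and C: "C \<in> sets \<mu>"
  shows "emeasure \<mu> C \<le> ennreal (LINT x|\<mu>. \<phi> x)"
proof -
  have "emeasure \<mu> C = (\<integral>\<^sup>+x. indicator C x \<partial>\<mu>)" using C by simp
  also have "\<dots> \<le> (\<integral>\<^sup>+x. ennreal (\<phi> x) \<partial>\<mu>)"
    using \<phi>(3) by (intro nn_integral_mono) (simp split: split_indicator)
  also have "\<dots> = ennreal (LINT x|\<mu>. \<phi> x)"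
    using \<phi> by (intro nn_integral_eq_integral Cc_integrable) auto
  finally show ?thesis .
qed

lemma compact_fst: "compact C \<Longrightarrow> compact (fst ` C)" and compact_snd: "compact C \<Longrightarrow> compact (snd ` C)"
  by (auto intro!: compact_continuous_image continuous_intros)

locale gabor =
  fixes \<mu>H :: "'h::{topological_group_add, t2_space} measure"
    and \<mu>K :: "'k::{topological_ab_group_add, t2_space} measure"
    and \<nu> :: "'k dual measure"
    and \<tau> :: "'h \<Rightarrow> 'k \<Rightarrow> 'k"
    and \<delta> :: "'h \<Rightarrow> real"
    and \<mu>G :: "('h \<times> 'k) measure"
    and \<mu>GD :: "('h \<times> 'k \<times> 'k dual) measure"
  assumes haar_H: "left_haar_measure (+) \<mu>H"
    and haar_K: "left_haar_measure (+) \<mu>K"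
    and plancherel: "plancherel_measure \<mu>K \<nu>"
    and modulus: "is_modulus \<mu>K \<tau> \<delta>"
    and haar_G: "haar_semidirect \<mu>H \<mu>K \<tau> \<delta> \<mu>G"
    and haar_GD: "haar_semidirect_dual \<mu>H \<mu>K \<nu> \<tau> \<mu>GD"
begin

sublocale H: radon \<mu>H
  using haar_H by unfold_locales (auto intro: left_haar_radon locally_compact_of_haar)

sublocale K: abelian_haar \<mu>K
  using haar_K by unfold_locales

sublocale D: abelian_haar \<nu>
  using plancherel by unfold_locales (simp add: plancherel_measure_def)

sublocale G: radon \<mu>G
  using haar_G
  by unfold_locales (auto simp: haar_semidirect_def left_haar_measure_def
      intro: locally_compact_Times H.locally_compact K.locally_compact)

sublocale GD: radon \<mu>GD
  using haar_GD
  by unfold_locales (auto simp: haar_semidirect_dual_def left_haar_measure_def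
      intro!: locally_compact_Times H.locally_compact K.locally_compact D.locally_compact)

lemma \<delta>_pos: "0 < \<delta> h" and \<delta>_continuous: "continuous_on UNIV \<delta>"
  using modulus by (auto simp: is_modulus_def)

lemma integral_G: "\<phi> \<in> Cc \<Longrightarrow> (LINT p|\<mu>G. \<phi> p :: real) = (LINT h|\<mu>H. \<delta> h * (LINT k|\<mu>K. \<phi> (h, k)))"
  using haar_G Cc_imp_Cc_fun[of \<phi>] by (simp add: haar_semidirect_def radon_measure_of_def)

lemma integral_GD: "\<phi> \<in> Cc \<Longrightarrow> (LINT p|\<mu>GD. \<phi> p :: real) = (LINT h|\<mu>H. LINT k|\<mu>K. LINT \<omega>|\<nu>. \<phi> (h, k, \<omega>))"
  using haar_GD Cc_imp_Cc_fun[of \<phi>] by (simp add: haar_semidirect_dual_def radon_measure_of_def)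

text \<open>The part of Fubini's theorem for null sets that survives without sigma-finiteness: the
  sections are null inside any fixed compact set Q. A set of h with large sections of the open
  neighbourhoods U n would, by compactness, give one function below the indicator of U n
  with a large integral.\<close>

lemma AE_null_sections:
  assumes N: "N \<in> null_sets \<mu>G" and Q: "compact Q"
  shows "AE h in \<mu>H. {y\<in>Q. (h, y) \<in> N} \<in> null_sets \<mu>K"
proof (rule H.AE_local)
  fix P :: "'h set" assume P: "compact P"
  have PQ: "compact (P \<times> Q)" using P Q by (rule compact_Times)
  have N': "N \<inter> P \<times> Q \<in> null_sets \<mu>G"
    using N by (rule G.complete2[rotated]) auto
  have "\<exists>U. open U \<and> N \<inter> P \<times> Q \<subseteq> U \<and> emeasure \<mu>G U \<le> ennreal (1 / real (Suc n))" for n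
  proof -
    obtain U where U: "open U" "N \<inter> P \<times> Q \<subseteq> U" "emeasure \<mu>G (U - N \<inter> P \<times> Q) \<le> ennreal (1 / real (Suc n))"
      by (rule G.outer_approx[OF null_setsD2[OF N'] _ PQ, of "1 / real (Suc n)"]) auto
    then show ?thesis
      using emeasure_Diff_null_set[OF N' G.sets_open[OF U(1)]] by auto
  qed
  then obtain U where U: "\<And>n. open (U n)" "\<And>n. N \<inter> P \<times> Q \<subseteq> U n" "\<And>n. emeasure \<mu>G (U n) \<le> ennreal (1 / real (Suc n))"
    by metis
  define I where "I \<phi> h = (LINT y|\<mu>K. \<phi> (h, y))" for \<phi> :: "'h \<times> 'k \<Rightarrow> real" and h
  have I_open: "open {h. r < I \<phi> h}" if "\<phi> \<in> Cc" for \<phi> r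
    using open_vimage[OF open_greaterThan[of r] Cc_continuous[OF K.Cc_integrate_out[OF that]]]
    by (simp add: I_def vimage_def)
  have I_mono: "I \<phi> h \<le> I \<psi> h" if "\<phi> \<in> Cc" "\<psi> \<in> Cc" "\<And>p. \<phi> p \<le> \<psi> p" for \<phi> \<psi> h
    unfolding I_def by (intro integral_mono K.Cc_integrable K.Cc_section that)
  \<comment> \<open>A m n is open and contains every h at which the section of U n has measure above 1 / (m + 1).\<close>
  define A where "A m n = (\<Union>\<phi>\<in>Cc_unit (U n). {h. 1 / real (Suc m) < I \<phi> h})" for m n
  have A_open: "open (A m n)" for m n
    unfolding A_def by (intro open_UN ballI I_open Cc_unit_D(1))
  have null_B: "P \<inter> (\<Inter>n. A m n) \<in> null_sets \<mu>H" for m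
  proof -
    have B: "P \<inter> (\<Inter>n. A m n) \<in> sets \<mu>H"
    proof (rule sets.Int[OF H.sets_compact[OF P]])
      show "(\<Inter>n. A m n) \<in> sets \<mu>H"
        using H.sets_open[OF A_open] H.space_UNIV sets.top[of \<mu>H] by (intro sets.countable_INT'') auto
    qed
    have "emeasure \<mu>H (P \<inter> (\<Inter>n. A m n)) \<le> 0"
    proof (rule H.emeasure_le_of_compact[OF B])
      fix C assume C: "compact C" "C \<subseteq> P \<inter> (\<Inter>n. A m n)"
      show "emeasure \<mu>H C \<le> 0"
      proof (cases "C = {}")
        case False
        obtain h0 where h0: "\<And>h. h \<in> C \<Longrightarrow> \<delta> h0 \<le> \<delta> h"
          using continuous_attains_inf[OF C(1) False continuous_on_subset[OF \<delta>_continuous]] by auto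
        have mC: "emeasure \<mu>H C = ennreal (measure \<mu>H C)"
          using H.emeasure_compact_finite[OF C(1)] by (simp add: emeasure_eq_ennreal_measure less_top)
        have le: "\<delta> h0 * (1 / real (Suc m)) * measure \<mu>H C \<le> 1 / real (Suc n)" for n
        proof -
          have "C \<subseteq> (\<Union>\<phi>\<in>Cc_unit (U n). {h. 1 / real (Suc m) < I \<phi> h})"
            using C(2) by (auto simp: A_def)
          then obtain F where F: "F \<subseteq> Cc_unit (U n)" "finite F" "C \<subseteq> (\<Union>\<phi>\<in>F. {h. 1 / real (Suc m) < I \<phi> h})"
            using compactE_image[OF C(1), of "Cc_unit (U n)" "\<lambda>\<phi>. {h. 1 / real (Suc m) < I \<phi> h}"]
              I_open[OF Cc_unit_D(1)] by blast
          obtain \<phi> where \<phi>: "\<phi> \<in> Cc_unit (U n)" "\<And>\<psi> x. \<psi> \<in> F \<Longrightarrow> \<psi> x \<le> \<phi> x"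
            using Cc_unit_directed[OF F(2,1)] by blast
          have I\<phi>: "1 / real (Suc m) \<le> I \<phi> h" if "h \<in> C" for h
          proof -
            from that F(3) obtain \<psi> where \<psi>: "\<psi> \<in> F" "1 / real (Suc m) < I \<psi> h" by auto
            have "I \<psi> h \<le> I \<phi> h"
              using \<psi>(1) F(1) by (intro I_mono \<phi> Cc_unit_D(1)[of _ "U n"]) auto
            with \<psi>(2) show ?thesis by simp
          qed
          have I0: "0 \<le> I \<phi> h" for h
            unfolding I_def using Cc_unit_D(2)[OF \<phi>(1)] by simp
          have int: "integrable \<mu>H (\<lambda>h. \<delta> h * I \<phi> h)"
            unfolding I_def
            by (intro H.Cc_integrable Cc_mult(1) K.Cc_integrate_out \<delta>_continuous Cc_unit_D(1)[OF \<phi>(1)])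
          have "\<delta> h0 * (1 / real (Suc m)) * measure \<mu>H C = (LINT h|\<mu>H. (\<delta> h0 * (1 / real (Suc m))) * indicator C h)"
            by (simp add: H.space_UNIV)
          also have "\<dots> \<le> (LINT h|\<mu>H. \<delta> h * I \<phi> h)"
          proof (rule integral_mono[OF _ int])
            show "integrable \<mu>H (\<lambda>h. (\<delta> h0 * (1 / real (Suc m))) * indicator C h)"
              using H.emeasure_compact_finite[OF C(1)] H.sets_compact[OF C(1)] by simp
            show "(\<delta> h0 * (1 / real (Suc m))) * indicator C h \<le> \<delta> h * I \<phi> h" for h
            proof (cases "h \<in> C")
              case True
              then have "\<delta> h0 * (1 / real (Suc m)) \<le> \<delta> h * I \<phi> h"
                using less_imp_le[OF \<delta>_pos] by (intro mult_mono h0 I\<phi>) auto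
              then show ?thesis using True by simp
            next
              case False
              then show ?thesis using less_imp_le[OF \<delta>_pos[of h]] I0[of h] by simp
            qed
          qed
          also have "\<dots> = (LINT p|\<mu>G. \<phi> p)"
            using integral_G[OF Cc_unit_D(1)[OF \<phi>(1)]] by (simp add: I_def)
          also have "\<dots> \<le> 1 / real (Suc n)"
            by (intro G.integral_Cc_unit_le[OF \<phi>(1) G.sets_open[OF U(1)] U(3)]) simp
          finally show ?thesis .
        qed
        have "\<delta> h0 * (1 / real (Suc m)) * measure \<mu>H C \<le> 0"
          by (rule LIMSEQ_le_const[OF LIMSEQ_Suc[OF lim_1_over_n]]) (use le in auto)
        then have "measure \<mu>H C \<le> 0"
          using \<delta>_pos[of h0] by (auto simp: mult_le_0_iff field_simps)
        then show ?thesis by (simp add: mC ennreal_neg)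
      qed simp
    qed
    then show ?thesis using B by (simp add: null_sets_def)
  qed
  have small: "{y\<in>Q. (h, y) \<in> N} \<in> null_sets \<mu>K" if h: "h \<in> P" "\<And>m. \<exists>n. h \<notin> A m n" for h
  proof (rule K.null_of_small_cover)
    fix e :: real assume "0 < e"
    then obtain m where m: "1 / real (Suc m) < e" using nat_approx_posE by blast
    obtain n where n: "h \<notin> A m n" using h(2) by blast
    have op: "open (Pair h -` U n)"
      using U(1) by (intro open_vimage continuous_on_Pair continuous_on_const continuous_on_id)
    have "emeasure \<mu>K (Pair h -` U n) \<le> ennreal e"
    proof (rule K.emeasure_le_of_compact[OF K.sets_open[OF op]])
      fix C assume C: "compact C" "C \<subseteq> Pair h -` U n"
      have hC: "compact ({h} \<times> C)" "{h} \<times> C \<subseteq> U n"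
        using C by (auto intro: compact_Times)
      obtain \<phi> where \<phi>: "\<phi> \<in> Cc_unit (U n)" "\<And>p. p \<in> {h} \<times> C \<Longrightarrow> \<phi> p = 1"
        using Cc_unit_Urysohn[OF G.locally_compact hC(1) U(1) hC(2)] by metis
      have "emeasure \<mu>K C \<le> ennreal (I \<phi> h)"
        unfolding I_def
        by (intro K.emeasure_le_integral_Cc K.Cc_section Cc_unit_D[OF \<phi>(1)] K.sets_compact C(1)) (simp add: \<phi>(2))
      also have "ennreal (I \<phi> h) \<le> ennreal e"
      proof (rule ennreal_leI)
        have "I \<phi> h \<le> 1 / real (Suc m)"
          using n \<phi>(1) unfolding A_def by (auto simp: not_less)
        then show "I \<phi> h \<le> e" using m by linarith
      qed
      finally show "emeasure \<mu>K C \<le> ennreal e" .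
    qed
    moreover have "{y\<in>Q. (h, y) \<in> N} \<subseteq> Pair h -` U n"
      using U(2)[of n] h(1) by auto
    ultimately show "\<exists>A\<in>sets \<mu>K. {y\<in>Q. (h, y) \<in> N} \<subseteq> A \<and> emeasure \<mu>K A \<le> ennreal e"
      using K.sets_open[OF op] by blast
  qed
  have "(\<Union>m. P \<inter> (\<Inter>n. A m n)) \<in> null_sets \<mu>H"
    using null_B by (intro null_sets_UN') auto
  then show "AE h in \<mu>H. h \<in> P \<longrightarrow> {y\<in>Q. (h, y) \<in> N} \<in> null_sets \<mu>K"
  proof (rule AE_I')
    show "{h \<in> space \<mu>H. \<not> (h \<in> P \<longrightarrow> {y\<in>Q. (h, y) \<in> N} \<in> null_sets \<mu>K)} \<subseteq> (\<Union>m. P \<inter> (\<Inter>n. A m n))"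
    proof (rule subsetI)
      fix h assume "h \<in> {h \<in> space \<mu>H. \<not> (h \<in> P \<longrightarrow> {y\<in>Q. (h, y) \<in> N} \<in> null_sets \<mu>K)}"
      then have "h \<in> P" "{y\<in>Q. (h, y) \<in> N} \<notin> null_sets \<mu>K" by blast+
      then have "\<exists>m. \<forall>n. h \<in> A m n" using small[of h] by blast
      then show "h \<in> (\<Union>m. P \<inter> (\<Inter>n. A m n))" using \<open>h \<in> P\<close> by auto
    qed
  qed
qed

text \<open>Inside a compact set, a null set of h is contained in an open set of small measure, and the
  measure of the part of the compact set above it is controlled by tensor products of Urysohn functions.\<close>

lemma null_cylinder:
  assumes M: "M \<in> null_sets \<mu>H"
  shows "fst -` M \<in> null_sets \<mu>GD"
proof (rule GD.null_local)
  fix C :: "('h \<times> 'k \<times> 'k dual) set" assume C: "compact C"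
  define P Q E where "P = fst ` C" and "Q = fst ` snd ` C" and "E = snd ` snd ` C"
  have PQE: "compact P" "compact Q" "compact E"
    unfolding P_def Q_def E_def using C by (auto intro!: compact_fst compact_snd)
  obtain \<psi> where \<psi>: "\<psi> \<in> Cc_unit UNIV" "\<And>k. k \<in> Q \<Longrightarrow> \<psi> k = 1"
    using Cc_unit_Urysohn[OF K.locally_compact PQE(2) open_UNIV subset_UNIV] by metis
  obtain \<eta> where \<eta>: "\<eta> \<in> Cc_unit UNIV" "\<And>\<omega>. \<omega> \<in> E \<Longrightarrow> \<eta> \<omega> = 1"
    using Cc_unit_Urysohn[OF D.locally_compact PQE(3) open_UNIV subset_UNIV] by metis
  define c where "c = (LINT k|\<mu>K. \<psi> k) * (LINT \<omega>|\<nu>. \<eta> \<omega>)"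
  have c: "0 \<le> c"
    unfolding c_def using Cc_unit_D(2)[OF \<psi>(1)] Cc_unit_D(2)[OF \<eta>(1)] by simp
  have M': "M \<inter> P \<in> null_sets \<mu>H"
    using M by (rule H.complete2[rotated]) auto
  show "fst -` M \<inter> C \<in> null_sets \<mu>GD"
  proof (rule GD.null_of_small_cover)
    fix e :: real assume e: "0 < e"
    define d where "d = e / (c + 1)"
    have d: "0 < d" "d * c \<le> e"
      using e c by (auto simp: d_def field_simps)
    obtain U where U: "open U" "M \<inter> P \<subseteq> U" "emeasure \<mu>H (U - M \<inter> P) \<le> ennreal d"
      by (rule H.outer_approx[OF null_setsD2[OF M'] _ PQE(1) d(1)]) auto
    have Ud: "emeasure \<mu>H U \<le> ennreal d"
      using U(3) emeasure_Diff_null_set[OF M' H.sets_open[OF U(1)]] by simp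
    have op: "open (fst -` U :: ('h \<times> 'k \<times> 'k dual) set)"
      using U(1) by (intro open_vimage continuous_intros)
    then have S: "fst -` U \<inter> C \<in> sets \<mu>GD"
      using C by (intro sets.Int GD.sets_open GD.sets_compact)
    have "emeasure \<mu>GD (fst -` U \<inter> C) \<le> ennreal e"
    proof (rule GD.emeasure_le_of_compact[OF S])
      fix B assume B: "compact B" "B \<subseteq> fst -` U \<inter> C"
      obtain \<phi> where \<phi>: "\<phi> \<in> Cc_unit U" "\<And>h. h \<in> fst ` B \<Longrightarrow> \<phi> h = 1"
        using Cc_unit_Urysohn[OF H.locally_compact compact_fst[OF B(1)] U(1)] B(2) by (metis Int_subset_iff image_subset_iff_subset_vimage)
      define \<Phi> where "\<Phi> p = \<phi> (fst p) * (\<psi> (fst (snd p)) * \<eta> (snd (snd p)))" for p :: "'h \<times> 'k \<times> 'k dual"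
      have \<Phi>: "\<Phi> \<in> Cc"
      proof -
        obtain S1 where S1: "compact S1" "\<And>x. x \<notin> S1 \<Longrightarrow> \<phi> x = 0" by (metis Cc_support Cc_unit_D(1)[OF \<phi>(1)])
        obtain S2 where S2: "compact S2" "\<And>x. x \<notin> S2 \<Longrightarrow> \<psi> x = 0" by (metis Cc_support Cc_unit_D(1)[OF \<psi>(1)])
        obtain S3 where S3: "compact S3" "\<And>x. x \<notin> S3 \<Longrightarrow> \<eta> x = 0" by (metis Cc_support Cc_unit_D(1)[OF \<eta>(1)])
        show ?thesis
        proof (rule CcI)
          show "continuous_on UNIV \<Phi>"
            unfolding \<Phi>_def
            by (intro continuous_intros continuous_on_compose2[OF Cc_continuous[OF Cc_unit_D(1)[OF \<phi>(1)]]]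
                continuous_on_compose2[OF Cc_continuous[OF Cc_unit_D(1)[OF \<psi>(1)]]]
                continuous_on_compose2[OF Cc_continuous[OF Cc_unit_D(1)[OF \<eta>(1)]]]) auto
          show "compact (S1 \<times> S2 \<times> S3)" by (intro compact_Times S1 S2 S3)
          show "\<Phi> p = 0" if "p \<notin> S1 \<times> S2 \<times> S3" for p
            using that S1(2) S2(2) S3(2) by (auto simp: \<Phi>_def mem_Times_iff)
        qed
      qed
      have "emeasure \<mu>GD B \<le> ennreal (LINT p|\<mu>GD. \<Phi> p)"
      proof (rule GD.emeasure_le_integral_Cc[OF \<Phi> _ _ GD.sets_compact[OF B(1)]])
        show "0 \<le> \<Phi> p" for p
          unfolding \<Phi>_def by (intro mult_nonneg_nonneg Cc_unit_D(2)[OF \<phi>(1)] Cc_unit_D(2)[OF \<psi>(1)] Cc_unit_D(2)[OF \<eta>(1)])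
        show "1 \<le> \<Phi> p" if "p \<in> B" for p
        proof -
          have "p \<in> C" using that B(2) by auto
          then have "\<psi> (fst (snd p)) = 1" "\<eta> (snd (snd p)) = 1"
            by (auto intro!: \<psi>(2) \<eta>(2) simp: Q_def E_def)
          moreover have "\<phi> (fst p) = 1" using that by (intro \<phi>(2)) auto
          ultimately show ?thesis by (simp add: \<Phi>_def)
        qed
      qed
      also have "ennreal (LINT p|\<mu>GD. \<Phi> p) \<le> ennreal e"
      proof (rule ennreal_leI)
        have "(LINT p|\<mu>GD. \<Phi> p) = (LINT h|\<mu>H. \<phi> h) * c"
          unfolding integral_GD[OF \<Phi>] by (simp add: \<Phi>_def c_def)
        also have "\<dots> \<le> d * c"
          using c d by (intro mult_right_mono H.integral_Cc_unit_le[OF \<phi>(1) H.sets_open[OF U(1)] Ud]) auto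
        also have "\<dots> \<le> e" by (rule d(2))
        finally show "(LINT p|\<mu>GD. \<Phi> p) \<le> e" .
      qed
      finally show "emeasure \<mu>GD B \<le> ennreal e" .
    qed
    moreover have "fst -` M \<inter> C \<subseteq> fst -` U \<inter> C"
      using U(2) by (auto simp: P_def)
    ultimately show "\<exists>A\<in>sets \<mu>GD. fst -` M \<inter> C \<subseteq> A \<and> emeasure \<mu>GD A \<le> ennreal e"
      using S by blast
  qed
qed

end

section \<open>The Gabor transform of compactly supported functions\<close>

context gabor
begin

abbreviation "\<V> \<equiv> gabor_transform \<mu>K \<delta>"

lemma gabor_transform_eq:
  "\<V> u f p = complex_of_real (sqrt (\<delta> (fst p))) *
    (LINT y|\<mu>K. f (fst p, y) * cnj (char_eval (snd (snd p)) y * u (y - fst (snd p))))"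
  by (simp add: gabor_transform_def L2_inner_def tf_shift_def case_prod_beta)

lemma gabor_transform_continuous:
  assumes f: "f \<in> Cc" and u: "u \<in> Cc"
  shows "continuous_on UNIV (\<V> u f)"
proof -
  obtain S where S: "compact S" "\<And>p. p \<notin> S \<Longrightarrow> f p = 0" by (metis Cc_support f)
  have "continuous_on UNIV (\<lambda>p :: 'h \<times> 'k \<times> 'k dual.
      LINT y|\<mu>K. f (fst p, y) * cnj (char_eval (snd (snd p)) y * u (y - fst (snd p))))"
  proof (rule K.continuous_parametric_integral[where Q = "snd ` S"])
    have "continuous_on UNIV (\<lambda>q :: ('h \<times> 'k \<times> 'k dual) \<times> 'k. (snd (snd (fst q)), snd q))"
      by (intro continuous_intros)
    from continuous_on_compose2[OF char_eval_jointly_continuous[OF K.locally_compact] this]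
    have "continuous_on UNIV (\<lambda>q :: ('h \<times> 'k \<times> 'k dual) \<times> 'k. char_eval (snd (snd (fst q))) (snd q))"
      by simp
    moreover have "continuous_on UNIV (\<lambda>q :: ('h \<times> 'k \<times> 'k dual) \<times> 'k. f (fst (fst q), snd q))"
      by (rule continuous_on_compose2[OF Cc_continuous[OF f]]) (auto intro!: continuous_intros)
    moreover have "continuous_on UNIV (\<lambda>q :: ('h \<times> 'k \<times> 'k dual) \<times> 'k. u (snd q - fst (snd (fst q))))"
      by (rule continuous_on_compose2[OF Cc_continuous[OF u]]) (auto intro!: continuous_intros)
    ultimately show "continuous_on UNIV (\<lambda>(p :: 'h \<times> 'k \<times> 'k dual, y).
        f (fst p, y) * cnj (char_eval (snd (snd p)) y * u (y - fst (snd p))))"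
      unfolding case_prod_beta by (intro continuous_on_mult continuous_on_cnj)
    show "compact (snd ` S)" by (rule compact_snd[OF S(1)])
    show "f (fst p, y) * cnj (char_eval (snd (snd p)) y * u (y - fst (snd p))) = 0" if "y \<notin> snd ` S"
      for p :: "'h \<times> 'k \<times> 'k dual" and y
      using that S(2)[of "(fst p, y)"] by force
  qed
  moreover have "continuous_on UNIV (\<lambda>p :: 'h \<times> 'k \<times> 'k dual. complex_of_real (sqrt (\<delta> (fst p))))"
    by (intro continuous_on_of_real continuous_on_real_sqrt continuous_on_compose2[OF \<delta>_continuous]
        continuous_on_fst continuous_on_id) simp
  ultimately show ?thesis
    unfolding gabor_transform_eq[abs_def] by (rule continuous_on_mult[rotated])
qed

text \<open>By Plancherel's theorem this is, up to the factor \<delta>(h), the energy of the transform in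
  the variable \<omega>.\<close>

definition spectral_energy :: "('h \<times> 'k \<Rightarrow> complex) \<Rightarrow> ('k \<Rightarrow> complex) \<Rightarrow> 'h \<times> 'k \<Rightarrow> real"
  where "spectral_energy f u p = (LINT y|\<mu>K. (cmod (f (fst p, y)))\<^sup>2 * (cmod (u (y - snd p)))\<^sup>2)"

text \<open>For fixed h and k the transform is, up to the factor \<delta>(h)^(1/2), the Fourier transform of f(h, .) times
  the conjugate of a translate of u. That function is in L1 and L2, so Plancherel's theorem applies
  to the pointwise Fourier integral.\<close>

lemma plancherel_fibre:
  assumes f: "f \<in> Cc" and u: "u \<in> Cc"
  shows "(\<integral>\<^sup>+\<omega>. ennreal ((cmod (\<V> u f (h, k, \<omega>)))\<^sup>2) \<partial>\<nu>)
    = ennreal (\<delta> h * spectral_energy f u (h, k))"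
proof -
  define v where "v y = f (h, y) * cnj (u (y - k))" for y
  have "continuous_on UNIV (\<lambda>y. cnj (u (y - k)))"
    by (intro continuous_on_cnj continuous_on_compose2[OF Cc_continuous[OF u]]) (auto intro!: continuous_intros)
  then have v: "v \<in> Cc"
    unfolding v_def by (intro Cc_mult K.Cc_section f)
  have V: "\<V> u f (h, k, \<omega>) = complex_of_real (sqrt (\<delta> h)) * fourier \<mu>K v \<omega>" for \<omega>
    unfolding gabor_transform_eq fourier_def by (simp add: v_def mult_ac)
  have sq: "0 < sqrt (\<delta> h)" using \<delta>_pos by simp
  have "continuous_on UNIV (\<lambda>\<omega>. \<V> u f (h, k, \<omega>))"
    by (rule continuous_on_compose2[OF gabor_transform_continuous[OF f u]]) (auto intro!: continuous_intros)
  then have "continuous_on UNIV (\<lambda>\<omega>. inverse (complex_of_real (sqrt (\<delta> h))) * \<V> u f (h, k, \<omega>))"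
    by (intro continuous_on_mult continuous_on_const)
  moreover have "inverse (complex_of_real (sqrt (\<delta> h))) * \<V> u f (h, k, \<omega>) = fourier \<mu>K v \<omega>" for \<omega>
    using sq unfolding V by simp
  ultimately have "continuous_on UNIV (fourier \<mu>K v)" by simp
  then have meas: "fourier \<mu>K v \<in> borel_measurable \<nu>"
    by (rule D.measurable_continuous)
  obtain F where F: "L2_unitary \<mu>K \<nu> F" "\<And>v. integrable \<mu>K v \<and> v \<in> L2 \<mu>K \<Longrightarrow> AE \<omega> in \<nu>. F v \<omega> = fourier \<mu>K v \<omega>"
    using plancherel unfolding plancherel_measure_def by blast
  have Fv: "F v \<in> L2 \<nu>" "L2_norm \<nu> (F v) = L2_norm \<mu>K v"
    using F(1) K.Cc_L2[OF v] unfolding L2_unitary_def L2_isometry_def by blast+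
  have ae: "AE \<omega> in \<nu>. F v \<omega> = fourier \<mu>K v \<omega>"
    using F(2) K.Cc_L2[OF v] K.Cc_integrable[OF v] by blast
  note fv = L2_AE_cong[OF Fv(1) meas ae]
  have E: "(L2_norm \<mu>K v)\<^sup>2 = spectral_energy f u (h, k)"
    by (simp add: L2_norm_power2 v_def spectral_energy_def norm_mult power_mult_distrib)
  have "(\<integral>\<^sup>+\<omega>. ennreal ((cmod (\<V> u f (h, k, \<omega>)))\<^sup>2) \<partial>\<nu>)
    = (\<integral>\<^sup>+\<omega>. ennreal (\<delta> h) * ennreal ((cmod (fourier \<mu>K v \<omega>))\<^sup>2) \<partial>\<nu>)"
    using less_imp_le[OF \<delta>_pos] by (intro nn_integral_cong) (simp add: V norm_mult power_mult_distrib ennreal_mult)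
  also have "\<dots> = ennreal (\<delta> h) * ennreal ((L2_norm \<nu> (fourier \<mu>K v))\<^sup>2)"
    using meas by (simp add: nn_integral_cmult nn_integral_L2[OF fv(1)])
  also have "\<dots> = ennreal (\<delta> h * spectral_energy f u (h, k))"
    using less_imp_le[OF \<delta>_pos] by (simp add: fv(2) Fv(2) E ennreal_mult')
  finally show ?thesis .
qed

lemma u_translates_integral:
  assumes u: "u \<in> Cc"
  shows "(LINT k|\<mu>K. (cmod (u (y - k)))\<^sup>2) = (L2_norm \<mu>K u)\<^sup>2"
proof -
  define g where "g k = (cmod (u k))\<^sup>2" for k
  have g: "g \<in> Cc" unfolding g_def by (rule Cc_norm_square[OF u])
  have "continuous_on UNIV (\<lambda>k. g (- k))"
    by (rule continuous_on_compose2[OF Cc_continuous[OF g]]) (auto intro!: continuous_intros)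
  then have "(LINT k|\<mu>K. g (- (k - y))) = (LINT k|\<mu>K. g (- k))"
    by (intro K.integral_translation K.measurable_continuous)
  also have "\<dots> = (LINT k|\<mu>K. g k)" by (rule K.Cc_integral_inversion[OF g])
  finally show ?thesis by (simp add: g_def L2_norm_power2)
qed

lemma energy_density_Cc:
  fixes f :: "'h \<times> 'k \<Rightarrow> complex" and u :: "'k \<Rightarrow> complex"
  assumes f: "f \<in> Cc" and u: "u \<in> Cc"
  shows "(\<lambda>q. (cmod (f (fst (fst q), snd q)))\<^sup>2 * (cmod (u (snd q - snd (fst q))))\<^sup>2) \<in> Cc"
proof -
  obtain S where S: "compact S" "\<And>p. p \<notin> S \<Longrightarrow> f p = 0" by (metis Cc_support f)
  obtain T where T: "compact T" "\<And>p. p \<notin> T \<Longrightarrow> u p = 0" by (metis Cc_support u)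
  define R where "R = (\<lambda>p. fst p - snd p) ` ((snd ` S) \<times> T)"
  have R: "compact R"
    unfolding R_def using S T by (intro compact_continuous_image compact_Times continuous_intros compact_snd)
  show ?thesis
  proof (rule CcI)
    show "continuous_on UNIV (\<lambda>q. (cmod (f (fst (fst q), snd q)))\<^sup>2 * (cmod (u (snd q - snd (fst q))))\<^sup>2)"
      by (intro continuous_intros continuous_on_compose2[OF Cc_continuous[OF f]]
          continuous_on_compose2[OF Cc_continuous[OF u]]) auto
    show "compact ((fst ` S \<times> R) \<times> snd ` S)"
      by (intro compact_Times R compact_fst compact_snd S)
    fix q :: "('h \<times> 'k) \<times> 'k" assume q: "q \<notin> (fst ` S \<times> R) \<times> snd ` S"
    show "(cmod (f (fst (fst q), snd q)))\<^sup>2 * (cmod (u (snd q - snd (fst q))))\<^sup>2 = 0"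
    proof (rule ccontr)
      assume "\<not> ?thesis"
      then have *: "(fst (fst q), snd q) \<in> S" "snd q - snd (fst q) \<in> T" using S(2) T(2) by auto
      then have "fst (fst q) \<in> fst ` S" "snd q \<in> snd ` S"
        using imageI[OF *(1), of fst] imageI[OF *(1), of snd] by simp_all
      moreover have "snd (fst q) \<in> R"
        unfolding R_def using *(2) \<open>snd q \<in> snd ` S\<close>
        by (intro image_eqI[of _ _ "(snd q, snd q - snd (fst q))"]) auto
      ultimately show False using q by (simp add: mem_Times_iff)
    qed
  qed
qed

lemma spectral_energy_Cc:
  assumes f: "f \<in> Cc" and u: "u \<in> Cc"
  obtains P R where "compact P" "compact R"
    "\<And>h k y. (h, k) \<notin> P \<times> R \<Longrightarrow> (cmod (f (h, y)))\<^sup>2 * (cmod (u (y - k)))\<^sup>2 = 0" "spectral_energy f u \<in> Cc"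
proof -
  obtain S where S: "compact S"
    "\<And>q. q \<notin> S \<Longrightarrow> (cmod (f (fst (fst q), snd q)))\<^sup>2 * (cmod (u (snd q - snd (fst q))))\<^sup>2 = 0"
    using Cc_support[OF energy_density_Cc[OF f u]] by blast
  show ?thesis
  proof (rule that)
    show "compact (fst ` fst ` S)" "compact (snd ` fst ` S)"
      by (intro compact_fst compact_snd S)+
    show "(cmod (f (h, y)))\<^sup>2 * (cmod (u (y - k)))\<^sup>2 = 0" if "(h, k) \<notin> fst ` fst ` S \<times> snd ` fst ` S" for h k y
      using S(2)[of "((h, k), y)"] that by force
    show "spectral_energy f u \<in> Cc"
      using K.Cc_integrate_out[OF energy_density_Cc[OF f u]] unfolding spectral_energy_def[abs_def] by simp
  qed
qed

text \<open>By inversion and translation invariance the integral of |u(y - k)|^2 over k is, for every y,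
  the squared norm of u.\<close>

lemma integral_spectral_energy:
  assumes f: "f \<in> Cc" and u: "u \<in> Cc"
  shows "(LINT h|\<mu>H. LINT k|\<mu>K. \<delta> h * spectral_energy f u (h, k)) = (L2_norm \<mu>K u)\<^sup>2 * (L2_norm \<mu>G f)\<^sup>2"
proof -
  interpret KK: radon_pair \<mu>K \<mu>K ..
  have inner: "(LINT k|\<mu>K. spectral_energy f u (h, k)) = (L2_norm \<mu>K u)\<^sup>2 * (LINT y|\<mu>K. (cmod (f (h, y)))\<^sup>2)" for h
  proof -
    obtain S where S: "compact S"
      "\<And>q. q \<notin> S \<Longrightarrow> (cmod (f (fst (fst q), snd q)))\<^sup>2 * (cmod (u (snd q - snd (fst q))))\<^sup>2 = 0"
      using Cc_support[OF energy_density_Cc[OF f u]] by blast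
    have "(\<lambda>q. (cmod (f (h, snd q)))\<^sup>2 * (cmod (u (snd q - fst q)))\<^sup>2) \<in> Cc"
    proof (rule CcI)
      show "continuous_on UNIV (\<lambda>q. (cmod (f (h, snd q)))\<^sup>2 * (cmod (u (snd q - fst q)))\<^sup>2)"
        by (intro continuous_intros continuous_on_compose2[OF Cc_continuous[OF f]]
            continuous_on_compose2[OF Cc_continuous[OF u]]) auto
      show "compact ((snd ` fst ` S) \<times> snd ` S)" by (intro compact_Times compact_fst compact_snd S)
      show "(cmod (f (h, snd q)))\<^sup>2 * (cmod (u (snd q - fst q)))\<^sup>2 = 0" if "q \<notin> (snd ` fst ` S) \<times> snd ` S" for q
        using S(2)[of "((h, fst q), snd q)"] that by (force simp: mem_Times_iff)
    qed
    from KK.Cc_Fubini[OF this]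
    have "(LINT k|\<mu>K. spectral_energy f u (h, k)) = (LINT y|\<mu>K. LINT k|\<mu>K. (cmod (f (h, y)))\<^sup>2 * (cmod (u (y - k)))\<^sup>2)"
      by (simp add: spectral_energy_def)
    also have "\<dots> = (LINT y|\<mu>K. (cmod (f (h, y)))\<^sup>2 * (L2_norm \<mu>K u)\<^sup>2)"
      by (simp add: u_translates_integral[OF u])
    also have "\<dots> = (L2_norm \<mu>K u)\<^sup>2 * (LINT y|\<mu>K. (cmod (f (h, y)))\<^sup>2)"
      by simp
    finally show ?thesis .
  qed
  have "(LINT h|\<mu>H. LINT k|\<mu>K. \<delta> h * spectral_energy f u (h, k))
      = (LINT h|\<mu>H. (L2_norm \<mu>K u)\<^sup>2 * (\<delta> h * (LINT y|\<mu>K. (cmod (f (h, y)))\<^sup>2)))"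
    by (simp add: inner mult_ac)
  also have "\<dots> = (L2_norm \<mu>K u)\<^sup>2 * (LINT p|\<mu>G. (cmod (f p))\<^sup>2)"
    by (simp add: integral_G[OF Cc_norm_square[OF f]])
  finally show ?thesis by (simp add: L2_norm_power2)
qed

lemma iterated_HK_mono:
  fixes \<Phi> \<Psi> :: "'h \<times> 'k \<Rightarrow> real"
  assumes "\<Phi> \<in> Cc" "\<Psi> \<in> Cc" "\<And>h k. \<Phi> (h, k) \<le> \<Psi> (h, k)"
  shows "(LINT h|\<mu>H. LINT k|\<mu>K. \<Phi> (h, k)) \<le> (LINT h|\<mu>H. LINT k|\<mu>K. \<Psi> (h, k))"
  by (intro integral_mono H.Cc_integrable K.Cc_integrate_out K.Cc_integrable K.Cc_section assms)

text \<open>On the dual only cutoffs \<eta> give compactly supported integrands. The upper bound is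
  Plancherel's theorem fibre by fibre; for the lower bound a single cutoff nearly exhausts
  the energy of all fibres over a compact set, as in Dini's theorem.\<close>

lemma gabor_transform_Cc:
  assumes f: "f \<in> Cc" and u: "u \<in> Cc"
  shows "\<V> u f \<in> L2 \<mu>GD"
    "L2_norm \<mu>GD (\<V> u f) = L2_norm \<mu>K u * L2_norm \<mu>G f"
proof -
  define V where "V = \<V> u f"
  have V: "continuous_on UNIV V" unfolding V_def by (rule gabor_transform_continuous[OF f u])
  note fibre = plancherel_fibre[OF f u, folded V_def]
  obtain P R where PR: "compact P" "compact R"
    "\<And>h k y. (h, k) \<notin> P \<times> R \<Longrightarrow> (cmod (f (h, y)))\<^sup>2 * (cmod (u (y - k)))\<^sup>2 = 0" and E: "spectral_energy f u \<in> Cc"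
    using spectral_energy_Cc[OF f u] by metis
  define A where "A p = \<delta> (fst p) * spectral_energy f u p" for p
  have "continuous_on UNIV (\<lambda>p :: 'h \<times> 'k. \<delta> (fst p))"
    by (rule continuous_on_compose2[OF \<delta>_continuous]) (auto intro!: continuous_intros)
  then have A: "A \<in> Cc" unfolding A_def by (intro Cc_mult E)
  have A0: "0 \<le> A p" for p
    unfolding A_def spectral_energy_def using less_imp_le[OF \<delta>_pos] by simp
  define T where "T = (L2_norm \<mu>K u)\<^sup>2 * (L2_norm \<mu>G f)\<^sup>2"
  have IA: "(LINT h|\<mu>H. LINT k|\<mu>K. A (h, k)) = T"
    using integral_spectral_energy[OF f u] by (simp add: A_def T_def)
  have Vzero: "V (h, k, \<omega>) = 0" if "(h, k) \<notin> P \<times> R" for h k \<omega>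
  proof -
    have "f (h, y) * cnj (char_eval \<omega> y * u (y - k)) = 0" for y
      using PR(3)[OF that, of y] by auto
    then have "(LINT y|\<mu>K. f (h, y) * cnj (char_eval \<omega> y * u (y - k))) = 0"
      by (simp only: Bochner_Integration.integral_zero)
    then show ?thesis unfolding V_def gabor_transform_eq fst_conv snd_conv by (simp only: mult_zero_right)
  qed
  have sqV: "continuous_on UNIV (\<lambda>p. (cmod (V p))\<^sup>2)" by (intro continuous_intros V)
  define W where "W \<eta> p = (cmod (V p))\<^sup>2 * \<eta> (snd (snd p))" for \<eta> :: "'k dual \<Rightarrow> real" and p
  define J where "J \<eta> q = (LINT \<omega>|\<nu>. W \<eta> (fst q, snd q, \<omega>))" for \<eta> q
  have W: "W \<eta> \<in> Cc" and J: "J \<eta> \<in> Cc" if \<eta>: "\<eta> \<in> Cc_unit UNIV" for \<eta>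
  proof -
    obtain S where S: "compact S" "\<And>\<omega>. \<omega> \<notin> S \<Longrightarrow> \<eta> \<omega> = 0" by (metis Cc_support Cc_unit_D(1)[OF \<eta>])
    have cW: "continuous_on UNIV (W \<eta>)"
      unfolding W_def
      by (intro continuous_on_mult sqV continuous_on_compose2[OF Cc_continuous[OF Cc_unit_D(1)[OF \<eta>]]] continuous_intros) auto
    have zW: "W \<eta> (h, k, \<omega>) = 0" if "h \<notin> P \<or> k \<notin> R \<or> \<omega> \<notin> S" for h k \<omega>
      using that S(2)[of \<omega>] Vzero[of h k \<omega>] by (auto simp: W_def)
    show "W \<eta> \<in> Cc"
      by (rule CcI[OF cW, of "P \<times> R \<times> S"]) (use zW PR S in \<open>auto intro!: compact_Times\<close>)
    have "(\<lambda>q. W \<eta> (fst (fst q), snd (fst q), snd q)) \<in> Cc"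
    proof (rule CcI)
      show "continuous_on UNIV (\<lambda>q. W \<eta> (fst (fst q), snd (fst q), snd q))"
        by (rule continuous_on_compose2[OF cW]) (auto intro!: continuous_intros)
      show "compact ((P \<times> R) \<times> S)" by (intro compact_Times PR S)
      show "W \<eta> (fst (fst q), snd (fst q), snd q) = 0" if "q \<notin> (P \<times> R) \<times> S" for q
        by (rule zW) (use that in \<open>auto simp: mem_Times_iff\<close>)
    qed
    from D.Cc_integrate_out[OF this] show "J \<eta> \<in> Cc"
      unfolding J_def by simp
  qed
  have W0: "0 \<le> W \<eta> p" if "\<eta> \<in> Cc_unit UNIV" for \<eta> p
    unfolding W_def using Cc_unit_D(2)[OF that] by simp
  have secW: "(\<lambda>\<omega>. W \<eta> (h, k, \<omega>)) \<in> Cc" if "\<eta> \<in> Cc_unit UNIV" for \<eta> h k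
    using D.Cc_section[OF D.Cc_section[OF W[OF that]]] .
  have JA: "J \<eta> (h, k) \<le> A (h, k)" if \<eta>: "\<eta> \<in> Cc_unit UNIV" for \<eta> h k
  proof -
    have "ennreal (J \<eta> (h, k)) = (\<integral>\<^sup>+\<omega>. ennreal (W \<eta> (h, k, \<omega>)) \<partial>\<nu>)"
      unfolding J_def fst_conv snd_conv using W0[OF \<eta>]
      by (intro nn_integral_eq_integral[symmetric] D.Cc_integrable secW \<eta>) auto
    also have "\<dots> \<le> (\<integral>\<^sup>+\<omega>. ennreal ((cmod (V (h, k, \<omega>)))\<^sup>2) \<partial>\<nu>)"
      unfolding W_def using Cc_unit_D(2,4)[OF \<eta>] by (intro nn_integral_mono ennreal_leI mult_left_le) auto
    also have "\<dots> = ennreal (A (h, k))" by (simp add: fibre A_def)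
    finally show ?thesis using A0 by (simp add: ennreal_le_iff)
  qed
  have IW: "(LINT p|\<mu>GD. W \<eta> p) = (LINT h|\<mu>H. LINT k|\<mu>K. J \<eta> (h, k))" if "\<eta> \<in> Cc_unit UNIV" for \<eta>
    by (simp add: integral_GD[OF W[OF that]] J_def)
  have nnW: "(\<integral>\<^sup>+p. ennreal (W \<eta> p) \<partial>\<mu>GD) = ennreal (LINT p|\<mu>GD. W \<eta> p)" if "\<eta> \<in> Cc_unit UNIV" for \<eta>
    using W0[OF that] by (intro nn_integral_eq_integral GD.Cc_integrable W that) auto
  have meas: "V \<in> borel_measurable \<mu>GD" by (rule GD.measurable_continuous[OF V])
  let ?N = "\<integral>\<^sup>+p. ennreal ((cmod (V p))\<^sup>2) \<partial>\<mu>GD"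
  have upper: "?N \<le> ennreal T"
  proof (rule GD.nn_integral_le_of_compact)
    show "(\<lambda>p. ennreal ((cmod (V p))\<^sup>2)) \<in> borel_measurable \<mu>GD" using meas by measurable
    fix C :: "('h \<times> 'k \<times> 'k dual) set" assume C: "compact C"
    obtain \<eta> where \<eta>: "\<eta> \<in> Cc_unit UNIV" "\<And>\<omega>. \<omega> \<in> snd ` snd ` C \<Longrightarrow> \<eta> \<omega> = 1"
      using Cc_unit_Urysohn[OF D.locally_compact compact_snd[OF compact_snd[OF C]] open_UNIV subset_UNIV] by metis
    have "(\<integral>\<^sup>+p. ennreal ((cmod (V p))\<^sup>2) * indicator C p \<partial>\<mu>GD) \<le> (\<integral>\<^sup>+p. ennreal (W \<eta> p) \<partial>\<mu>GD)"
    proof (rule nn_integral_mono)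
      fix p show "ennreal ((cmod (V p))\<^sup>2) * indicator C p \<le> ennreal (W \<eta> p)"
      proof (cases "p \<in> C")
        case True
        then have "\<eta> (snd (snd p)) = 1" by (intro \<eta>(2)) auto
        then show ?thesis by (simp add: W_def True)
      qed simp
    qed
    also have "\<dots> \<le> ennreal T"
      unfolding nnW[OF \<eta>(1)] IW[OF \<eta>(1)] IA[symmetric]
      by (intro ennreal_leI iterated_HK_mono J \<eta> A JA)
    finally show "(\<integral>\<^sup>+p. ennreal ((cmod (V p))\<^sup>2) * indicator C p \<partial>\<mu>GD) \<le> ennreal T" .
  qed
  \<comment> \<open>Since \<theta> is 1 on the support of A, a deficit of at most e at each point costs at most e * c
    after integration.\<close>
  obtain \<theta> where \<theta>: "\<theta> \<in> Cc_unit UNIV" "\<And>q. q \<in> P \<times> R \<Longrightarrow> \<theta> q = 1"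
    using Cc_unit_Urysohn[OF G.locally_compact compact_Times[OF PR(1,2)] open_UNIV subset_UNIV] by metis
  define c where "c = (LINT h|\<mu>H. LINT k|\<mu>K. \<theta> (h, k))"
  have c: "0 \<le> c" unfolding c_def using Cc_unit_D(2)[OF \<theta>(1)] by simp
  have lower: "ennreal (T - e * c) \<le> ?N" if e: "0 < e" for e
  proof -
    have "\<exists>\<eta>. \<eta> \<in> Cc_unit UNIV \<and> A q - e < J \<eta> q" for q
    proof (cases "A q - e < 0")
      case True
      have "(\<lambda>\<omega>. 0) \<in> Cc_unit (UNIV :: 'k dual set)" by (simp add: Cc_unit_def Cc_zero)
      moreover have "J (\<lambda>\<omega>. 0) q = 0" by (simp add: J_def W_def)
      ultimately show ?thesis using True by metis
    next
      case False
      have mV: "(\<lambda>\<omega>. ennreal ((cmod (V (fst q, snd q, \<omega>)))\<^sup>2)) \<in> borel_measurable \<nu>"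
      proof -
        have "continuous_on UNIV (\<lambda>\<omega>. V (fst q, snd q, \<omega>))"
          by (rule continuous_on_compose2[OF V]) (auto intro!: continuous_intros)
        note [measurable] = D.measurable_continuous[OF this]
        show ?thesis by measurable
      qed
      have "ennreal (A q - e) < ennreal (A q)"
        using False e by (simp add: ennreal_less_iff)
      also have "ennreal (A q) = (SUP C\<in>{C. compact C}. \<integral>\<^sup>+\<omega>. ennreal ((cmod (V (fst q, snd q, \<omega>)))\<^sup>2) * indicator C \<omega> \<partial>\<nu>)"
        using fibre[of "fst q" "snd q"] D.nn_integral_compact[OF mV] by (simp add: A_def)
      finally obtain C where C: "compact C"
          "ennreal (A q - e) < (\<integral>\<^sup>+\<omega>. ennreal ((cmod (V (fst q, snd q, \<omega>)))\<^sup>2) * indicator C \<omega> \<partial>\<nu>)"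
        unfolding less_SUP_iff by blast
      obtain \<eta> where \<eta>: "\<eta> \<in> Cc_unit UNIV" "\<And>\<omega>. \<omega> \<in> C \<Longrightarrow> \<eta> \<omega> = 1"
        using Cc_unit_Urysohn[OF D.locally_compact C(1) open_UNIV subset_UNIV] by metis
      note C(2)
      also have "(\<integral>\<^sup>+\<omega>. ennreal ((cmod (V (fst q, snd q, \<omega>)))\<^sup>2) * indicator C \<omega> \<partial>\<nu>)
          \<le> (\<integral>\<^sup>+\<omega>. ennreal (W \<eta> (fst q, snd q, \<omega>)) \<partial>\<nu>)"
        using \<eta>(2) by (intro nn_integral_mono) (simp add: W_def split: split_indicator)
      also have "\<dots> = ennreal (J \<eta> q)"
        unfolding J_def using W0[OF \<eta>(1)]
        by (intro nn_integral_eq_integral D.Cc_integrable secW \<eta>) auto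
      finally have "A q - e < J \<eta> q"
        using False by (simp add: ennreal_less_iff)
      then show ?thesis using \<eta>(1) by blast
    qed
    then obtain \<eta>' where \<eta>': "\<And>q. \<eta>' q \<in> Cc_unit UNIV" "\<And>q. A q - e < J (\<eta>' q) q" by metis
    have op: "open {q'. A q' - e < J (\<eta>' q) q'}" for q
      using open_Collect_less[OF continuous_on_diff[OF Cc_continuous[OF A] continuous_on_const[of _ e]] Cc_continuous[OF J[OF \<eta>'(1)]], of q]
      by simp
    obtain F where F: "F \<subseteq> P \<times> R" "finite F" "P \<times> R \<subseteq> (\<Union>q\<in>F. {q'. A q' - e < J (\<eta>' q) q'})"
      by (rule compactE_image[OF compact_Times[OF PR(1,2)], of "P \<times> R" "\<lambda>q. {q'. A q' - e < J (\<eta>' q) q'}"])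
         (use op \<eta>'(2) in auto)
    obtain \<eta> where \<eta>: "\<eta> \<in> Cc_unit UNIV" "\<And>q \<omega>. q \<in> F \<Longrightarrow> \<eta>' q \<omega> \<le> \<eta> \<omega>"
      using Cc_unit_directed[of "\<eta>' ` F" UNIV] F(2) \<eta>'(1) by (auto simp: image_subset_iff)
    have le: "A q - e * \<theta> q \<le> J \<eta> q" for q
    proof (cases "q \<in> P \<times> R")
      case True
      then obtain q' where q': "q' \<in> F" "A q - e < J (\<eta>' q') q" using F(3) by auto
      have "J (\<eta>' q') q \<le> J \<eta> q"
        unfolding J_def
      proof (intro integral_mono D.Cc_integrable secW \<eta>(1) \<eta>'(1))
        show "W (\<eta>' q') (fst q, snd q, \<omega>) \<le> W \<eta> (fst q, snd q, \<omega>)" for \<omega>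
          unfolding W_def using \<eta>(2)[OF q'(1)] by (intro mult_left_mono) auto
      qed
      then show ?thesis using q'(2) \<theta>(2)[OF True] by simp
    next
      case False
      have "(cmod (f (fst q, y)))\<^sup>2 * (cmod (u (y - snd q)))\<^sup>2 = 0" for y
        using PR(3)[of "fst q" "snd q" y] False by simp
      then have "spectral_energy f u q = 0"
        unfolding spectral_energy_def by (simp only: Bochner_Integration.integral_zero)
      then have "A q = 0" by (simp add: A_def)
      moreover have "0 \<le> e * \<theta> q" using e Cc_unit_D(2)[OF \<theta>(1)] by simp
      moreover have "0 \<le> J \<eta> q" unfolding J_def using W0[OF \<eta>(1)] by simp
      ultimately show ?thesis by simp
    qed
    have "T - e * c = (LINT h|\<mu>H. LINT k|\<mu>K. A (h, k) - e * \<theta> (h, k))"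
      using K.Cc_integrable[OF K.Cc_section[OF A]] K.Cc_integrable[OF K.Cc_section[OF Cc_unit_D(1)[OF \<theta>(1)]]]
        H.Cc_integrable[OF K.Cc_integrate_out[OF A]] H.Cc_integrable[OF K.Cc_integrate_out[OF Cc_unit_D(1)[OF \<theta>(1)]]]
      by (simp add: IA[symmetric] c_def)
    also have "\<dots> \<le> (LINT h|\<mu>H. LINT k|\<mu>K. J \<eta> (h, k))"
      by (rule iterated_HK_mono[of "\<lambda>q. A q - e * \<theta> q"])
         (intro Cc_diff A Cc_cmult Cc_unit_D(1)[OF \<theta>(1)] J[OF \<eta>(1)] le)+
    also have "\<dots> = (LINT p|\<mu>GD. W \<eta> p)" by (rule IW[OF \<eta>(1), symmetric])
    finally have "ennreal (T - e * c) \<le> (\<integral>\<^sup>+p. ennreal (W \<eta> p) \<partial>\<mu>GD)"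
      unfolding nnW[OF \<eta>(1)] by (rule ennreal_leI)
    also have "\<dots> \<le> ?N"
      unfolding W_def using Cc_unit_D(2,4)[OF \<eta>(1)] by (intro nn_integral_mono ennreal_leI mult_left_le) auto
    finally show ?thesis .
  qed
  have "T \<ge> 0" by (simp add: T_def)
  have T_eq: "T = (L2_norm \<mu>K u * L2_norm \<mu>G f)\<^sup>2" by (simp add: T_def power_mult_distrib)
  have L: "V \<in> L2 \<mu>GD" "L2_norm \<mu>GD V \<le> L2_norm \<mu>K u * L2_norm \<mu>G f"
    by (rule L2_norm_le_nn_integral[OF meas upper[unfolded T_eq]]; simp)+
  have "T \<le> (L2_norm \<mu>GD V)\<^sup>2"
  proof (rule field_le_epsilon)
    fix e :: real assume "0 < e"
    define d where "d = e / (c + 1)"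
    have d: "0 < d" "d * c \<le> e"
      using \<open>0 < e\<close> c by (auto simp: d_def field_simps)
    have "ennreal (T - d * c) \<le> ennreal ((L2_norm \<mu>GD V)\<^sup>2)"
      using lower[OF d(1)] nn_integral_L2[OF L(1)] by simp
    then have "T - d * c \<le> (L2_norm \<mu>GD V)\<^sup>2"
      by (simp add: ennreal_le_iff)
    then show "T \<le> (L2_norm \<mu>GD V)\<^sup>2 + e" using d(2) by linarith
  qed
  then have "L2_norm \<mu>K u * L2_norm \<mu>G f \<le> L2_norm \<mu>GD V"
    unfolding T_eq by (rule power2_le_imp_le) simp
  with L show "\<V> u f \<in> L2 \<mu>GD"
    "L2_norm \<mu>GD (\<V> u f) = L2_norm \<mu>K u * L2_norm \<mu>G f"
    unfolding V_def by auto
qed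

end

section \<open>The Gabor transform of square-integrable functions\<close>

lemma L2_fast_add:
  assumes "L2_fast M F f" "L2_fast M G g"
  shows "L2_fast M (\<lambda>n x. F n x + G n x) (\<lambda>x. f x + g x)"
proof -
  obtain C where C: "\<And>n. L2_norm M (\<lambda>x. F n x - f x) \<le> C / 2 ^ n" and LF: "f \<in> L2 M" "\<And>n. F n \<in> L2 M"
    using assms(1) unfolding L2_fast_def by blast
  obtain D where D: "\<And>n. L2_norm M (\<lambda>x. G n x - g x) \<le> D / 2 ^ n" and LG: "g \<in> L2 M" "\<And>n. G n \<in> L2 M"
    using assms(2) unfolding L2_fast_def by blast
  have "L2_norm M (\<lambda>x. F n x + G n x - (f x + g x)) \<le> (C + D) / 2 ^ n" for n
  proof -
    have "L2_norm M (\<lambda>x. (F n x - f x) + (G n x - g x)) \<le> C / 2 ^ n + D / 2 ^ n"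
      by (intro order_trans[OF L2_norm_triangle] add_mono C D L2_diff LF LG)
    then show ?thesis by (simp add: add_divide_distrib algebra_simps)
  qed
  then show ?thesis
    unfolding L2_fast_def by (intro conjI allI L2_add LF LG exI[of _ "C + D"])
qed

lemma L2_fast_summable:
  assumes "L2_fast M F f"
  shows "summable (\<lambda>n. L2_norm M (\<lambda>x. F n x - F (Suc n) x))"
proof -
  obtain C where C: "\<And>n. L2_norm M (\<lambda>x. F n x - f x) \<le> C / 2 ^ n" and LF: "f \<in> L2 M" "\<And>n. F n \<in> L2 M"
    using assms(1) unfolding L2_fast_def by blast
  have s: "summable (\<lambda>n. C * (1/2) ^ n)"
    by (intro summable_mult summable_geometric) simp
  have "summable (\<lambda>n. L2_norm M (\<lambda>x. F n x - f x))"
  proof (rule summable_comparison_test'[OF s])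
    show "norm (L2_norm M (\<lambda>x. F n x - f x)) \<le> C * (1/2) ^ n" if "0 \<le> n" for n
      using C[of n] by (simp add: power_divide)
  qed
  then have "summable (\<lambda>n. L2_norm M (\<lambda>x. F n x - f x) + L2_norm M (\<lambda>x. F (Suc n) x - f x))"
    using summable_Suc_iff[of "\<lambda>n. L2_norm M (\<lambda>x. F n x - f x)"] by (intro summable_add) simp_all
  then show ?thesis
  proof (rule summable_comparison_test')
    show "norm (L2_norm M (\<lambda>x. F n x - F (Suc n) x)) \<le> L2_norm M (\<lambda>x. F n x - f x) + L2_norm M (\<lambda>x. F (Suc n) x - f x)"
      if "0 \<le> n" for n
      using L2_norm_diff_triangle[OF LF(2)[of n] LF(1) LF(2)[of "Suc n"]] L2_norm_minus_commute[of M f "F (Suc n)"]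
      by simp
  qed
qed

lemma L2_norm_mono:
  assumes "g \<in> L2 M" "f \<in> borel_measurable M" "\<And>x. cmod (f x) \<le> cmod (g x)"
  shows "f \<in> L2 M" "L2_norm M f \<le> L2_norm M g"
proof -
  have "(\<integral>\<^sup>+x. ennreal ((cmod (f x))\<^sup>2) \<partial>M) \<le> (\<integral>\<^sup>+x. ennreal ((cmod (g x))\<^sup>2) \<partial>M)"
    by (intro nn_integral_mono ennreal_leI power_mono assms(3)) simp
  then have "(\<integral>\<^sup>+x. ennreal ((cmod (f x))\<^sup>2) \<partial>M) \<le> ennreal ((L2_norm M g)\<^sup>2)"
    by (simp add: nn_integral_L2[OF assms(1)])
  from L2_norm_le_nn_integral[OF assms(2) this] show "f \<in> L2 M" "L2_norm M f \<le> L2_norm M g"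
    by simp_all
qed

context gabor
begin

lemma gabor_integrable:
  assumes f: "f \<in> Cc" and u: "u \<in> Cc"
  shows "integrable \<mu>K (\<lambda>y. f (h, y) * cnj (char_eval \<omega> y * u (y - k)))"
proof (intro K.Cc_integrable Cc_mult(2) K.Cc_section f)
  show "continuous_on UNIV (\<lambda>y. cnj (char_eval \<omega> y * u (y - k)))"
    by (intro continuous_on_cnj continuous_on_mult char_eval_continuous continuous_on_compose2[OF Cc_continuous[OF u]]
        continuous_intros) auto
qed

lemma gabor_transform_Cc_add:
  assumes "f \<in> Cc" "g \<in> Cc" "u \<in> Cc"
  shows "\<V> u (\<lambda>x. f x + g x) p = \<V> u f p + \<V> u g p"
  unfolding gabor_transform_eq distrib_right
  by (simp only: Bochner_Integration.integral_add[OF gabor_integrable[OF assms(1,3)] gabor_integrable[OF assms(2,3)]] distrib_left)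

lemma gabor_transform_Cc_diff:
  assumes "f \<in> Cc" "g \<in> Cc" "u \<in> Cc"
  shows "\<V> u (\<lambda>x. f x - g x) p = \<V> u f p - \<V> u g p"
  unfolding gabor_transform_eq left_diff_distrib
  by (simp only: Bochner_Integration.integral_diff[OF gabor_integrable[OF assms(1,3)] gabor_integrable[OF assms(2,3)]] right_diff_distrib)

lemma gabor_transform_Cc_window_diff:
  assumes "f \<in> Cc" "u \<in> Cc" "v \<in> Cc"
  shows "\<V> (\<lambda>x. u x - v x) f p = \<V> u f p - \<V> v f p"
  unfolding gabor_transform_eq right_diff_distrib complex_cnj_diff
  by (simp only: Bochner_Integration.integral_diff[OF gabor_integrable[OF assms(1,2)] gabor_integrable[OF assms(1,3)]] right_diff_distrib)

lemma gabor_transform_cmult: "\<V> u (\<lambda>x. c * f x) p = c * \<V> u f p"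
  unfolding gabor_transform_eq by (simp add: mult.assoc mult.left_commute)

text \<open>The squared L2 norm of F n - F (n + 1) on the semi-direct product is the integral over h, with weight
  \<delta>(h), of the squared norms of its sections, because F n - F (n + 1) is in Cc. So almost
  all sections form a Cauchy sequence.\<close>

lemma AE_sections_summable:
  assumes F: "\<And>n. F n \<in> Cc" "L2_fast \<mu>G F f"
  shows "AE h in \<mu>H. summable (\<lambda>n. L2_norm \<mu>K (\<lambda>y. F n (h, y) - F (Suc n) (h, y)))"
proof -
  obtain C where C: "\<And>n. (L2_norm \<mu>G (\<lambda>x. F n x - F (Suc n) x))\<^sup>2 \<le> C / 4 ^ n"
    using L2_fast_step[OF F(2)] by metis
  define D where "D n x = (cmod (F n x - F (Suc n) x))\<^sup>2" for n x
  have D: "D n \<in> Cc" for n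
    unfolding D_def by (intro Cc_norm_square Cc_diff F)
  define b where "b n h = \<delta> h * (LINT y|\<mu>K. D n (h, y))" for n h
  have b: "b n \<in> Cc" for n
    unfolding b_def by (intro Cc_mult(1) K.Cc_integrate_out D \<delta>_continuous)
  have b0: "0 \<le> b n h" for n h
    unfolding b_def D_def using less_imp_le[OF \<delta>_pos] by simp
  have b_eq: "sqrt (b n h) = sqrt (\<delta> h) * L2_norm \<mu>K (\<lambda>y. F n (h, y) - F (Suc n) (h, y))" for n h
    by (simp add: b_def D_def L2_norm_def real_sqrt_mult)
  have "AE h in \<mu>H. summable (\<lambda>n. sqrt (b n h))"
  proof (rule AE_summable_weighted_squares)
    fix n
    show "(\<lambda>h. sqrt (b n h)) \<in> borel_measurable \<mu>H"
      by (intro H.measurable_continuous continuous_on_real_sqrt Cc_continuous b)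
    have "(\<integral>\<^sup>+h. ennreal ((sqrt (b n h))\<^sup>2) \<partial>\<mu>H) = ennreal (LINT h|\<mu>H. b n h)"
      using b0 by (simp add: nn_integral_eq_integral H.Cc_integrable b)
    also have "(LINT h|\<mu>H. b n h) = (L2_norm \<mu>G (\<lambda>x. F n x - F (Suc n) x))\<^sup>2"
      unfolding L2_norm_power2 using integral_G[OF D[of n]] by (simp add: b_def D_def)
    finally show "(\<integral>\<^sup>+h. ennreal ((sqrt (b n h))\<^sup>2) \<partial>\<mu>H) \<le> ennreal (C / 4 ^ n)"
      using C[of n] by (simp add: ennreal_leI)
  qed (use b0 in simp)
  then show ?thesis
  proof eventually_elim
    case (elim h)
    then have "summable (\<lambda>n. inverse (sqrt (\<delta> h)) * sqrt (b n h))"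
      by (rule summable_mult)
    moreover have "inverse (sqrt (\<delta> h)) * sqrt (b n h) = L2_norm \<mu>K (\<lambda>y. F n (h, y) - F (Suc n) (h, y))" for n
      unfolding b_eq using \<delta>_pos[of h] by simp
    ultimately show ?case by simp
  qed
qed

text \<open>The values of the transform at (h, k, \<omega>) only see f on the translate by k of a
  sigma-compact set carrying u. For k in a compact set these translates stay in one sigma-compact
  set X. Almost every section of f is, on X, the limit in L2 of the sections of F n, although
  the whole section may fail to be measurable for every h.\<close>

lemma gabor_transform_AE_limit:
  assumes u: "u \<in> L2 \<mu>K" and U: "\<And>n. U n \<in> Cc" "L2_fast \<mu>K U u"
    and F: "\<And>n. F n \<in> Cc" "L2_fast \<mu>G F f"
  shows "AE p in \<mu>GD. (\<lambda>n. \<V> (U n) (F n) p) \<longlonglongrightarrow> \<V> u f p"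
proof (rule GD.AE_local)
  fix C :: "('h \<times> 'k \<times> 'k dual) set" assume C: "compact C"
  define Q where "Q = fst ` snd ` C"
  have Q: "compact Q" unfolding Q_def by (intro compact_fst compact_snd C)
  have "\<exists>S. \<forall>j. compact (S j) \<and> (\<forall>x. x \<notin> S j \<longrightarrow> U j x = 0)"
    using U(1) unfolding Cc_def by (intro choice) auto
  then obtain S where S: "\<And>j. compact (S j)" "\<And>j x. x \<notin> S j \<Longrightarrow> U j x = 0" by blast
  define Y where "Y j = (\<lambda>p. fst p + snd p) ` (Q \<times> S j)" for j
  have Y: "compact (Y j)" for j
    unfolding Y_def by (intro compact_continuous_image compact_Times Q S continuous_intros)
  define X where "X = (\<Union>j. Y j)"
  have X: "X \<in> sets \<mu>K"
    unfolding X_def using K.sets_compact[OF Y] by (intro sets.countable_UN'') auto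
  define N where "N = {p. \<not> (\<lambda>n. F n p) \<longlonglongrightarrow> f p}"
  have N: "N \<in> null_sets \<mu>G"
    unfolding N_def using L2_fast_AE[OF F(2)] by (simp add: G.AE_iff_null_set)
  have "AE h in \<mu>H. \<forall>j. {y\<in>Y j. (h, y) \<in> N} \<in> null_sets \<mu>K"
    unfolding AE_all_countable using AE_null_sections[OF N Y] by blast
  then have "AE h in \<mu>H. (\<forall>j. {y\<in>Y j. (h, y) \<in> N} \<in> null_sets \<mu>K) \<and>
      summable (\<lambda>n. L2_norm \<mu>K (\<lambda>y. F n (h, y) - F (Suc n) (h, y)))"
    using AE_sections_summable[OF F] by eventually_elim simp
  then have "{h. \<not> ((\<forall>j. {y\<in>Y j. (h, y) \<in> N} \<in> null_sets \<mu>K) \<and>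
      summable (\<lambda>n. L2_norm \<mu>K (\<lambda>y. F n (h, y) - F (Suc n) (h, y))))} \<in> null_sets \<mu>H"
    by (simp only: H.AE_iff_null_set)
  from null_cylinder[OF this]
  have "AE p in \<mu>GD. (\<forall>j. {y\<in>Y j. (fst p, y) \<in> N} \<in> null_sets \<mu>K) \<and>
      summable (\<lambda>n. L2_norm \<mu>K (\<lambda>y. F n (fst p, y) - F (Suc n) (fst p, y)))"
    unfolding GD.AE_iff_null_set by (simp only: vimage_def mem_Collect_eq)
  then show "AE p in \<mu>GD. p \<in> C \<longrightarrow>
      (\<lambda>n. \<V> (U n) (F n) p) \<longlonglongrightarrow> \<V> u f p"
  proof eventually_elim
    case (elim p)
    show ?case
    proof
      assume p: "p \<in> C"
      obtain h k \<omega> where hk: "p = (h, k, \<omega>)" by (metis prod_cases3)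
      have k: "k \<in> Q" using p hk unfolding Q_def by force
      define g where "g y = indicator X y * f (h, y)" for y
      define G where "G n y = indicator X y * F n (h, y)" for n y
      define t where "t y = char_eval \<omega> y * u (y - k)" for y
      define t' where "t' n y = char_eval \<omega> y * U n (y - k)" for n y
      note [measurable] = X K.measurable_continuous[OF char_eval_continuous[of \<omega>]]
      have sF: "(\<lambda>y. F n (h, y)) \<in> L2 \<mu>K" for n
        by (intro K.Cc_L2 K.Cc_section F)
      note [measurable] = L2_measurable[OF sF]
      have mG [measurable]: "G n \<in> borel_measurable \<mu>K" for n
        unfolding G_def by measurable
      have G: "G n \<in> L2 \<mu>K" for n
        by (rule L2_norm_mono(1)[OF sF[of n] mG]) (simp add: G_def norm_mult split: split_indicator)
      have Gdiff: "L2_norm \<mu>K (\<lambda>y. G m y - G n y) \<le> L2_norm \<mu>K (\<lambda>y. F m (h, y) - F n (h, y))" for m n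
        by (rule L2_norm_mono(2)[OF L2_diff[OF sF sF]]) (auto simp: G_def split: split_indicator)
      have cauchy: "\<exists>N. \<forall>m\<ge>N. \<forall>n\<ge>N. L2_norm \<mu>K (\<lambda>y. G m y - G n y) < e" if e: "0 < e" for e
      proof -
        have "summable (\<lambda>n. L2_norm \<mu>K (\<lambda>y. F n (h, y) - F (Suc n) (h, y)))"
          using elim by (simp add: hk)
        from L2_summable_imp_Cauchy[where F = "\<lambda>n y. F n (h, y)", OF sF this e]
        obtain N where "\<forall>m\<ge>N. \<forall>n\<ge>N. L2_norm \<mu>K (\<lambda>y. F m (h, y) - F n (h, y)) < e" by blast
        then show ?thesis using le_less_trans[OF Gdiff] by blast
      qed
      have lim: "AE y in \<mu>K. (\<lambda>n. G n y) \<longlonglongrightarrow> g y"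
        unfolding K.AE_iff_null_set
      proof (rule K.complete2)
        have "\<And>j. {y\<in>Y j. (h, y) \<in> N} \<in> null_sets \<mu>K" using elim by (simp add: hk)
        then show "(\<Union>j. {y\<in>Y j. (h, y) \<in> N}) \<in> null_sets \<mu>K" by (intro null_sets_UN')  auto
        show "{y. \<not> (\<lambda>n. G n y) \<longlonglongrightarrow> g y} \<subseteq> (\<Union>j. {y\<in>Y j. (h, y) \<in> N})"
        proof
          fix y assume "y \<in> {y. \<not> (\<lambda>n. G n y) \<longlonglongrightarrow> g y}"
          then have y: "\<not> (\<lambda>n. G n y) \<longlonglongrightarrow> g y" by simp
          have "y \<in> X"
          proof (rule ccontr)
            assume "y \<notin> X"
            then show False using y by (simp add: G_def g_def)
          qed
          moreover have "(h, y) \<in> N"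
            using y \<open>y \<in> X\<close> by (simp add: G_def g_def N_def)
          ultimately show "y \<in> (\<Union>j. {y\<in>Y j. (h, y) \<in> N})" by (auto simp: X_def)
        qed
      qed
      have mg: "g \<in> borel_measurable \<mu>K"
        by (rule K.measurable_AE_limit[OF mG lim])
      note g = L2_limit_of_AE_limit[OF G cauchy lim mg]
      have modulate: "(\<lambda>y. char_eval \<omega> y * v (y - k)) \<in> L2 \<mu>K"
          "L2_norm \<mu>K (\<lambda>y. char_eval \<omega> y * v (y - k)) = L2_norm \<mu>K v" if v: "v \<in> L2 \<mu>K" for v
      proof -
        note [measurable] = L2_measurable[OF K.L2_translation(1)[OF v, of k]]
        show "(\<lambda>y. char_eval \<omega> y * v (y - k)) \<in> L2 \<mu>K"
          by (rule L2_norm_mono(1)[OF K.L2_translation(1)[OF v, of k]]) (measurable, simp add: norm_mult)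
        show "L2_norm \<mu>K (\<lambda>y. char_eval \<omega> y * v (y - k)) = L2_norm \<mu>K v"
          using K.L2_translation(2)[OF v, of k] by (simp add: L2_norm_def norm_mult)
      qed
      have LU: "U n \<in> L2 \<mu>K" for n by (rule K.Cc_L2[OF U(1)])
      have t: "t \<in> L2 \<mu>K" unfolding t_def by (rule modulate[OF u])
      have t': "t' n \<in> L2 \<mu>K" for n unfolding t'_def by (rule modulate[OF LU])
      have "L2_norm \<mu>K (\<lambda>y. t' n y - t y) = L2_norm \<mu>K (\<lambda>y. U n y - u y)" for n
        using modulate(2)[OF L2_diff[OF LU u], of n] by (simp add: t_def t'_def right_diff_distrib)
      then have t_lim: "(\<lambda>n. L2_norm \<mu>K (\<lambda>y. t' n y - t y)) \<longlonglongrightarrow> 0"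
        using L2_fast_tendsto[OF U(2)] by simp
      have shift: "y - k \<notin> S j" if "y \<notin> X" for y j
      proof
        assume "y - k \<in> S j"
        then have "y \<in> Y j" unfolding Y_def using k by (intro image_eqI[of _ _ "(k, y - k)"]) auto
        then show False using that by (auto simp: X_def)
      qed
      have inner': "L2_inner \<mu>K (G n) (t' n) = L2_inner \<mu>K (\<lambda>y. F n (h, y)) (t' n)" for n
        unfolding L2_inner_def
      proof (rule Bochner_Integration.integral_cong[OF refl])
        fix y
        show "G n y * cnj (t' n y) = F n (h, y) * cnj (t' n y)"
          using S(2)[OF shift[of y n]] by (cases "y \<in> X") (simp_all add: G_def t'_def)
      qed
      have "AE x in \<mu>K. x \<notin> (\<Union>j. S j) \<longrightarrow> u x = 0"
        using L2_fast_AE[OF U(2)]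
      proof eventually_elim
        case (elim x)
        show ?case
        proof
          assume "x \<notin> (\<Union>j. S j)"
          then have "\<And>n. U n x = 0" using S(2) by simp
          then show "u x = 0" using elim by (simp add: LIMSEQ_const_iff)
        qed
      qed
      from K.AE_translation[OF this, of k]
      have eq: "AE y in \<mu>K. g y * cnj (t y) = f (h, y) * cnj (t y)"
      proof eventually_elim
        case (elim y)
        then show ?case
          using shift[of y] by (cases "y \<in> X") (auto simp: g_def t_def)
      qed
      have mgt: "(\<lambda>y. g y * cnj (t y)) \<in> borel_measurable \<mu>K"
        using L2_inner_Cauchy_Schwarz(1)[OF g(1) t] by (rule borel_measurable_integrable)
      have inner: "L2_inner \<mu>K g t = L2_inner \<mu>K (\<lambda>y. f (h, y)) t"
        unfolding L2_inner_def
        by (rule integral_cong_AE[OF mgt K.measurable_AE_cong[OF mgt eq] eq])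
      have "(\<lambda>n. L2_inner \<mu>K (G n) (t' n)) \<longlonglongrightarrow> L2_inner \<mu>K g t"
        by (rule L2_inner_tendsto[OF G g t' t t_lim])
      then have "(\<lambda>n. complex_of_real (sqrt (\<delta> h)) * L2_inner \<mu>K (\<lambda>y. F n (h, y)) (t' n))
          \<longlonglongrightarrow> complex_of_real (sqrt (\<delta> h)) * L2_inner \<mu>K (\<lambda>y. f (h, y)) t"
        unfolding inner inner' by (rule tendsto_mult[OF tendsto_const])
      then show "(\<lambda>n. \<V> (U n) (F n) p) \<longlonglongrightarrow> \<V> u f p"
        by (simp add: hk gabor_transform_def tf_shift_def t_def[abs_def] t'_def[abs_def])
    qed
  qed
qed

text \<open>The approximants form a Cauchy sequence by the isometry on Cc, applied to differences in either
  argument; the almost everywhere limit is then also the limit in L2.\<close>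

lemma gabor_transform_L2:
  assumes u: "u \<in> L2 \<mu>K" and f: "f \<in> L2 \<mu>G"
  shows "\<V> u f \<in> L2 \<mu>GD"
    "L2_norm \<mu>GD (\<V> u f) = L2_norm \<mu>K u * L2_norm \<mu>G f"
proof -
  obtain U where U: "\<And>n::nat. U n \<in> Cc" "L2_fast \<mu>K U u"
    using K.Cc_dense_fast[OF u] by metis
  obtain F where F: "\<And>n::nat. F n \<in> Cc" "L2_fast \<mu>G F f"
    using G.Cc_dense_fast[OF f] by metis
  define V where "V n = \<V> (U n) (F n)" for n
  have V: "V n \<in> L2 \<mu>GD" "L2_norm \<mu>GD (V n) = L2_norm \<mu>K (U n) * L2_norm \<mu>G (F n)" for n
    unfolding V_def by (rule gabor_transform_Cc[OF F(1) U(1)])+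
  have LU: "U n \<in> L2 \<mu>K" and LF: "F n \<in> L2 \<mu>G" for n
    by (rule K.Cc_L2[OF U(1)], rule G.Cc_L2[OF F(1)])
  have limU: "(\<lambda>n. L2_norm \<mu>K (U n)) \<longlonglongrightarrow> L2_norm \<mu>K u"
    by (rule L2_norm_tendsto[OF LU u L2_fast_tendsto[OF U(2)]])
  have limF: "(\<lambda>n. L2_norm \<mu>G (F n)) \<longlonglongrightarrow> L2_norm \<mu>G f"
    by (rule L2_norm_tendsto[OF LF f L2_fast_tendsto[OF F(2)]])
  obtain A where A: "\<And>n. L2_norm \<mu>K (U n) \<le> A"
    using Bseq_bdd_above[OF convergent_imp_Bseq[OF convergentI[OF limU]]] by (auto simp: bdd_above_def)
  obtain B where B: "\<And>n. L2_norm \<mu>G (F n) \<le> B"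
    using Bseq_bdd_above[OF convergent_imp_Bseq[OF convergentI[OF limF]]] by (auto simp: bdd_above_def)
  have step: "L2_norm \<mu>GD (\<lambda>p. V n p - V (Suc n) p)
      \<le> A * L2_norm \<mu>G (\<lambda>x. F n x - F (Suc n) x) + L2_norm \<mu>K (\<lambda>x. U n x - U (Suc n) x) * B" for n
  proof -
    define D where "D = (\<lambda>x. F n x - F (Suc n) x)"
    define E where "E = (\<lambda>x. U n x - U (Suc n) x)"
    have D: "D \<in> Cc" and E: "E \<in> Cc" unfolding D_def E_def by (intro Cc_diff F U)+
    have "(\<lambda>p. V n p - V (Suc n) p) = (\<lambda>p. \<V> (U n) D p + \<V> E (F (Suc n)) p)"
      unfolding V_def D_def E_def
      by (simp add: gabor_transform_Cc_diff[OF F(1) F(1) U(1)] gabor_transform_Cc_window_diff[OF F(1) U(1) U(1)])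
    then have "L2_norm \<mu>GD (\<lambda>p. V n p - V (Suc n) p)
        \<le> L2_norm \<mu>GD (\<V> (U n) D) + L2_norm \<mu>GD (\<V> E (F (Suc n)))"
      using L2_norm_triangle[OF gabor_transform_Cc(1)[OF D U(1)] gabor_transform_Cc(1)[OF F(1) E]] by simp
    also have "\<dots> = L2_norm \<mu>K (U n) * L2_norm \<mu>G D + L2_norm \<mu>K E * L2_norm \<mu>G (F (Suc n))"
      by (simp only: gabor_transform_Cc(2)[OF D U(1)] gabor_transform_Cc(2)[OF F(1) E])
    also have "\<dots> \<le> A * L2_norm \<mu>G D + L2_norm \<mu>K E * B"
      by (intro add_mono mult_right_mono mult_left_mono A B L2_norm_nonneg)
    finally show ?thesis by (simp only: D_def E_def)
  qed
  have "summable (\<lambda>n. A * L2_norm \<mu>G (\<lambda>x. F n x - F (Suc n) x) + L2_norm \<mu>K (\<lambda>x. U n x - U (Suc n) x) * B)"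
    by (intro summable_add summable_mult summable_mult2 L2_fast_summable[OF F(2)] L2_fast_summable[OF U(2)])
  then have sm: "summable (\<lambda>n. L2_norm \<mu>GD (\<lambda>p. V n p - V (Suc n) p))"
    by (rule summable_comparison_test') (use step in simp)
  have ae: "AE p in \<mu>GD. (\<lambda>n. V n p) \<longlonglongrightarrow> \<V> u f p"
    unfolding V_def by (rule gabor_transform_AE_limit[OF u U F])
  have m: "\<V> u f \<in> borel_measurable \<mu>GD"
    by (rule GD.measurable_AE_limit[OF L2_measurable[OF V(1)] ae])
  note lim = L2_limit_of_AE_limit[OF V(1) L2_summable_imp_Cauchy[where F = V, OF V(1) sm] ae m]
  show "\<V> u f \<in> L2 \<mu>GD" by (rule lim)
  have "(\<lambda>n. L2_norm \<mu>GD (V n)) \<longlonglongrightarrow> L2_norm \<mu>GD (\<V> u f)"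
    by (rule L2_norm_tendsto[OF V(1) lim])
  moreover have "(\<lambda>n. L2_norm \<mu>GD (V n)) \<longlonglongrightarrow> L2_norm \<mu>K u * L2_norm \<mu>G f"
    unfolding V(2) by (intro tendsto_mult limU limF)
  ultimately show "L2_norm \<mu>GD (\<V> u f) = L2_norm \<mu>K u * L2_norm \<mu>G f"
    by (rule LIMSEQ_unique)
qed

lemma gabor_transform_add:
  assumes u: "u \<in> L2 \<mu>K" and f: "f \<in> L2 \<mu>G" and g: "g \<in> L2 \<mu>G"
  shows "AE p in \<mu>GD. \<V> u (\<lambda>x. f x + g x) p = \<V> u f p + \<V> u g p"
proof -
  obtain U where U: "\<And>n::nat. U n \<in> Cc" "L2_fast \<mu>K U u"
    using K.Cc_dense_fast[OF u] by metis
  obtain F where F: "\<And>n::nat. F n \<in> Cc" "L2_fast \<mu>G F f"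
    using G.Cc_dense_fast[OF f] by metis
  obtain E where E: "\<And>n::nat. E n \<in> Cc" "L2_fast \<mu>G E g"
    using G.Cc_dense_fast[OF g] by metis
  have "AE p in \<mu>GD. (\<lambda>n. \<V> (U n) (\<lambda>x. F n x + E n x) p) \<longlonglongrightarrow> \<V> u (\<lambda>x. f x + g x) p"
    by (rule gabor_transform_AE_limit[OF u U Cc_add[OF F(1) E(1)] L2_fast_add[OF F(2) E(2)]])
  with gabor_transform_AE_limit[OF u U F] gabor_transform_AE_limit[OF u U E]
  show ?thesis
  proof eventually_elim
    case (elim p)
    have "(\<lambda>n. \<V> (U n) (\<lambda>x. F n x + E n x) p)
        \<longlonglongrightarrow> \<V> u f p + \<V> u g p"
      unfolding gabor_transform_Cc_add[OF F(1) E(1) U(1)] by (rule tendsto_add[OF elim(1,2)])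
    with elim(3) show ?case by (rule LIMSEQ_unique)
  qed
qed

lemma gabor_transform_diff:
  assumes u: "u \<in> L2 \<mu>K" and f: "f \<in> L2 \<mu>G" and g: "g \<in> L2 \<mu>G"
  shows "L2_norm \<mu>GD (\<lambda>p. \<V> u f p - \<V> u g p)
    = L2_norm \<mu>K u * L2_norm \<mu>G (\<lambda>x. f x - g x)"
proof -
  have "AE p in \<mu>GD. \<V> u (\<lambda>x. f x + (-1) * g x) p
      = \<V> u f p + \<V> u (\<lambda>x. (-1) * g x) p"
    by (rule gabor_transform_add[OF u f L2_cmult(1)[OF g]])
  then have ae: "AE p in \<mu>GD. \<V> u (\<lambda>x. f x - g x) p = \<V> u f p - \<V> u g p"
    unfolding gabor_transform_cmult by simp
  have fg: "(\<lambda>x. f x - g x) \<in> L2 \<mu>G" by (rule L2_diff[OF f g])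
  have m: "(\<lambda>p. \<V> u f p - \<V> u g p) \<in> borel_measurable \<mu>GD"
    by (intro L2_measurable L2_diff gabor_transform_L2 u f g)
  show ?thesis
    using L2_AE_cong(2)[OF gabor_transform_L2(1)[OF u fg] m ae] gabor_transform_L2(2)[OF u fg] by simp
qed

lemma L2_isometry_gabor_transform:
  assumes u: "u \<in> L2 \<mu>K" and nz: "L2_norm \<mu>K u \<noteq> 0"
  shows "L2_isometry \<mu>G \<mu>GD (\<lambda>f p. complex_of_real (inverse (L2_norm \<mu>K u)) * \<V> u f p)"
  unfolding L2_isometry_def
proof (intro conjI ballI allI)
  fix f assume f: "f \<in> L2 \<mu>G"
  show "(\<lambda>p. complex_of_real (inverse (L2_norm \<mu>K u)) * \<V> u f p) \<in> L2 \<mu>GD"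
    by (intro L2_cmult gabor_transform_L2 u f)
  show "L2_norm \<mu>GD (\<lambda>p. complex_of_real (inverse (L2_norm \<mu>K u)) * \<V> u f p) = L2_norm \<mu>G f"
    unfolding L2_cmult(2)[OF gabor_transform_L2(1)[OF u f]] gabor_transform_L2(2)[OF u f] norm_of_real
    using nz by (simp add: abs_of_nonneg)
  fix c
  show "AE p in \<mu>GD. complex_of_real (inverse (L2_norm \<mu>K u)) * \<V> u (\<lambda>y. c * f y) p
      = c * (complex_of_real (inverse (L2_norm \<mu>K u)) * \<V> u f p)"
    by (simp add: gabor_transform_cmult)
next
  fix f g assume f: "f \<in> L2 \<mu>G" and g: "g \<in> L2 \<mu>G"
  show "AE p in \<mu>GD. complex_of_real (inverse (L2_norm \<mu>K u)) * \<V> u (\<lambda>y. f y + g y) p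
      = complex_of_real (inverse (L2_norm \<mu>K u)) * \<V> u f p
        + complex_of_real (inverse (L2_norm \<mu>K u)) * \<V> u g p"
    using gabor_transform_add[OF u f g] by eventually_elim (simp add: distrib_left)
qed

lemma nonzero_window: "\<exists>v\<in>L2 \<mu>K. L2_norm \<mu>K v \<noteq> 0"
proof -
  obtain \<phi> :: "'k \<Rightarrow> real" where \<phi>: "\<phi> \<in> Cc" "(LINT x|\<mu>K. \<phi> x) > 0"
    using K.Cc_integral_pos by metis
  have L: "(\<lambda>x. complex_of_real (\<phi> x)) \<in> L2 \<mu>K"
    by (intro K.Cc_L2 Cc_of_real \<phi>)
  have "L2_norm \<mu>K (\<lambda>x. complex_of_real (\<phi> x)) \<noteq> 0"
  proof
    assume "L2_norm \<mu>K (\<lambda>x. complex_of_real (\<phi> x)) = 0"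
    then have "AE x in \<mu>K. \<phi> x = 0"
      using L2_norm_eq_0[OF L] by simp
    then have "(LINT x|\<mu>K. \<phi> x) = 0" by (rule integral_eq_zero_AE)
    then show False using \<phi>(2) by simp
  qed
  then show ?thesis using L by blast
qed

text \<open>For a null window the factor is 0, and an isometry is supplied by any other window.\<close>

lemma multiple_of_L2_isometry_gabor_transform:
  assumes u: "u \<in> L2 \<mu>K"
  shows "multiple_of_L2_isometry \<mu>G \<mu>GD (\<V> u)"
proof (cases "L2_norm \<mu>K u = 0")
  case True
  obtain v where v: "v \<in> L2 \<mu>K" "L2_norm \<mu>K v \<noteq> 0" using nonzero_window by blast
  have zero: "AE p in \<mu>GD. \<V> u f p = 0" if f: "f \<in> L2 \<mu>G" for f
    using gabor_transform_L2[OF u f] True L2_norm_eq_0 by (metis mult_zero_left)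
  show ?thesis
    unfolding multiple_of_L2_isometry_def
    by (rule exI[of _ 0], rule exI, rule conjI, rule L2_isometry_gabor_transform[OF v]) (simp add: zero)
next
  case False
  show ?thesis
    unfolding multiple_of_L2_isometry_def
    by (rule exI[of _ "complex_of_real (L2_norm \<mu>K u)"], rule exI, rule conjI,
        rule L2_isometry_gabor_transform[OF u False]) (use False in simp)
qed

text \<open>A multiple of an isometry with nonzero factor pulls Cauchy sequences back to Cauchy sequences, and the
  L2 space of the semi-direct product is complete.\<close>

lemma L2_closed_subspace_gabor_transform:
  assumes u: "u \<in> L2 \<mu>K"
  shows "L2_closed_subspace \<mu>GD (\<V> u ` L2 \<mu>G)"
  unfolding L2_closed_subspace_def
proof (intro conjI allI ballI impI)
  let ?V = "\<V> u"
  note V = gabor_transform_L2[OF u]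
  show "?V ` L2 \<mu>G \<subseteq> L2 \<mu>GD" using V(1) by blast
  have zero: "?V (\<lambda>x. 0) p = 0" for p
    unfolding gabor_transform_eq by simp
  show "\<exists>z\<in>?V ` L2 \<mu>G. AE x in \<mu>GD. z x = 0"
    by (intro bexI[of _ "?V (\<lambda>x. 0)"]) (simp_all add: zero)
  fix f assume "f \<in> ?V ` L2 \<mu>G"
  then obtain f' where f: "f' \<in> L2 \<mu>G" "f = ?V f'" by blast
  show "\<exists>s\<in>?V ` L2 \<mu>G. AE x in \<mu>GD. s x = c * f x" for c
    using L2_cmult(1)[OF f(1), of c] by (intro bexI[of _ "?V (\<lambda>x. c * f' x)"]) (simp_all add: f gabor_transform_cmult)
  fix g assume "g \<in> ?V ` L2 \<mu>G"
  then obtain g' where g: "g' \<in> L2 \<mu>G" "g = ?V g'" by blast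
  show "\<exists>s\<in>?V ` L2 \<mu>G. AE x in \<mu>GD. s x = f x + g x"
    using gabor_transform_add[OF u f(1) g(1)] L2_add[OF f(1) g(1)]
    by (intro bexI[of _ "?V (\<lambda>x. f' x + g' x)"]) (simp_all add: f g)
next
  let ?V = "\<V> u"
  note V = gabor_transform_L2[OF u]
  fix F :: "nat \<Rightarrow> _" and g
  assume g: "g \<in> L2 \<mu>GD" and F: "(\<forall>n. F n \<in> ?V ` L2 \<mu>G) \<and> (\<lambda>n. L2_norm \<mu>GD (\<lambda>x. F n x - g x)) \<longlonglongrightarrow> 0"
  then have "\<forall>n. \<exists>f. f \<in> L2 \<mu>G \<and> F n = ?V f" by blast
  then obtain \<phi> where \<phi>: "\<And>n. \<phi> n \<in> L2 \<mu>G" "\<And>n. F n = ?V (\<phi> n)" by metis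
  have lim: "(\<lambda>n. L2_norm \<mu>GD (\<lambda>x. ?V (\<phi> n) x - g x)) \<longlonglongrightarrow> 0"
    using F by (simp add: \<phi>(2))
  have "\<exists>f\<in>L2 \<mu>G. (\<lambda>n. L2_norm \<mu>GD (\<lambda>x. ?V (\<phi> n) x - ?V f x)) \<longlonglongrightarrow> 0"
  proof (cases "L2_norm \<mu>K u = 0")
    case True
    then have "(\<lambda>n. L2_norm \<mu>GD (\<lambda>x. ?V (\<phi> n) x - ?V (\<lambda>x. 0) x)) \<longlonglongrightarrow> 0"
      by (simp add: gabor_transform_diff[OF u \<phi>(1) L2_zero(1)])
    then show ?thesis by (rule bexI[OF _ L2_zero(1)])
  next
    case False
    then have c: "0 < L2_norm \<mu>K u" using L2_norm_nonneg[of \<mu>K u] by linarith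
    obtain f where f: "f \<in> L2 \<mu>G" "(\<lambda>n. L2_norm \<mu>G (\<lambda>x. \<phi> n x - f x)) \<longlonglongrightarrow> 0"
    proof (rule Riesz_Fischer[OF \<phi>(1)])
      fix e :: real assume "0 < e"
      then have "0 < e * L2_norm \<mu>K u / 2" using c by simp
      from LIMSEQ_D[OF lim this] obtain N where
        N: "\<And>n. N \<le> n \<Longrightarrow> L2_norm \<mu>GD (\<lambda>x. ?V (\<phi> n) x - g x) < e * L2_norm \<mu>K u / 2" by auto
      have "L2_norm \<mu>G (\<lambda>x. \<phi> m x - \<phi> n x) < e" if "N \<le> m" "N \<le> n" for m n
      proof -
        have "L2_norm \<mu>K u * L2_norm \<mu>G (\<lambda>x. \<phi> m x - \<phi> n x) = L2_norm \<mu>GD (\<lambda>x. ?V (\<phi> m) x - ?V (\<phi> n) x)"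
          by (rule gabor_transform_diff[OF u \<phi>(1) \<phi>(1), symmetric])
        also have "\<dots> \<le> L2_norm \<mu>GD (\<lambda>x. ?V (\<phi> m) x - g x) + L2_norm \<mu>GD (\<lambda>x. g x - ?V (\<phi> n) x)"
          by (rule L2_norm_diff_triangle[OF V(1)[OF \<phi>(1)] g V(1)[OF \<phi>(1)]])
        also have "\<dots> < L2_norm \<mu>K u * e"
          using N[OF that(1)] N[OF that(2)] L2_norm_minus_commute[of \<mu>GD g "?V (\<phi> n)"] by (simp add: mult.commute)
        finally show ?thesis using c by simp
      qed
      then show "\<exists>N. \<forall>m\<ge>N. \<forall>n\<ge>N. L2_norm \<mu>G (\<lambda>x. \<phi> m x - \<phi> n x) < e" by blast
    qed metis
    have "(\<lambda>n. L2_norm \<mu>K u * L2_norm \<mu>G (\<lambda>x. \<phi> n x - f x)) \<longlonglongrightarrow> L2_norm \<mu>K u * 0"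
      by (intro tendsto_mult tendsto_const f)
    then have "(\<lambda>n. L2_norm \<mu>GD (\<lambda>x. ?V (\<phi> n) x - ?V f x)) \<longlonglongrightarrow> 0"
      by (simp add: gabor_transform_diff[OF u \<phi>(1) f(1)])
    then show ?thesis by (rule bexI[OF _ f(1)])
  qed
  then obtain f where f: "f \<in> L2 \<mu>G" "(\<lambda>n. L2_norm \<mu>GD (\<lambda>x. ?V (\<phi> n) x - ?V f x)) \<longlonglongrightarrow> 0" by blast
  have "L2_norm \<mu>GD (\<lambda>x. ?V f x - g x) \<le> L2_norm \<mu>GD (\<lambda>x. ?V (\<phi> n) x - ?V f x) + L2_norm \<mu>GD (\<lambda>x. ?V (\<phi> n) x - g x)" for n
    using L2_norm_diff_triangle[OF V(1)[OF f(1)] V(1)[OF \<phi>(1)] g, of n] L2_norm_minus_commute[of \<mu>GD "?V f" "?V (\<phi> n)"]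
    by simp
  then have "L2_norm \<mu>GD (\<lambda>x. ?V f x - g x) \<le> 0 + 0"
    by (intro LIMSEQ_le_const[OF tendsto_add[OF f(2) lim]]) auto
  then have "L2_norm \<mu>GD (\<lambda>x. ?V f x - g x) = 0"
    using L2_norm_nonneg[of \<mu>GD "\<lambda>x. ?V f x - g x"] by simp
  then have "AE x in \<mu>GD. ?V f x - g x = 0"
    using L2_norm_eq_0[OF L2_diff[OF V(1)[OF f(1)] g]] by simp
  then show "\<exists>s\<in>?V ` L2 \<mu>G. AE x in \<mu>GD. s x = g x"
    using f(1) by (intro bexI[of _ "?V f"]) auto
qed

end

theorem theorem3p4:
  fixes \<mu>H :: "'h::{topological_group_add, t2_space} measure"
    and \<mu>K :: "'k::{topological_ab_group_add, t2_space} measure"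
    and \<nu> :: "'k dual measure"
    and \<tau> :: "'h \<Rightarrow> 'k \<Rightarrow> 'k"
    and \<delta> :: "'h \<Rightarrow> real"
    and \<mu>G :: "('h \<times> 'k) measure"
    and \<mu>GD :: "('h \<times> 'k \<times> 'k dual) measure"
    and u :: "'k \<Rightarrow> complex"
  assumes "locally_compact_space (euclidean :: 'h topology)"
    and "locally_compact_space (euclidean :: 'k topology)"
    and "left_haar_measure (+) \<mu>H"
    and "left_haar_measure (+) \<mu>K"
    and "plancherel_measure \<mu>K \<nu>"
    and "continuous_hom_to_Aut \<tau>"
    and "is_modulus \<mu>K \<tau> \<delta>"
    and "haar_semidirect \<mu>H \<mu>K \<tau> \<delta> \<mu>G"
    and "haar_semidirect_dual \<mu>H \<mu>K \<nu> \<tau> \<mu>GD"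
    and "u \<in> L2 \<mu>K"
  shows "(\<forall>f\<in>L2 \<mu>G. gabor_transform \<mu>K \<delta> u f \<in> L2 \<mu>GD) \<and>
    multiple_of_L2_isometry \<mu>G \<mu>GD (gabor_transform \<mu>K \<delta> u) \<and>
    L2_closed_subspace \<mu>GD (gabor_transform \<mu>K \<delta> u ` L2 \<mu>G)"
proof -
  interpret gabor \<mu>H \<mu>K \<nu> \<tau> \<delta> \<mu>G \<mu>GD
    using assms(3,4,5,7,8,9) by unfold_locales
  show ?thesis
    using gabor_transform_L2(1)[OF assms(10)] multiple_of_L2_isometry_gabor_transform[OF assms(10)]
      L2_closed_subspace_gabor_transform[OF assms(10)] by blast
qed

end
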